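(* Let $A$ be the adjacency matrix of a graph drawn from the Watts–Strogatz model ${\sf WS}(n,k,\beta)$ with hidden permutation $\pi$, where $k=k(n)$ and $\beta=\beta(n)$. For each node $v_i$, let $\mathcal{N}(v_i)$ be its true ring neighborhood and let $\hat{\mathcal{N}}(v_i)$ be the output of the spectral ordering procedure (both defined in the context). Assume that $k$ is large enough in the sense that $$1>\varlimsup_{n,k(n)\to\infty}\frac{\log k}{\log n}\ \ge\ \varliminf_{n,k(n)\to\infty}\frac{\log k}{\log n}>\frac78.$$ If $$1-\beta\ \succ\ \frac{n^{3.5}}{k^4},$$ then spectral ordering provides a consistent estimate of the neighborhood sets with high probability, in the sense that $$\lim_{n,k(n)\to\infty}\ \max_{i}\ \frac{|\hat{\mathcal{N}}(v_i)\,\triangle\,\mathcal{N}(v_i)|}{|\mathcal{N}(v_i)|}=0,$$ where the maximum is over all $n$ nodes and $\triangle$ denotes symmetric set difference; that is, there is a deterministic sequence $\varepsilon_n\to0$ such that, with probability tending to $1$, this maximum is at most $\varepsilon_n$.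
   Context: Parameters: $n$ is the number of nodes, $k$ (even) the neighborhood size, $\beta\in[0,1]$ the rewiring probability. Ring lattice matrix: $B\in\{0,1\}^{n\times n}$ is given by $B_{ij}=1$ if $i\ne j$ and the ring (circular) distance $\min(|i-j|,n-|i-j|)$ is at most $k/2$, and $B_{ij}=0$ otherwise. For a permutation $\pi$ of the $n$ nodes with permutation matrix $P_\pi$, the convention is $[P_\pi B P_\pi^T]_{ij}=B_{\pi^{-1}(i)\pi^{-1}(j)}$. ${\sf WS}(n,k,\beta)$ with hidden permutation $\pi$: the symmetric random adjacency matrix $A\in\{0,1\}^{n\times n}$ with zero diagonal whose entries $A_{ij}$, $i<j$, are independent, with $A_{ij}\sim{\sf Bernoulli}\left(1-\beta(1-\beta\frac{k}{n-1})\right)$ if $[P_\pi BP_\pi^T]_{ij}=1$ and $A_{ij}\sim{\sf Bernoulli}\left(\beta\frac{k}{n-1}\right)$ if $[P_\pi BP_\pi^T]_{ij}=0$. True neighborhood: $\mathcal{N}(v_i)$ is the set of nodes $v_j$ such that $j\ne i$ and the ring distance between $\pi^{-1}(i)$ and $\pi^{-1}(j)$ is at most $k/2$. Spectral ordering: compute the decomposition $A=U\Sigma U^T$ with eigenvalues in decreasing order, and let $u,v\in\mathbb{R}^n$ be the (orthonormal) eigenvectors for the second and third largest eigenvalues. For each node $v_i$ with column $A_{\cdot i}$ of $A$, let $\theta_i$ be the angle of the planar vector $(u^TA_{\cdot i},\,v^TA_{\cdot i})$. The sorted angles give a ring embedding of the nodes (node $v_i$ placed on the circle at angle $\theta_i$),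 and $\hat{\mathcal{N}}(v_i)$ is the set of the $k$ nodes other than $v_i$ closest to $v_i$ in this ring embedding, i.e. with angle closest to $\theta_i$ in circular distance (ties broken arbitrarily). Notation: $a(n)\succ b(n)$ means $\limsup_{n\to\infty}b(n)/a(n)=0$. *)

theory Defs
  imports "HOL-Probability.Probability" "Jordan_Normal_Form.Matrix"
begin

unbundle no m_inv_syntax

text \<open>Nodes are numbered \<open>0, \<dots>, n - 1\<close>. The ring distance depends only on differences, so
  it is the same as for the numbering \<open>1, \<dots>, n\<close>.\<close>

definition ring_dist :: "nat \<Rightarrow> nat \<Rightarrow> nat \<Rightarrow> int" where
  "ring_dist n i j = min \<bar>int i - int j\<bar> (int n - \<bar>int i - int j\<bar>)"

definition ring_lattice :: "nat \<Rightarrow> nat \<Rightarrow> real mat" where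
  "ring_lattice n k = Matrix.mat n n (\<lambda>(i, j).
     if i \<noteq> j \<and> real_of_int (ring_dist n i j) \<le> real k / 2 then 1 else 0)"

definition perm_matrix :: "nat \<Rightarrow> (nat \<Rightarrow> nat) \<Rightarrow> real mat" where
  "perm_matrix n \<pi> = Matrix.mat n n (\<lambda>(i, j). if i = \<pi> j then 1 else 0)"

definition permuted_lattice :: "nat \<Rightarrow> nat \<Rightarrow> (nat \<Rightarrow> nat) \<Rightarrow> real mat" where
  "permuted_lattice n k \<pi> =
     perm_matrix n \<pi> * ring_lattice n k * transpose_mat (perm_matrix n \<pi>)"

lemma permuted_lattice_index:
  assumes "\<pi> permutes {..<n}" "i < n" "j < n"
  shows "permuted_lattice n k \<pi> $$ (i, j) = ring_lattice n k $$ (inv \<pi> i, inv \<pi> j)"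
proof -
  have inv: "i = \<pi> l \<longleftrightarrow> l = inv \<pi> i" for i l
    using permutes_inverses[OF assms(1)] by metis
  have lt: "inv \<pi> i < n" "inv \<pi> j < n"
    using permutes_in_image[OF permutes_inv[OF assms(1)]] assms(2,3) by auto
  have row: "(perm_matrix n \<pi> * ring_lattice n k) $$ (i, l) = ring_lattice n k $$ (inv \<pi> i, l)"
    if "l < n" for l
    using that assms(2) lt
    by (simp add: perm_matrix_def ring_lattice_def scalar_prod_def inv if_distrib[of "\<lambda>x. x * _"]
          cong: if_cong)
  have "permuted_lattice n k \<pi> $$ (i, j) =
      (\<Sum>l\<in>{0..<n}. (perm_matrix n \<pi> * ring_lattice n k) $$ (i, l) * (if l = inv \<pi> j then 1 else 0))"
    using assms(2,3)
    by (simp add: permuted_lattice_def perm_matrix_def ring_lattice_def scalar_prod_def inv)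
  also have "\<dots> = ring_lattice n k $$ (inv \<pi> i, inv \<pi> j)"
    using row lt(2) by (simp add: if_distrib[of "\<lambda>x. _ * x"] cong: if_cong)
  finally show ?thesis .
qed

definition edge_prob :: "nat \<Rightarrow> nat \<Rightarrow> real \<Rightarrow> (nat \<Rightarrow> nat) \<Rightarrow> nat \<Rightarrow> nat \<Rightarrow> real" where
  "edge_prob n k \<beta> \<pi> i j =
     (if permuted_lattice n k \<pi> $$ (i, j) = 1
      then 1 - \<beta> * (1 - \<beta> * (real k / (real n - 1)))
      else \<beta> * (real k / (real n - 1)))"

text \<open>The law of the adjacency matrix: the pairs \<open>i < j\<close> carry independent coin flips, which are
  then written symmetrically into a matrix with zero diagonal.\<close>

definition WS :: "nat \<Rightarrow> nat \<Rightarrow> real \<Rightarrow> (nat \<Rightarrow> nat) \<Rightarrow> real mat pmf" where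
  "WS n k \<beta> \<pi> =
     map_pmf (\<lambda>E. Matrix.mat n n (\<lambda>(i, j).
                if i < j \<and> E (i, j) \<or> j < i \<and> E (j, i) then 1 else 0))
       (Pi_pmf {(i, j). i < j \<and> j < n} False (\<lambda>(i, j). bernoulli_pmf (edge_prob n k \<beta> \<pi> i j)))"

definition nbhd :: "nat \<Rightarrow> nat \<Rightarrow> (nat \<Rightarrow> nat) \<Rightarrow> nat \<Rightarrow> nat set" where
  "nbhd n k \<pi> i =
     {j \<in> {..<n}. j \<noteq> i \<and> real_of_int (ring_dist n (inv \<pi> i) (inv \<pi> j)) \<le> real k / 2}"

text \<open>A decomposition \<open>A = U \<Sigma> U\<^sup>T\<close> with \<open>U\<close> orthogonal and the eigenvalues in (weakly)
  decreasing order along the diagonal of \<open>\<Sigma>\<close>.\<close>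

definition spectral_decomposition :: "nat \<Rightarrow> real mat \<Rightarrow> real mat \<Rightarrow> (nat \<Rightarrow> real) \<Rightarrow> bool" where
  "spectral_decomposition n A U eig \<longleftrightarrow>
     U \<in> carrier_mat n n \<and>
     transpose_mat U * U = 1\<^sub>m n \<and> U * transpose_mat U = 1\<^sub>m n \<and>
     antimono_on {..<n} eig \<and>
     A = U * mat_diag n eig * transpose_mat U"

text \<open>Columns are counted from \<open>0\<close>, so the second and third eigenvectors are columns \<open>1\<close> and \<open>2\<close>.\<close>

definition spectral_angle :: "real mat \<Rightarrow> real mat \<Rightarrow> nat \<Rightarrow> real" where
  "spectral_angle A U i =
     Arg (Complex (scalar_prod (col U 1) (col A i)) (scalar_prod (col U 2) (col A i)))"

text \<open>Distance on the circle of angles taken in \<open>(-pi, pi]\<close>, the range of \<^const>\<open>Arg\<close>.\<close>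

definition angle_dist :: "real \<Rightarrow> real \<Rightarrow> real" where
  "angle_dist a b = min \<bar>a - b\<bar> (2 * pi - \<bar>a - b\<bar>)"

definition nearest_nodes :: "nat \<Rightarrow> nat \<Rightarrow> (nat \<Rightarrow> real) \<Rightarrow> nat \<Rightarrow> nat set \<Rightarrow> bool" where
  "nearest_nodes n k \<theta> i S \<longleftrightarrow>
     S \<subseteq> {..<n} - {i} \<and> card S = k \<and>
     (\<forall>j\<in>S. \<forall>l\<in>{..<n} - {i} - S. angle_dist (\<theta> i) (\<theta> j) \<le> angle_dist (\<theta> i) (\<theta> l))"

text \<open>A possible output of spectral ordering on \<open>A\<close>. Neither the eigenvectors nor the nearest nodes
  need be unique; every admissible choice counts as an output.\<close>

definition spectral_ordering :: "nat \<Rightarrow> nat \<Rightarrow> real mat \<Rightarrow> (nat \<Rightarrow> nat set) \<Rightarrow> bool" where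
  "spectral_ordering n k A Nhat \<longleftrightarrow>
     (\<exists>U eig. spectral_decomposition n A U eig \<and>
        (\<forall>i<n. nearest_nodes n k (spectral_angle A U) i (Nhat i)))"

definition max_nbhd_error :: "nat \<Rightarrow> nat \<Rightarrow> (nat \<Rightarrow> nat) \<Rightarrow> (nat \<Rightarrow> nat set) \<Rightarrow> real" where
  "max_nbhd_error n k \<pi> Nhat =
     (MAX i\<in>{..<n}. real (card (sym_diff (Nhat i) (nbhd n k \<pi> i))) / real (card (nbhd n k \<pi> i)))"

text \<open>The quotient is taken in \<^typ>\<open>ereal\<close>, where a positive number divided by \<open>0\<close> is \<open>\<infinity>\<close>. With
  real division (\<open>x / 0 = 0\<close>) the relation would hold for \<open>a = 0\<close>.\<close>

definition asymp_dominates :: "(nat \<Rightarrow> real) \<Rightarrow> (nat \<Rightarrow> real) \<Rightarrow> bool" (infix "\<succ>" 50) where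
  "a \<succ> b \<longleftrightarrow> limsup (\<lambda>n. ereal (b n) / ereal (a n)) = 0"

end

theory Submission
  imports Defs "HOL-Real_Asymp.Real_Asymp"
begin

text \<open>
  Write \<open>q = \<beta> k / (n - 1)\<close> and \<open>s = (1 - \<beta>) (1 - q)\<close>, so that a pair of lattice neighbors is joined with
  probability \<open>s + q\<close> and any other pair with probability \<open>q\<close>. Adding \<open>q\<close> to the diagonal of \<open>A\<close> changes
  no eigenvector and gives \<open>A + q I = M + W\<close>, where \<open>M = s B + q J\<close> (\<open>B\<close> the permuted ring lattice, \<open>J\<close> the
  all-ones matrix) and \<open>W\<close> is symmetric with independent centered entries above a zero diagonal.

  The harmonics \<open>cos (2 \<pi> m x / n)\<close> and \<open>sin (2 \<pi> m x / n)\<close> of the hidden position \<open>x\<close> are eigenvectors of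
  \<open>M\<close>; those with \<open>m = 0\<close> carry the top eigenvalue and those with \<open>m = 1\<close> the next two. The \<open>m = 1\<close> plane puts
  every node on the circle at its true place. Hence the order is right if the eigenvectors \<open>u\<close>, \<open>v\<close> of \<open>A\<close> agree
  with this plane entry by entry. A neighborhood is an arc of half-width \<open>\<pi> k / n\<close>, so the relative
  error of every entry must be \<open>o(k / n)\<close>.

  The \<open>m = 1\<close> eigenvalue is separated from the others by order \<open>s k\<^sup>3 / n\<^sup>2\<close>, while \<open>W\<close> has norm
  \<open>O(sqrt n)\<close>. The resulting \<open>L2\<close> distance of eigenspaces does not control single entries, so the
  equation \<open>\<lambda> u = M u + W u\<close> is used once per row.

  \<^item> The row of \<open>M u\<close> is expanded in harmonics. The coefficient of \<open>u\<close> along a harmonic \<open>f\<close> with eigenvalue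
    \<open>\<mu>\<close> is that of \<open>W u\<close> divided by \<open>\<lambda> - \<mu>\<close>. By Cauchy--Schwarz all harmonics other than \<open>m = 1\<close> contribute
    at most \<open>norm W / sqrt n\<close> times the square root of \<open>\<Sum> (\<mu> / (\<lambda> - \<mu>))\<^sup>2\<close>, which is \<open>O(n\<^sup>2 / k\<^sup>2)\<close>
    because the gaps grow like \<open>m\<^sup>2\<close>. Compared with the size \<open>s k / sqrt n\<close> of the main term this is a
    relative error \<open>n powr 2.5 / (s k\<^sup>3)\<close>, and \<open>1 - \<beta> \<succ> n powr 3.5 / k\<^sup>4\<close> says exactly that it is
    \<open>o(k / n)\<close>
    (\<open>row_bias_le\<close>, \<open>sum_ratio_power2\<close>).
  \<^item> In the row of \<open>W u\<close> the vector \<open>u\<close> depends on that row. Solving \<open>\<lambda> u = M u + W u\<close> by a Neumann series in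
    the matrix with this row and column removed leaves the row applied to vectors independent of
    it, to which Hoeffding's inequality applies; the outcome is \<open>O(sqrt (ln n))\<close>
    (\<open>row_noise_le\<close>, \<open>walk_noise_tail\<close>, \<open>entry_approx\<close>).

  What remains is planar: the two perturbed coordinates are a rotation or reflection of the true angles
  up to a uniform error (\<open>spectral_angle_near\<close>), and a uniform error in the distances misplaces only nodes
  near the two ends of an arc (\<open>nearest_nodes_error\<close>).
\<close>

section \<open>Vectors, operator norms and the row expansion\<close>

text \<open>Vectors are functions on \<open>nat\<close> of which only the values below \<open>n\<close> matter. This keeps \<open>n\<close> a plain
variable, as it has to be for a limit in \<open>n\<close>.\<close>
definition inn :: "nat \<Rightarrow> (nat \<Rightarrow> real) \<Rightarrow> (nat \<Rightarrow> real) \<Rightarrow> real" where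
  "inn n x y = (\<Sum>a<n. x a * y a)"

abbreviation nrm :: "nat \<Rightarrow> (nat \<Rightarrow> real) \<Rightarrow> real" where
  "nrm n x \<equiv> L2_set x {..<n}"

definition mv :: "nat \<Rightarrow> (nat \<Rightarrow> nat \<Rightarrow> real) \<Rightarrow> (nat \<Rightarrow> real) \<Rightarrow> nat \<Rightarrow> real" where
  "mv n W x a = (\<Sum>b<n. W a b * x b)"

definition opnorm_le :: "nat \<Rightarrow> (nat \<Rightarrow> nat \<Rightarrow> real) \<Rightarrow> real \<Rightarrow> bool" where
  "opnorm_le n W N \<longleftrightarrow> 0 \<le> N \<and> (\<forall>x y. \<bar>inn n x (mv n W y)\<bar> \<le> N * nrm n x * nrm n y)"

definition minor :: "nat \<Rightarrow> (nat \<Rightarrow> nat \<Rightarrow> real) \<Rightarrow> nat \<Rightarrow> nat \<Rightarrow> real" where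
  "minor i W a b = (if a = i \<or> b = i then 0 else W a b)"

lemma nrm_power2: "(nrm n x)\<^sup>2 = inn n x x"
  by (simp add: L2_set_def inn_def sum_nonneg power2_eq_square)

lemma inn_commute: "inn n x y = inn n y x"
  by (simp add: inn_def mult.commute)

lemma inn_cong: "(\<And>a. a < n \<Longrightarrow> x a = x' a) \<Longrightarrow> (\<And>a. a < n \<Longrightarrow> y a = y' a) \<Longrightarrow> inn n x y = inn n x' y'"
  by (simp add: inn_def)

lemma abs_sum_mult_le: "\<bar>\<Sum>i\<in>A. f i * g i\<bar> \<le> L2_set f A * L2_set g A" for f g :: "'a \<Rightarrow> real"
proof -
  have "\<bar>\<Sum>i\<in>A. f i * g i\<bar> \<le> (\<Sum>i\<in>A. \<bar>f i\<bar> * \<bar>g i\<bar>)"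
    by (rule order_trans[OF sum_abs]) (simp add: abs_mult)
  also have "\<dots> \<le> L2_set f A * L2_set g A" by (rule L2_set_mult_ineq)
  finally show ?thesis .
qed

lemma inn_le: "\<bar>inn n x y\<bar> \<le> nrm n x * nrm n y"
  unfolding inn_def by (rule abs_sum_mult_le)

text \<open>Linearity is stated for two-term combinations, so that one equation covers sums, differences and
(with \<open>d = 0\<close>) scalar multiples.\<close>
lemma inn_lin_right: "inn n x (\<lambda>a. c * y a + d * z a) = c * inn n x y + d * inn n x z"
  by (simp add: inn_def algebra_simps sum.distrib sum_distrib_left)

lemma inn_lin_left: "inn n (\<lambda>a. c * y a + d * z a) x = c * inn n y x + d * inn n z x"
  by (simp add: inn_def algebra_simps sum.distrib sum_distrib_left)

lemma mv_cong: "(\<And>b. b < n \<Longrightarrow> x b = y b) \<Longrightarrow> mv n W x a = mv n W y a"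
  by (simp add: mv_def)

lemma mv_lin: "mv n W (\<lambda>a. c * x a + d * y a) = (\<lambda>a. c * mv n W x a + d * mv n W y a)"
  by (rule ext) (simp add: mv_def algebra_simps sum.distrib sum_distrib_left)

lemma mv_sum: "mv n W (\<lambda>a. \<Sum>i\<in>I. c i * x i a) = (\<lambda>a. \<Sum>i\<in>I. c i * mv n W (x i) a)"
proof (rule ext)
  fix a
  have "mv n W (\<lambda>a. \<Sum>i\<in>I. c i * x i a) a = (\<Sum>b<n. \<Sum>i\<in>I. W a b * (c i * x i b))"
    by (simp add: mv_def sum_distrib_left)
  also have "\<dots> = (\<Sum>i\<in>I. \<Sum>b<n. W a b * (c i * x i b))" by (rule sum.swap)
  also have "\<dots> = (\<Sum>i\<in>I. c i * mv n W (x i) a)"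
    by (simp add: mv_def sum_distrib_left algebra_simps)
  finally show "mv n W (\<lambda>a. \<Sum>i\<in>I. c i * x i a) a = (\<Sum>i\<in>I. c i * mv n W (x i) a)" .
qed

lemma inn_mv_sym:
  assumes "\<And>a b. a < n \<Longrightarrow> b < n \<Longrightarrow> W a b = W b a"
  shows "inn n x (mv n W y) = inn n (mv n W x) y"
proof -
  have "inn n x (mv n W y) = (\<Sum>a<n. \<Sum>b<n. x a * (W a b * y b))"
    by (simp add: inn_def mv_def sum_distrib_left)
  also have "\<dots> = (\<Sum>b<n. \<Sum>a<n. x a * (W a b * y b))" by (rule sum.swap)
  also have "\<dots> = (\<Sum>b<n. \<Sum>a<n. W b a * x a * y b)"
    using assms by (intro sum.cong refl) auto
  also have "\<dots> = inn n (mv n W x) y"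
    by (simp add: inn_def mv_def sum_distrib_right)
  finally show ?thesis .
qed

lemma abs_le_nrm: "a < n \<Longrightarrow> \<bar>x a\<bar> \<le> nrm n x"
  using member_le_L2_set[of "{..<n}" a "\<lambda>a. \<bar>x a\<bar>"] by (simp add: L2_set_def)

lemma nrm_mv_le:
  assumes "opnorm_le n W N" shows "nrm n (mv n W x) \<le> N * nrm n x"
proof (cases "nrm n (mv n W x) = 0")
  case True then show ?thesis using assms by (simp add: opnorm_le_def)
next
  case False
  then have p: "nrm n (mv n W x) > 0" by (simp add: less_le)
  have "(nrm n (mv n W x))\<^sup>2 \<le> N * nrm n (mv n W x) * nrm n x"
    using assms unfolding nrm_power2 opnorm_le_def by (meson abs_le_D1)
  then have "nrm n (mv n W x) * nrm n (mv n W x) \<le> nrm n (mv n W x) * (N * nrm n x)"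
    by (simp add: power2_eq_square algebra_simps)
  then show ?thesis using p by (simp only: mult_le_cancel_left_pos)
qed

lemma nrm_mono: "(\<And>a. a < n \<Longrightarrow> \<bar>x a\<bar> \<le> \<bar>y a\<bar>) \<Longrightarrow> nrm n x \<le> nrm n y"
  unfolding L2_set_def by (intro real_sqrt_le_mono sum_mono) (simp add: abs_le_square_iff)

lemma opnorm_le_minor:
  assumes "opnorm_le n W N" shows "opnorm_le n (minor i W) N"
  unfolding opnorm_le_def
proof (intro conjI allI)
  show N: "0 \<le> N" using assms by (simp add: opnorm_le_def)
  fix x y :: "nat \<Rightarrow> real"
  define x' y' where "x' = x(i := 0)" and "y' = y(i := 0)"
  have "inn n x (mv n (minor i W) y) = inn n x' (mv n W y')"
    unfolding inn_def mv_def by (intro sum.cong refl)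
      (auto simp: x'_def y'_def minor_def intro!: sum.cong)
  then have "\<bar>inn n x (mv n (minor i W) y)\<bar> \<le> N * nrm n x' * nrm n y'"
    using assms by (simp add: opnorm_le_def)
  also have "\<dots> \<le> N * nrm n x * nrm n y"
    using N by (intro mult_mono nrm_mono) (auto simp: x'_def y'_def)
  finally show "\<bar>inn n x (mv n (minor i W) y)\<bar> \<le> N * nrm n x * nrm n y" .
qed

lemma nrm_mv_pow_le:
  assumes "opnorm_le n W N" shows "nrm n ((mv n W ^^ j) x) \<le> N ^ j * nrm n x"
proof (induction j)
  case (Suc j)
  have "nrm n ((mv n W ^^ Suc j) x) \<le> N * nrm n ((mv n W ^^ j) x)"
    using nrm_mv_le[OF assms] by simp
  also have "\<dots> \<le> N * (N ^ j * nrm n x)"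
    using Suc assms by (intro mult_left_mono) (auto simp: opnorm_le_def)
  finally show ?case by simp
qed simp

lemma mv_pow_lin: "(mv n W ^^ j) (\<lambda>a. c * x a + d * y a) = (\<lambda>a. c * (mv n W ^^ j) x a + d * (mv n W ^^ j) y a)"
  by (induction j) (simp_all add: mv_lin)

lemma mv_pow_sum: "(mv n W ^^ j) (\<lambda>a. \<Sum>i\<in>I. c i * x i a) = (\<lambda>a. \<Sum>i\<in>I. c i * (mv n W ^^ j) (x i) a)"
  by (induction j) (simp_all add: mv_sum)

lemma mv_pow_cong:
  assumes "\<And>b. b < n \<Longrightarrow> x b = y b" "a < n"
  shows "(mv n W ^^ j) x a = (mv n W ^^ j) y a"
  using assms(2)
proof (induction j arbitrary: a)
  case (Suc j) then show ?case by (auto intro!: mv_cong)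
qed (use assms in auto)

text \<open>Row \<open>i\<close> of \<open>W\<close> applied to \<open>W\<^sub>i\<^sup>j x\<close>, where \<open>W\<^sub>i\<close> is \<open>W\<close> without row and column \<open>i\<close>: a weighted count of the
walks from \<open>i\<close> that never come back to \<open>i\<close>. The vector \<open>W\<^sub>i\<^sup>j x\<close> does not involve the entries of row \<open>i\<close>.\<close>
definition walk :: "nat \<Rightarrow> (nat \<Rightarrow> nat \<Rightarrow> real) \<Rightarrow> nat \<Rightarrow> nat \<Rightarrow> (nat \<Rightarrow> real) \<Rightarrow> real" where
  "walk n W i j x = mv n W ((mv n (minor i W) ^^ j) x) i"

lemma walk_lin: "walk n W i j (\<lambda>a. c * x a + d * y a) = c * walk n W i j x + d * walk n W i j y"
  by (simp add: walk_def mv_pow_lin mv_lin)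

lemma walk_sum: "walk n W i j (\<lambda>a. \<Sum>t\<in>I. c t * x t a) = (\<Sum>t\<in>I. c t * walk n W i j (x t))"
  by (simp add: walk_def mv_pow_sum mv_sum)

lemma walk_cong: "(\<And>b. b < n \<Longrightarrow> x b = y b) \<Longrightarrow> walk n W i j x = walk n W i j y"
  unfolding walk_def by (intro mv_cong mv_pow_cong)

lemma walk_Suc: "walk n W i (Suc j) x = walk n W i j (mv n (minor i W) x)"
  by (simp add: walk_def funpow_swap1)

lemma walk_le:
  assumes "opnorm_le n W N" "i < n"
  shows "\<bar>walk n W i j x\<bar> \<le> N * N ^ j * nrm n x"
proof -
  have "\<bar>walk n W i j x\<bar> \<le> N * nrm n ((mv n (minor i W) ^^ j) x)"
    unfolding walk_def using abs_le_nrm[OF assms(2)] nrm_mv_le[OF assms(1)] by (rule order_trans)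
  also have "\<dots> \<le> N * (N ^ j * nrm n x)"
    using assms nrm_mv_pow_le[OF opnorm_le_minor[OF assms(1)]]
    by (intro mult_left_mono) (auto simp: opnorm_le_def)
  finally show ?thesis by simp
qed

text \<open>A walk that avoids \<open>i\<close> after its start cannot see a vector supported at \<open>i\<close>. Hence the right-hand
side of the eigenvalue equation may be altered at \<open>i\<close> at will.\<close>
lemma walk_unit:
  assumes "W i i = 0" "i < n"
  shows "walk n W i j (\<lambda>a. if a = i then c else 0) = 0"
proof (cases j)
  case 0
  have "(\<Sum>b<n. W i b * (if b = i then c else 0)) = (\<Sum>b<n. 0)"
    by (intro sum.cong) (use assms in auto)
  then show ?thesis using 0 by (simp add: walk_def mv_def)
next
  case (Suc m)
  have "mv n (minor i W) (\<lambda>a. if a = i then c else 0) = (\<lambda>a. 0 * 0 + 0 * 0)"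
    by (rule ext) (auto simp: mv_def minor_def intro!: sum.neutral)
  then have "walk n W i (Suc m) (\<lambda>a. if a = i then c else 0) = walk n W i m (\<lambda>a. 0 * 0 + 0 * 0)"
    unfolding walk_Suc by (rule arg_cong)
  also have "\<dots> = 0" by (subst walk_lin) simp
  finally show ?thesis unfolding Suc .
qed

text \<open>Off \<open>i\<close> the vector \<open>u\<close> satisfies, with \<open>w\<close> column \<open>i\<close> of \<open>W\<close>, \<open>l u = W\<^sub>i u + h + u\<^sub>i w\<close>. Iterating this equation \<open>J\<close> times inside row \<open>i\<close>
of \<open>W\<close> replaces \<open>u\<close>, which depends on the row, by \<open>h\<close> and the column itself, up to a
geometrically small remainder.\<close>
lemma row_neumann_expansion:
  assumes W0: "W i i = 0" and i: "i < n" and l: "l \<noteq> 0"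
    and eq: "\<And>a. a < n \<Longrightarrow> l * u a = h a + mv n W u a"
  shows "mv n W u i = (\<Sum>j<J. (1 / l) ^ Suc j * (walk n W i j h + u i * walk n W i j (\<lambda>a. W a i)))
     + (1 / l) ^ J * walk n W i J (u(i := 0))"
proof -
  define z where "z = u(i := 0)"
  \<comment> \<open>The last summand makes \<open>g\<close> vanish at \<open>i\<close>, so that \<open>z\<close> solves its equation at \<open>i\<close> too.\<close>
  define g where "g = (\<lambda>a. 1 * (1 * h a + u i * W a i) + (- 1) * (if a = i then h i else 0))"
  have wg: "walk n W i j g = walk n W i j h + u i * walk n W i j (\<lambda>a. W a i)" for j
    unfolding g_def walk_lin by (simp add: walk_unit[of W i, OF W0 i])
  have z_eq: "l * z a = 1 * g a + 1 * mv n (minor i W) z a" if a: "a < n" for a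
  proof (cases "a = i")
    case True
    then show ?thesis by (simp add: z_def g_def mv_def minor_def W0)
  next
    case False
    have "mv n W u a = (\<Sum>b\<in>{..<n}-{i}. W a b * u b) + W a i * u i"
      unfolding mv_def using i by (subst sum.remove[of _ i]) auto
    also have "(\<Sum>b\<in>{..<n}-{i}. W a b * u b) = (\<Sum>b\<in>{..<n}-{i}. minor i W a b * z b)"
      using False by (intro sum.cong) (auto simp: minor_def z_def)
    also have "\<dots> = mv n (minor i W) z a"
      unfolding mv_def using i by (subst (2) sum.remove[of _ i]) (auto simp: minor_def)
    finally show ?thesis using eq[OF a] False by (simp add: z_def g_def)
  qed
  have step: "walk n W i j z = (1 / l) * (walk n W i j g + walk n W i (Suc j) z)" for j
  proof -
    have "l * walk n W i j z = walk n W i j (\<lambda>a. l * z a + 0 * z a)" by (subst walk_lin) simp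
    also have "\<dots> = walk n W i j (\<lambda>a. 1 * g a + 1 * mv n (minor i W) z a)"
      by (rule walk_cong) (use z_eq in simp)
    also have "\<dots> = walk n W i j g + walk n W i (Suc j) z" by (subst walk_lin) (simp add: walk_Suc)
    finally show ?thesis using l by (simp add: field_simps)
  qed
  have "mv n W u i = walk n W i 0 z"
    using W0 by (auto simp: walk_def mv_def z_def intro!: sum.cong)
  also have "walk n W i 0 z = (\<Sum>j<J. (1 / l) ^ Suc j * walk n W i j g) + (1 / l) ^ J * walk n W i J z"
  proof (induction J)
    case (Suc J)
    have "(1 / l) ^ J * walk n W i J z = (1 / l) ^ Suc J * walk n W i J g + (1 / l) ^ Suc J * walk n W i (Suc J) z"
      by (subst step) (simp add: algebra_simps)
    then show ?case using Suc by simp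
  qed simp
  finally show ?thesis by (simp add: wg z_def)
qed

lemma neumann_weight_sum_le:
  fixes l N :: real
  assumes "0 < l" "0 \<le> N" "2 * N \<le> l"
  shows "(\<Sum>j<J. (1 / l) ^ Suc j * N ^ j) \<le> 2 / l"
proof -
  have "(\<Sum>j<J. (1 / l) ^ Suc j * N ^ j) = (1 / l) * (\<Sum>j<J. (N / l) ^ j)"
    by (simp add: sum_distrib_left power_divide)
  also have "(\<Sum>j<J. (N / l) ^ j) \<le> (\<Sum>j<J. (1 / 2) ^ j)"
    using assms by (intro sum_mono power_mono) (auto simp: field_simps)
  also have "(\<Sum>j<J. (1 / 2 :: real) ^ j) \<le> 2"
    by (subst geometric_sum) auto
  finally show ?thesis using assms by (simp add: field_simps)
qed

text \<open>The hypothesis on \<open>walk\<close> is what independence of row \<open>i\<close> gives with high probability for fixed vectors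
\<open>f t\<close>; it is a factor \<open>L / N\<close> better than the operator norm bound. The column term is only bounded by
\<open>N\<^sup>2\<close>, but it is multiplied by the single entry \<open>u i\<close>.\<close>
lemma row_noise_le:
  assumes W: "opnorm_le n W N" and W0: "W i i = 0" and symW: "\<And>a. a < n \<Longrightarrow> W a i = W i a"
    and i: "i < n" and l: "0 < l" "2 * N \<le> l"
    and eq: "\<And>a. a < n \<Longrightarrow> l * u a = h a + mv n W u a" and u: "nrm n u = 1"
    and h: "\<And>a. a < n \<Longrightarrow> h a = (\<Sum>t\<in>I. c t * f t a)"
    and walk: "\<And>t j. t \<in> I \<Longrightarrow> j < J \<Longrightarrow> \<bar>walk n W i j (f t)\<bar> \<le> L * nrm n ((mv n (minor i W) ^^ j) (f t))"
    and f: "\<And>t. t \<in> I \<Longrightarrow> nrm n (f t) \<le> F" and L: "0 \<le> L"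
  shows "\<bar>mv n W u i\<bar> \<le> 2 * L * F / l * (\<Sum>t\<in>I. \<bar>c t\<bar>) + 2 * N\<^sup>2 / l * \<bar>u i\<bar> + N / 2 ^ J"
proof -
  have N: "0 \<le> N" using W by (simp add: opnorm_le_def)
  have geo: "(\<Sum>j<J. (1 / l) ^ Suc j * N ^ j) \<le> 2 / l"
    using l N by (intro neumann_weight_sum_le) auto
  have wh: "\<bar>walk n W i j h\<bar> \<le> N ^ j * (L * F * (\<Sum>t\<in>I. \<bar>c t\<bar>))" if j: "j < J" for j
  proof -
    have "walk n W i j h = (\<Sum>t\<in>I. c t * walk n W i j (f t))"
      by (subst walk_sum[symmetric]) (intro walk_cong h)
    also have "\<bar>\<dots>\<bar> \<le> (\<Sum>t\<in>I. \<bar>c t\<bar> * (L * (N ^ j * F)))"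
    proof (intro order_trans[OF sum_abs] sum_mono)
      fix t assume t: "t \<in> I"
      have "\<bar>walk n W i j (f t)\<bar> \<le> L * nrm n ((mv n (minor i W) ^^ j) (f t))" by (rule walk[OF t j])
      also have "\<dots> \<le> L * (N ^ j * F)"
        using L N by (intro mult_left_mono order_trans[OF nrm_mv_pow_le[OF opnorm_le_minor[OF W]]] f[OF t]) auto
      finally show "\<bar>c t * walk n W i j (f t)\<bar> \<le> \<bar>c t\<bar> * (L * (N ^ j * F))"
        by (simp add: abs_mult mult_left_mono)
    qed
    also have "\<dots> = N ^ j * (L * F * (\<Sum>t\<in>I. \<bar>c t\<bar>))"
      by (simp add: sum_distrib_left sum_distrib_right algebra_simps)
    finally show ?thesis .
  qed
  have ww: "\<bar>walk n W i j (\<lambda>a. W a i)\<bar> \<le> N ^ j * N\<^sup>2" for j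
  proof -
    have "(\<lambda>a. W a i) a = mv n W (\<lambda>b. if b = i then 1 else 0) a" for a
      using i by (simp add: mv_def if_distrib cong: if_cong)
    then have "nrm n (\<lambda>a. W a i) = nrm n (mv n W (\<lambda>b. if b = i then 1 else 0))" by presburger
    also have "\<dots> \<le> N * nrm n (\<lambda>b. if b = i then 1 else 0)" by (rule nrm_mv_le[OF W])
    also have "nrm n (\<lambda>b. if b = i then 1 else 0) = 1"
      using i by (simp add: L2_set_def if_distrib[of "\<lambda>x. x\<^sup>2"] cong: if_cong)
    finally have "nrm n (\<lambda>a. W a i) \<le> N" by simp
    then have "N * N ^ j * nrm n (\<lambda>a. W a i) \<le> N * N ^ j * N" using N by (intro mult_left_mono) auto
    then show ?thesis using walk_le[OF W i, of j "\<lambda>a. W a i"] by (simp add: power2_eq_square algebra_simps)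
  qed
  have "nrm n (u(i := 0)) \<le> nrm n u" by (rule nrm_mono) auto
  then have "\<bar>walk n W i J (u(i := 0))\<bar> \<le> N * N ^ J"
    using walk_le[OF W i, of J "u(i := 0)"] u N mult_left_mono[of "nrm n (u(i := 0))" 1 "N * N ^ J"] by simp
  then have "\<bar>(1 / l) ^ J * walk n W i J (u(i := 0))\<bar> \<le> (1 / l) ^ J * (N * N ^ J)"
    using l by (simp add: abs_mult divide_right_mono power_divide)
  also have "\<dots> = N * (N / l) ^ J" by (simp add: power_divide)
  also have "\<dots> \<le> N * (1 / 2) ^ J"
    using l N by (intro mult_left_mono power_mono) (auto simp: field_simps)
  finally have tail: "\<bar>(1 / l) ^ J * walk n W i J (u(i := 0))\<bar> \<le> N / 2 ^ J"
    by (simp add: power_divide)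
  define X where "X = L * F * (\<Sum>t\<in>I. \<bar>c t\<bar>) + \<bar>u i\<bar> * N\<^sup>2"
  have "0 \<le> L * F * (\<Sum>t\<in>I. \<bar>c t\<bar>)"
  proof (cases "I = {}")
    case False
    then obtain t where "t \<in> I" by blast
    then have "0 \<le> F" using f[of t] L2_set_nonneg order_trans by blast
    then show ?thesis using L by (simp add: sum_nonneg)
  qed simp
  then have X0: "0 \<le> X" by (simp add: X_def)
  have "\<bar>\<Sum>j<J. (1 / l) ^ Suc j * (walk n W i j h + u i * walk n W i j (\<lambda>a. W a i))\<bar>
      \<le> (\<Sum>j<J. ((1 / l) ^ Suc j * N ^ j) * X)"
  proof (intro order_trans[OF sum_abs] sum_mono)
    fix j assume j: "j \<in> {..<J}"
    have "\<bar>walk n W i j h + u i * walk n W i j (\<lambda>a. W a i)\<bar> \<le> 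
       N ^ j * (L * F * (\<Sum>t\<in>I. \<bar>c t\<bar>)) + \<bar>u i\<bar> * (N ^ j * N\<^sup>2)"
      using wh j ww[of j]
      by (intro order_trans[OF abs_triangle_ineq] add_mono) (auto simp: abs_mult intro!: mult_left_mono)
    also have "\<dots> = N ^ j * X" by (simp add: X_def algebra_simps)
    finally have "\<bar>walk n W i j h + u i * walk n W i j (\<lambda>a. W a i)\<bar> \<le> N ^ j * X" .
    then show "\<bar>(1 / l) ^ Suc j * (walk n W i j h + u i * walk n W i j (\<lambda>a. W a i))\<bar> \<le> (1 / l) ^ Suc j * N ^ j * X"
      using l by (simp add: abs_mult divide_right_mono mult.assoc)
  qed
  also have "\<dots> \<le> 2 / l * X"
    using mult_right_mono[OF geo X0] by (simp only: sum_distrib_right)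
  finally have main: "\<bar>\<Sum>j<J. (1 / l) ^ Suc j * (walk n W i j h + u i * walk n W i j (\<lambda>a. W a i))\<bar>
      \<le> 2 / l * (L * F * (\<Sum>t\<in>I. \<bar>c t\<bar>) + \<bar>u i\<bar> * N\<^sup>2)" unfolding X_def .
  have "mv n W u i = (\<Sum>j<J. (1 / l) ^ Suc j * (walk n W i j h + u i * walk n W i j (\<lambda>a. W a i)))
     + (1 / l) ^ J * walk n W i J (u(i := 0))"
    by (rule row_neumann_expansion[OF W0 i _ eq]) (use l in auto)
  then have "\<bar>mv n W u i\<bar> \<le> 2 / l * (L * F * (\<Sum>t\<in>I. \<bar>c t\<bar>) + \<bar>u i\<bar> * N\<^sup>2) + N / 2 ^ J"
    using main tail by linarith
  then show ?thesis by (simp add: algebra_simps)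
qed

section \<open>Perturbing a matrix with a tight frame of eigenvectors\<close>

text \<open>The frame used later consists of all \<open>n\<close> cosines and all \<open>n\<close> sines, in which every vector is expanded twice over. This
avoids choosing an orthonormal subset of them, which would depend on the parity of \<open>n\<close>.\<close>
locale tight_frame =
  fixes n :: nat and I :: "'i set" and f :: "'i \<Rightarrow> nat \<Rightarrow> real"
  assumes finite_I: "finite I" and n_pos: "0 < n"
    and frame: "\<And>a b. a < n \<Longrightarrow> b < n \<Longrightarrow> (\<Sum>t\<in>I. f t a * f t b) = (if a = b then real n else 0)"
begin

lemma expansion:
  assumes a: "a < n" shows "u a = (1 / n) * (\<Sum>t\<in>I. inn n (f t) u * f t a)"
proof -
  have "(\<Sum>t\<in>I. inn n (f t) u * f t a) = (\<Sum>t\<in>I. \<Sum>b<n. u b * (f t b * f t a))"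
    by (simp add: inn_def sum_distrib_right sum_distrib_left mult_ac)
  also have "\<dots> = (\<Sum>b<n. u b * (\<Sum>t\<in>I. f t b * f t a))"
    by (subst sum.swap) (simp add: sum_distrib_left)
  also have "\<dots> = (\<Sum>b<n. u b * (if b = a then real n else 0))"
    using frame a by (intro sum.cong) auto
  also have "\<dots> = u a * n" using a by (simp add: if_distrib[of "\<lambda>x. u _ * x"] cong: if_cong)
  finally show ?thesis using n_pos by simp
qed

lemma parseval: "inn n u v = (1 / n) * (\<Sum>t\<in>I. inn n (f t) u * inn n (f t) v)"
proof -
  have "inn n u v = (\<Sum>a<n. (1 / n) * (\<Sum>t\<in>I. inn n (f t) u * f t a) * v a)"
    unfolding inn_def[of n u v] by (intro sum.cong refl) (subst expansion[of _ u], auto)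
  also have "\<dots> = (1 / n) * (\<Sum>a<n. \<Sum>t\<in>I. inn n (f t) u * (f t a * v a))"
    by (simp add: sum_distrib_left sum_distrib_right mult.assoc)
  also have "(\<Sum>a<n. \<Sum>t\<in>I. inn n (f t) u * (f t a * v a)) = (\<Sum>t\<in>I. inn n (f t) u * inn n (f t) v)"
    by (subst sum.swap) (simp add: inn_def[of n _ v] sum_distrib_left)
  finally show ?thesis .
qed

lemma L2_set_coeffs: "L2_set (\<lambda>t. inn n (f t) u) I = sqrt n * nrm n u"
proof -
  have "(\<Sum>t\<in>I. (inn n (f t) u)\<^sup>2) = n * inn n u u"
    using parseval[of u u] n_pos by (simp add: power2_eq_square)
  then show ?thesis by (simp add: L2_set_def real_sqrt_mult inn_def power2_eq_square)
qed

end

locale perturbed_frame = tight_frame +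
  fixes M W :: "nat \<Rightarrow> nat \<Rightarrow> real" and ev :: "'a \<Rightarrow> real" and N :: real
  assumes eigen: "\<And>t a. t \<in> I \<Longrightarrow> a < n \<Longrightarrow> mv n M (f t) a = ev t * f t a"
    and symM: "\<And>a b. a < n \<Longrightarrow> b < n \<Longrightarrow> M a b = M b a"
    and symW: "\<And>a b. a < n \<Longrightarrow> b < n \<Longrightarrow> W a b = W b a"
    and opW: "opnorm_le n W N"
begin

lemma N_nonneg: "0 \<le> N" using opW by (simp add: opnorm_le_def)

lemma mv_M_expansion:
  assumes a: "a < n" shows "mv n M u a = (1 / n) * (\<Sum>t\<in>I. ev t * inn n (f t) u * f t a)"
proof -
  have "mv n M u a = mv n M (\<lambda>a. \<Sum>t\<in>I. (1 / n) * inn n (f t) u * f t a) a"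
    by (rule mv_cong, subst expansion) (auto simp: sum_distrib_left mult.assoc)
  also have "\<dots> = (\<Sum>t\<in>I. (1 / n) * inn n (f t) u * (ev t * f t a))"
    unfolding mv_sum using eigen a by (intro sum.cong) auto
  finally show ?thesis by (simp add: sum_distrib_left algebra_simps)
qed

definition eigenpair :: "real \<Rightarrow> (nat \<Rightarrow> real) \<Rightarrow> bool" where
  "eigenpair l u \<longleftrightarrow> nrm n u = 1 \<and> (\<forall>a<n. l * u a = mv n M u a + mv n W u a)"

text \<open>Testing \<open>l u = M u + W u\<close> against an eigenvector of \<open>M\<close>: away from the eigenvalue \<open>l\<close>, the coefficients of \<open>u\<close> are
those of the noise \<open>W u\<close> divided by the gap. The three estimates that follow insert this
identity and apply the Cauchy--Schwarz inequality.\<close>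
lemma coeff_eq:
  assumes u: "eigenpair l u" and t: "t \<in> I"
  shows "(l - ev t) * inn n (f t) u = inn n (f t) (mv n W u)"
proof -
  have "l * inn n (f t) u = inn n (f t) (\<lambda>a. l * u a + 0 * 0)" by (subst inn_lin_right) simp
  also have "\<dots> = inn n (f t) (\<lambda>a. 1 * mv n M u a + 1 * mv n W u a)"
    using u by (intro inn_cong) (auto simp: eigenpair_def)
  also have "\<dots> = inn n (f t) (mv n M u) + inn n (f t) (mv n W u)" by (subst inn_lin_right) simp
  also have "inn n (f t) (mv n M u) = inn n (mv n M (f t)) u" by (rule inn_mv_sym[OF symM])
  also have "\<dots> = inn n (\<lambda>a. ev t * f t a + 0 * 0) u"
    using eigen[OF t] by (intro inn_cong) auto
  also have "\<dots> = ev t * inn n (f t) u" by (subst inn_lin_left) simp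
  finally show ?thesis by (simp add: algebra_simps)
qed

lemma coeff_noise_le:
  assumes "nrm n u = 1" "A \<subseteq> I" shows "L2_set (\<lambda>t. inn n (f t) (mv n W u)) A \<le> sqrt n * N"
proof -
  have "L2_set (\<lambda>t. inn n (f t) (mv n W u)) A \<le> L2_set (\<lambda>t. inn n (f t) (mv n W u)) I"
    unfolding L2_set_def using assms(2) finite_I by (intro real_sqrt_le_mono sum_mono2) auto
  also have "\<dots> \<le> sqrt n * N"
    unfolding L2_set_coeffs using nrm_mv_le[OF opW, of u] assms(1) by (intro mult_left_mono) auto
  finally show ?thesis .
qed

text \<open>Keeping the weights \<open>ev t / (l - ev t)\<close> inside the Cauchy--Schwarz inequality, instead of using the smallest
gap for all of them, gains the factor \<open>sqrt (n / k)\<close> without which the entries could not be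
controlled.\<close>
lemma row_bias_le:
  assumes u: "eigenpair l u" and I0: "I0 \<subseteq> I" and sep: "\<And>t. t \<in> I - I0 \<Longrightarrow> l \<noteq> ev t" and a: "a < n"
    and Xi: "L2_set (\<lambda>t. ev t / (l - ev t) * f t a) (I - I0) \<le> Xi"
  shows "\<bar>mv n M u a - (1 / n) * (\<Sum>t\<in>I0. ev t * inn n (f t) u * f t a)\<bar> \<le> N * Xi / sqrt n"
proof -
  have "mv n M u a - (1 / n) * (\<Sum>t\<in>I0. ev t * inn n (f t) u * f t a)
      = (1 / n) * (\<Sum>t\<in>I-I0. ev t * inn n (f t) u * f t a)"
    unfolding mv_M_expansion[OF a] sum.subset_diff[OF I0 finite_I] by (simp add: distrib_left)
  also have "(\<Sum>t\<in>I-I0. ev t * inn n (f t) u * f t a)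
      = (\<Sum>t\<in>I-I0. (ev t / (l - ev t) * f t a) * inn n (f t) (mv n W u))"
    using sep coeff_eq[OF u] by (intro sum.cong refl) (auto simp: field_simps)
  finally have *: "mv n M u a - (1 / n) * (\<Sum>t\<in>I0. ev t * inn n (f t) u * f t a) =
      (1 / n) * (\<Sum>t\<in>I-I0. (ev t / (l - ev t) * f t a) * inn n (f t) (mv n W u))" .
  have "\<bar>\<Sum>t\<in>I-I0. (ev t / (l - ev t) * f t a) * inn n (f t) (mv n W u)\<bar> \<le> Xi * (sqrt n * N)"
    by (rule order_trans[OF abs_sum_mult_le])
      (use u Xi order_trans[OF L2_set_nonneg Xi] in \<open>auto intro!: mult_mono coeff_noise_le simp: eigenpair_def\<close>)
  then have "(1 / n) * \<bar>\<Sum>t\<in>I-I0. (ev t / (l - ev t) * f t a) * inn n (f t) (mv n W u)\<bar> \<le> (1 / n) * (Xi * (sqrt n * N))"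
    by (intro mult_left_mono) auto
  also have "(1 / n) * (Xi * (sqrt n * N)) = N * Xi / sqrt n"
    using n_pos by (simp add: field_simps)
  finally show ?thesis unfolding * by (simp add: abs_mult)
qed

lemma coeff_weight_le:
  assumes u: "eigenpair l u" and I0: "I0 \<subseteq> I" and sep: "\<And>t. t \<in> I - I0 \<Longrightarrow> l \<noteq> ev t"
    and Xi: "L2_set (\<lambda>t. ev t / (l - ev t)) (I - I0) \<le> Xi"
  shows "(\<Sum>t\<in>I-I0. \<bar>ev t * inn n (f t) u\<bar>) \<le> sqrt n * N * Xi"
proof -
  have "(\<Sum>t\<in>I-I0. \<bar>ev t * inn n (f t) u\<bar>)
      = (\<Sum>t\<in>I-I0. \<bar>ev t / (l - ev t)\<bar> * \<bar>inn n (f t) (mv n W u)\<bar>)"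
    using sep coeff_eq[OF u] by (intro sum.cong refl) (auto simp: abs_mult[symmetric] field_simps)
  also have "\<dots> \<le> Xi * (sqrt n * N)"
    by (rule order_trans[OF L2_set_mult_ineq])
      (use u Xi order_trans[OF L2_set_nonneg Xi] in \<open>auto intro!: mult_mono coeff_noise_le simp: eigenpair_def\<close>)
  finally show ?thesis by (simp add: algebra_simps)
qed

text \<open>For \<open>u = v\<close> this bounds the mass of \<open>u\<close> outside \<open>I0\<close>; for orthogonal \<open>u\<close> and \<open>v\<close> it says that their parts in
\<open>I0\<close> are nearly orthogonal. Both are second order in \<open>N / d\<close>.\<close>
lemma leak_le:
  assumes u: "eigenpair l u" and v: "eigenpair l' v" and I0: "I0 \<subseteq> I" and d: "0 < d"
    and du: "\<And>t. t \<in> I - I0 \<Longrightarrow> d \<le> \<bar>l - ev t\<bar>" and dv: "\<And>t. t \<in> I - I0 \<Longrightarrow> d \<le> \<bar>l' - ev t\<bar>"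
  shows "\<bar>inn n u v - (1 / n) * (\<Sum>t\<in>I0. inn n (f t) u * inn n (f t) v)\<bar> \<le> (N / d)\<^sup>2"
proof -
  have bd: "L2_set (\<lambda>t. inn n (f t) w) (I - I0) \<le> sqrt n * N / d"
    if w: "eigenpair m w" and dw: "\<And>t. t \<in> I - I0 \<Longrightarrow> d \<le> \<bar>m - ev t\<bar>" for m w
  proof -
    have "d * L2_set (\<lambda>t. inn n (f t) w) (I - I0) = L2_set (\<lambda>t. d * \<bar>inn n (f t) w\<bar>) (I - I0)"
      using d by (subst L2_set_right_distrib) (auto simp: L2_set_def power_mult_distrib)
    also have "\<dots> \<le> L2_set (\<lambda>t. \<bar>inn n (f t) (mv n W w)\<bar>) (I - I0)"
    proof (rule L2_set_mono)
      fix t assume t: "t \<in> I - I0"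
      have "d * \<bar>inn n (f t) w\<bar> \<le> \<bar>m - ev t\<bar> * \<bar>inn n (f t) w\<bar>" using dw[OF t] by (rule mult_right_mono) simp
      then show "d * \<bar>inn n (f t) w\<bar> \<le> \<bar>inn n (f t) (mv n W w)\<bar>"
        using coeff_eq[OF w, of t] t by (simp add: abs_mult[symmetric])
    qed (use d in auto)
    also have "\<dots> \<le> sqrt n * N"
      using coeff_noise_le[of w "I - I0"] w by (auto simp: L2_set_def eigenpair_def)
    finally show ?thesis using d by (simp add: field_simps)
  qed
  have "inn n u v - (1 / n) * (\<Sum>t\<in>I0. inn n (f t) u * inn n (f t) v)
      = (1 / n) * (\<Sum>t\<in>I-I0. inn n (f t) u * inn n (f t) v)"
    unfolding parseval[of u v] sum.subset_diff[OF I0 finite_I] by (simp add: distrib_left)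
  moreover have "\<bar>\<Sum>t\<in>I-I0. inn n (f t) u * inn n (f t) v\<bar> \<le> (sqrt n * N / d) * (sqrt n * N / d)"
    using d N_nonneg
    by (intro order_trans[OF abs_sum_mult_le mult_mono] bd[OF u du] bd[OF v dv]) auto
  moreover have "(sqrt n * N / d) * (sqrt n * N / d) = n * (N / d)\<^sup>2"
    by (simp add: power2_eq_square field_simps)
  ultimately show ?thesis using n_pos by (simp add: abs_mult field_simps)
qed

end

section \<open>Harmonics and the spectrum of the ring lattice\<close>

text \<open>At \<open>m = 2\<close> the comparison of \<open>16 m\<^sup>2\<close> with \<open>4 \<pi>\<^sup>2\<close> in the spectral gap is tight enough that \<open>\<pi> < 4\<close> does not
suffice.\<close>
lemma pi_power2_le_10: "pi\<^sup>2 \<le> (10 :: real)"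
proof -
  have le: "arctan x \<le> x" if "0 \<le> x" for x :: real
  proof -
    have "((\<lambda>y. y - arctan y) has_real_derivative (1 - inverse (1 + y\<^sup>2))) (at y)" for y
      by (auto intro!: derivative_eq_intros simp: inverse_eq_divide)
    moreover have "0 \<le> 1 - inverse (1 + y\<^sup>2)" for y :: real
      by (simp add: field_simps add_pos_nonneg)
    ultimately have "0 - arctan 0 \<le> x - arctan x"
      using that by (intro DERIV_nonneg_imp_nondecreasing[of 0 x "\<lambda>y. y - arctan y"]) blast+
    then show ?thesis by simp
  qed
  have "pi / 4 \<le> 5 * (1 / 7) + 2 * (3 / 79)"
    unfolding machin_Euler[symmetric] by (intro add_mono mult_left_mono le) auto
  then have "pi \<le> 3162 / 1000" by simp
  then have "pi\<^sup>2 \<le> (3162 / 1000)\<^sup>2" by (intro power_mono) auto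
  also have "\<dots> \<le> 10" by (simp add: power2_eq_square)
  finally show ?thesis .
qed

lemma sin_ge_chord:
  fixes x :: real
  assumes "0 \<le> x" "x \<le> pi / 2" shows "2 / pi * x \<le> sin x"
proof -
  have "convex_on {0..pi/2} (\<lambda>x. - sin x)"
  proof (rule convex_on_realI[where f' = "\<lambda>x. - cos x"])
    show "- cos x \<le> - cos y" if "x \<in> {0..pi/2}" "y \<in> {0..pi/2}" "x \<le> y" for x y :: real
      using that by (simp add: cos_mono_le_eq)
  qed (auto intro!: derivative_eq_intros)
  then have "- sin ((1 - 2 * x / pi) *\<^sub>R 0 + (2 * x / pi) *\<^sub>R (pi / 2)) \<le> (1 - 2 * x / pi) * - sin 0 + (2 * x / pi) * - sin (pi / 2)"
    using assms by (intro convex_onD) (auto simp: field_simps)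
  then show ?thesis by simp
qed

lemma sum_roots_of_unity:
  assumes "0 < d" "d < n"
  shows "(\<Sum>m<n. cos (2 * pi * real m * real d / n)) = 0"
    and "(\<Sum>m<n. sin (2 * pi * real m * real d / n)) = 0"
proof -
  define z where "z = cis (2 * pi * real d / n)"
  have y: "0 < pi * real d / n" "pi * real d / n < pi" using assms by (auto simp: field_simps)
  have "Re z = 1 - 2 * (sin (pi * real d / n))\<^sup>2"
    using cos_double_sin[of "pi * real d / n"] by (simp add: z_def mult.assoc)
  moreover have "sin (pi * real d / n) > 0" using y by (rule sin_gt_zero)
  ultimately have "z \<noteq> 1" by auto
  have "real n * (2 * pi * real d / n) = 2 * pi * real d" using assms by simp
  then have "z ^ n = cis (2 * pi * real d)" by (simp only: z_def Complex.DeMoivre)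
  also have "\<dots> = 1" using cis_multiple_2pi[of "real d"] by simp
  finally have "(\<Sum>m<n. z ^ m) = 0" using \<open>z \<noteq> 1\<close> by (simp add: geometric_sum)
  then have "(\<Sum>m<n. cis (2 * pi * real m * real d / n)) = 0"
    by (simp add: z_def Complex.DeMoivre mult_ac)
  then have "Re (\<Sum>m<n. cis (2 * pi * real m * real d / n)) = 0" "Im (\<Sum>m<n. cis (2 * pi * real m * real d / n)) = 0"
    by simp_all
  then show "(\<Sum>m<n. cos (2 * pi * real m * real d / n)) = 0"
    and "(\<Sum>m<n. sin (2 * pi * real m * real d / n)) = 0" by simp_all
qed

text \<open>The flag of a mode \<open>(m, \<sigma>)\<close> selects the cosine or the sine.\<close>
definition harmonic :: "nat \<Rightarrow> nat \<times> bool \<Rightarrow> nat \<Rightarrow> real" where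
  "harmonic n t x = (if snd t then cos else sin) (2 * pi * real (fst t) * real x / n)"

lemma sum_modes: "finite A \<Longrightarrow> (\<Sum>t\<in>A \<times> (UNIV :: bool set). g t) = (\<Sum>m\<in>A. g (m, True) + g (m, False))"
  using sum.cartesian_product[of "\<lambda>m s. g (m, s)" UNIV A] by (simp add: UNIV_bool add.commute)

lemma harmonic_frame:
  assumes "x < n" "y < n"
  shows "(\<Sum>t\<in>{..<n} \<times> UNIV. harmonic n t x * harmonic n t y) = (if x = y then real n else 0)"
proof -
  have "(\<Sum>t\<in>{..<n} \<times> UNIV. harmonic n t x * harmonic n t y) =
      (\<Sum>m<n. cos (2 * pi * real m * (real x - real y) / n))"
    unfolding sum_modes[OF finite_lessThan]
  proof (intro sum.cong refl)
    fix m
    have "2 * pi * real m * (real x - real y) / n = 2 * pi * real m * real x / n - 2 * pi * real m * real y / n"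
      by (simp add: diff_divide_distrib right_diff_distrib)
    then show "harmonic n (m, True) x * harmonic n (m, True) y + harmonic n (m, False) x * harmonic n (m, False) y
      = cos (2 * pi * real m * (real x - real y) / n)"
      by (simp add: harmonic_def cos_diff)
  qed
  also have "\<dots> = (if x = y then real n else 0)"
  proof (cases x y rule: linorder_cases)
    case less
    have "cos (2 * pi * real m * (real x - real y) / n) = cos (2 * pi * real m * real (y - x) / n)" for m
      using less cos_minus[of "2 * pi * real m * real (y - x) / n"]
      by (simp add: of_nat_diff algebra_simps minus_divide_left)
    then show ?thesis using less sum_roots_of_unity(1)[of "y - x" n] assms by simp
  next
    case greater
    then show ?thesis using sum_roots_of_unity(1)[of "x - y" n] assms by (simp add: of_nat_diff)
  qed simp
  finally show ?thesis .
qed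

lemma harmonic_norm: "(harmonic n (m, True) x)\<^sup>2 + (harmonic n (m, False) x)\<^sup>2 = 1"
  by (simp add: harmonic_def)

lemma abs_harmonic_le_1: "\<bar>harmonic n t x\<bar> \<le> 1"
  by (simp add: harmonic_def)

lemma harmonic_sum:
  assumes "m < n" shows "(\<Sum>x<n. harmonic n (m, s) x) = (if m = 0 \<and> s then real n else 0)"
proof (cases "m = 0")
  case False
  then show ?thesis using sum_roots_of_unity[of m n] assms
    by (auto simp: harmonic_def mult.assoc mult.commute[of _ "real m"] mult.left_commute[of _ "real m"])
qed (auto simp: harmonic_def)

definition ring_adj :: "nat \<Rightarrow> nat \<Rightarrow> nat \<Rightarrow> nat \<Rightarrow> bool" where
  "ring_adj n r x y \<longleftrightarrow> x \<noteq> y \<and> ring_dist n x y \<le> int r"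

definition fwd :: "nat \<Rightarrow> nat \<Rightarrow> nat \<Rightarrow> nat" where
  "fwd n x d = (if x + d < n then x + d else x + d - n)"

definition bwd :: "nat \<Rightarrow> nat \<Rightarrow> nat \<Rightarrow> nat" where
  "bwd n x d = (if d \<le> x then x - d else x + n - d)"

text \<open>Every neighbor lies exactly one of \<open>1, \<dots>, r\<close> steps ahead or behind, since \<open>2 r < n\<close>.\<close>
lemma sum_ring_adj:
  fixes g :: "nat \<Rightarrow> 'b :: comm_monoid_add"
  assumes x: "x < n" and r: "2 * r < n"
  shows "sum g {y. y < n \<and> ring_adj n r x y} = (\<Sum>d=1..r. g (fwd n x d) + g (bwd n x d))"
proof -
  have eq: "{y. y < n \<and> ring_adj n r x y} = fwd n x ` {1..r} \<union> bwd n x ` {1..r}" (is "?L = ?R")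
  proof (intro equalityI subsetI)
    fix y assume "y \<in> ?L"
    then have y: "y < n" "y \<noteq> x" "ring_dist n x y \<le> int r" by (auto simp: ring_adj_def)
    consider "y > x" "y - x \<le> r" | "y > x" "n - (y - x) \<le> r" | "y < x" "x - y \<le> r" | "y < x" "n - (x - y) \<le> r"
      using y x unfolding ring_dist_def by linarith
    then show "y \<in> ?R"
    proof cases
      case 1 then have "y = fwd n x (y - x)" "y - x \<in> {1..r}" using y by (auto simp: fwd_def)
      then show ?thesis by blast
    next
      case 2 then have "y = bwd n x (n - (y - x))" "n - (y - x) \<in> {1..r}" using y x by (auto simp: bwd_def)
      then show ?thesis by blast
    next
      case 3 then have "y = bwd n x (x - y)" "x - y \<in> {1..r}" using y by (auto simp: bwd_def)
      then show ?thesis by blast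
    next
      case 4 then have "y = fwd n x (n - (x - y))" "n - (x - y) \<in> {1..r}" using y x by (auto simp: fwd_def)
      then show ?thesis by blast
    qed
  next
    fix y assume "y \<in> ?R"
    then obtain d where "d \<in> {1..r}" "y = fwd n x d \<or> y = bwd n x d" by blast
    then show "y \<in> ?L" using x r
      unfolding ring_adj_def ring_dist_def fwd_def bwd_def by (auto split: if_splits)
  qed
  have disj: "fwd n x ` {1..r} \<inter> bwd n x ` {1..r} = {}"
    using x r by (auto simp: fwd_def bwd_def split: if_splits)
  have inj: "inj_on (fwd n x) {1..r}" "inj_on (bwd n x) {1..r}"
    using x r by (auto simp: inj_on_def fwd_def bwd_def split: if_splits)
  show ?thesis
    unfolding eq by (subst sum.union_disjoint[OF _ _ disj])
      (simp_all add: sum.reindex[OF inj(1)] sum.reindex[OF inj(2)] sum.distrib del: One_nat_def)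
qed

lemma card_ring_adj:
  assumes "x < n" "2 * r < n" shows "card {y. y < n \<and> ring_adj n r x y} = 2 * r"
  using sum_ring_adj[OF assms, of "\<lambda>_. 1 :: nat"] by simp

lemma ring_adj_commute: "ring_adj n r x y \<longleftrightarrow> ring_adj n r y x"
  by (auto simp: ring_adj_def ring_dist_def abs_minus_commute)

text \<open>The eigenvalue of the ring lattice for frequency \<open>m\<close>.\<close>
definition mu :: "nat \<Rightarrow> nat \<Rightarrow> nat \<Rightarrow> real" where
  "mu n r m = (\<Sum>d=1..r. 2 * cos (2 * pi * real m * real d / n))"

lemma harmonic_shift:
  assumes "x < n" "d < n"
  shows "harmonic n t (fwd n x d) + harmonic n t (bwd n x d)
    = 2 * cos (2 * pi * real (fst t) * real d / n) * harmonic n t x"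
proof -
  define m where "m = fst t"
  have n: "real n \<noteq> 0" using assms by simp
  have per: "cos (y + 2 * pi * real m) = cos y" "sin (y + 2 * pi * real m) = sin y"
    "cos (y - 2 * pi * real m) = cos y" "sin (y - 2 * pi * real m) = sin y" for y
    by (simp_all add: cos_add sin_add cos_diff sin_diff cos_integer_2pi sin_integer_2pi)
  have f: "2 * pi * real m * real (fwd n x d) / n = 2 * pi * real m * real x / n + 2 * pi * real m * real d / n
     \<or> 2 * pi * real m * real (fwd n x d) / n = (2 * pi * real m * real x / n + 2 * pi * real m * real d / n) - 2 * pi * real m"
    using n by (auto simp: fwd_def field_simps of_nat_diff)
  have b: "2 * pi * real m * real (bwd n x d) / n = 2 * pi * real m * real x / n - 2 * pi * real m * real d / n
     \<or> 2 * pi * real m * real (bwd n x d) / n = (2 * pi * real m * real x / n - 2 * pi * real m * real d / n) + 2 * pi * real m"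
    using n assms by (auto simp: bwd_def field_simps of_nat_diff)
  have "cos (2 * pi * real m * real (fwd n x d) / n) = cos (2 * pi * real m * real x / n + 2 * pi * real m * real d / n)"
    "sin (2 * pi * real m * real (fwd n x d) / n) = sin (2 * pi * real m * real x / n + 2 * pi * real m * real d / n)"
    "cos (2 * pi * real m * real (bwd n x d) / n) = cos (2 * pi * real m * real x / n - 2 * pi * real m * real d / n)"
    "sin (2 * pi * real m * real (bwd n x d) / n) = sin (2 * pi * real m * real x / n - 2 * pi * real m * real d / n)"
    using f b per by metis+
  then show ?thesis by (simp add: harmonic_def m_def[symmetric] cos_add cos_diff sin_add sin_diff)
qed

lemma ring_harmonic_eigen:
  assumes "x < n" "2 * r < n"
  shows "(\<Sum>y<n. of_bool (ring_adj n r x y) * harmonic n t y) = mu n r (fst t) * harmonic n t x"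
proof -
  have "(\<Sum>y<n. of_bool (ring_adj n r x y) * harmonic n t y) = sum (harmonic n t) {y. y < n \<and> ring_adj n r x y}"
    by (rule sum.mono_neutral_cong_right) auto
  also have "\<dots> = (\<Sum>d=1..r. 2 * cos (2 * pi * real (fst t) * real d / n) * harmonic n t x)"
    unfolding sum_ring_adj[OF assms] using assms by (intro sum.cong refl harmonic_shift) auto
  finally show ?thesis by (simp add: mu_def sum_distrib_right)
qed

lemma mu_0: "mu n r 0 = 2 * real r" by (simp add: mu_def)

lemma mu_reflect: assumes "m \<le> n" "0 < n" shows "mu n r (n - m) = mu n r m"
proof -
  have "cos (2 * pi * real (n - m) * real d / n) = cos (2 * pi * real m * real d / n)" for d
  proof -
    have "2 * pi * real (n - m) * real d / n = 2 * pi * real d - 2 * pi * real m * real d / n"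
      using assms by (simp add: of_nat_diff field_simps)
    then show ?thesis by (simp add: cos_diff cos_integer_2pi sin_integer_2pi)
  qed
  then show ?thesis by (simp add: mu_def)
qed

lemma mu_deficit: "2 * real r - mu n r m = 4 * (\<Sum>d=1..r. (sin (pi * real m * real d / n))\<^sup>2)"
proof -
  have "2 * cos (2 * pi * real m * real d / n) = 2 - 4 * (sin (pi * real m * real d / n))\<^sup>2" for d
    using cos_double_sin[of "pi * real m * real d / n"] by (simp add: algebra_simps)
  then show ?thesis by (simp add: mu_def sum_subtractf sum_distrib_left)
qed

lemma mu_le: "mu n r m \<le> 2 * real r"
  using mu_deficit[of r n m] sum_nonneg[of "{1..r}" "\<lambda>d. (sin (pi * real m * real d / n))\<^sup>2"] by simp

lemma abs_mu_le: "\<bar>mu n r m\<bar> \<le> 2 * real r"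
proof -
  have "\<bar>mu n r m\<bar> \<le> (\<Sum>d=1..r. 2 * 1)"
    unfolding mu_def by (intro order_trans[OF sum_abs] sum_mono) (auto simp: abs_mult)
  then show ?thesis by simp
qed

text \<open>For low frequencies both bounds on \<open>2 r - mu n r m\<close> are multiples of \<open>\<Sum> d\<^sup>2\<close>. Keeping the sum itself
lets the gap between \<open>m = 1\<close> and \<open>m \<ge> 2\<close> be a difference of two coefficients.\<close>
definition sq_sum :: "nat \<Rightarrow> real" where "sq_sum r = (\<Sum>d=1..r. (real d)\<^sup>2)"

lemma sq_sum_bounds: "real r ^ 3 / 3 \<le> sq_sum r" "sq_sum r \<le> real r ^ 3"
proof -
  have "real r ^ 3 / 3 \<le> sq_sum r \<and> sq_sum r \<le> real r ^ 3"
  proof (induction r)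
    case (Suc r)
    have "real (Suc r) ^ 3 = real r ^ 3 + 3 * (real r)\<^sup>2 + 3 * real r + 1" "(real (Suc r))\<^sup>2 = (real r)\<^sup>2 + 2 * real r + 1"
      by (simp_all add: power2_eq_square power3_eq_cube algebra_simps)
    moreover have "sq_sum (Suc r) = sq_sum r + (real (Suc r))\<^sup>2" by (simp add: sq_sum_def)
    moreover have "0 \<le> real r" "0 \<le> (real r)\<^sup>2" by simp_all
    ultimately show ?case using Suc by linarith
  qed (simp add: sq_sum_def)
  then show "real r ^ 3 / 3 \<le> sq_sum r" "sq_sum r \<le> real r ^ 3" by auto
qed

lemma mu_1_deficit_le: "2 * real r - mu n r 1 \<le> 40 * sq_sum r / (real n)\<^sup>2"
proof -
  have "(sin (pi * real d / n))\<^sup>2 \<le> 10 * (real d)\<^sup>2 / (real n)\<^sup>2" for d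
  proof -
    have "(sin (pi * real d / n))\<^sup>2 \<le> (pi * real d / n)\<^sup>2"
      using abs_sin_x_le_abs_x[of "pi * real d / n"] by (simp only: abs_le_square_iff)
    also have "\<dots> = pi\<^sup>2 * ((real d)\<^sup>2 / (real n)\<^sup>2)" by (simp add: power_divide power_mult_distrib)
    also have "\<dots> \<le> 10 * ((real d)\<^sup>2 / (real n)\<^sup>2)" by (intro mult_right_mono pi_power2_le_10) auto
    finally show ?thesis by simp
  qed
  then have "(\<Sum>d=1..r. (sin (pi * real d / n))\<^sup>2) \<le> (\<Sum>d=1..r. 10 * (real d)\<^sup>2 / (real n)\<^sup>2)"
    by (intro sum_mono) auto
  then show ?thesis
    unfolding mu_deficit by (simp add: sq_sum_def sum_divide_distrib[symmetric] sum_distrib_left[symmetric])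
qed

lemma mu_deficit_ge:
  assumes "2 * m * r \<le> n" "0 < n"
  shows "16 * (real m)\<^sup>2 * sq_sum r / (real n)\<^sup>2 \<le> 2 * real r - mu n r m"
proof -
  have "(2 * real m * real d / n)\<^sup>2 \<le> (sin (pi * real m * real d / n))\<^sup>2" if "d \<in> {1..r}" for d
  proof (rule power_mono)
    have "m * d \<le> m * r" using that by simp
    then have "2 * m * d \<le> n" using assms(1) by linarith
    then have "real (2 * m * d) \<le> real n" by (rule of_nat_mono)
    then have "2 / pi * (pi * real m * real d / n) \<le> sin (pi * real m * real d / n)"
      using assms(2) by (intro sin_ge_chord) (auto simp: field_simps)
    then show "2 * real m * real d / n \<le> sin (pi * real m * real d / n)" by simp
  qed auto
  then have "(\<Sum>d=1..r. (2 * real m * real d / n)\<^sup>2) \<le> (\<Sum>d=1..r. (sin (pi * real m * real d / n))\<^sup>2)"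
    by (rule sum_mono)
  moreover have "(\<Sum>d=1..r. (2 * real m * real d / n)\<^sup>2) = 4 * (real m)\<^sup>2 * sq_sum r / (real n)\<^sup>2"
    by (simp add: sq_sum_def sum_distrib_left sum_divide_distrib power_mult_distrib power_divide)
  ultimately show ?thesis unfolding mu_deficit by simp
qed

text \<open>Once half a period of the harmonic fits into the arc of \<open>r\<close> steps, the Dirichlet kernel
\<open>\<Sum> 2 cos (2 d y) = sin ((2 r + 1) y) / sin y - 1\<close> is at most
\<open>1 / sin y \<le> n / (2 m) \<le> r\<close>, half of the top value \<open>2 r\<close>.\<close>
lemma mu_high_le:
  assumes "0 < m" "2 * m \<le> n" "n \<le> 2 * m * r"
  shows "mu n r m \<le> real r"
proof -
  define y where "y = pi * real m / n"
  have n: "0 < n" using assms by simp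
  have y: "0 \<le> y" "y \<le> pi / 2" using assms n by (auto simp: y_def field_simps)
  have "2 / pi * y \<le> sin y" by (rule sin_ge_chord[OF y])
  then have s: "2 * real m / n \<le> sin y" by (simp add: y_def)
  moreover have "0 < 2 * real m / n" using assms n by simp
  ultimately have s0: "0 < sin y" by linarith
  have tel: "(\<Sum>d=1..j. 2 * cos (2 * pi * real m * real d / n)) * sin y = sin ((2 * real j + 1) * y) - sin y" for j
  proof (induction j)
    case (Suc j)
    have "2 * cos (2 * real (Suc j) * y) * sin y = sin ((2 * real (Suc j) + 1) * y) - sin ((2 * real j + 1) * y)"
    proof -
      have "sin ((2 * real (Suc j) + 1) * y) = sin (2 * real (Suc j) * y + y)"
        "sin ((2 * real j + 1) * y) = sin (2 * real (Suc j) * y - y)" by (simp_all add: algebra_simps)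
      then show ?thesis by (simp add: sin_add sin_diff)
    qed
    moreover have "2 * real (Suc j) * y = 2 * pi * real m * real (Suc j) / n" by (simp add: y_def)
    ultimately show ?case using Suc by (simp add: algebra_simps)
  qed simp
  have "mu n r m * sin y \<le> 1" using tel[of r] s0 sin_le_one[of "(2 * real r + 1) * y"]
    unfolding mu_def by linarith
  then have "mu n r m \<le> 1 / sin y" using s0 by (simp add: field_simps)
  also have "\<dots> \<le> 1 / (2 * real m / n)" using s assms n by (intro divide_left_mono) (auto intro!: divide_pos_pos mult_pos_pos s0)
  also have "\<dots> \<le> real r"
  proof -
    have "real n \<le> real (2 * m * r)" using assms(3) by (rule of_nat_mono)
    then show ?thesis using assms by (simp add: field_simps)
  qed
  finally show ?thesis .
qed

section \<open>Spectral gaps of the expected adjacency matrix\<close>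

lemma sum_inverse_fourth_powers_le: "(\<Sum>m=2..<n. 1 / real m ^ 4) \<le> 1"
proof -
  have "(\<Sum>m=2..<n. 1 / real m ^ 4) \<le> 1 - 1 / real (max n 2 - 1)"
  proof (induction n)
    case (Suc n)
    show ?case
    proof (cases "n < 2")
      case False
      then have n: "2 \<le> real n" by simp
      have "1 / real n ^ 4 \<le> 1 / (real n * (real n - 1))"
      proof (rule divide_left_mono)
        have "real n * (real n - 1) \<le> real n * real n" using n by simp
        also have "\<dots> = real n ^ 2" by (simp add: power2_eq_square)
        also have "\<dots> \<le> real n ^ 4" using n by (intro power_increasing) auto
        finally show "real n * (real n - 1) \<le> real n ^ 4" .
      qed (use n in auto)
      also have "\<dots> = 1 / (real n - 1) - 1 / real n" using n by (simp add: field_simps)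
      finally have "1 / real n ^ 4 \<le> 1 / (real n - 1) - 1 / real n" .
      then show ?thesis using Suc False by (simp add: of_nat_diff max_def split: if_splits)
    qed (auto simp: max_def)
  qed simp
  also have "\<dots> \<le> 1" by simp
  finally show ?thesis .
qed

text \<open>The position of node \<open>a\<close> is \<open>p a\<close>, and \<open>k = 2 r\<close>. The condition on \<open>N\<close> puts the noise below the gap, whose
size is \<open>s r\<^sup>3 / n\<^sup>2\<close>.\<close>
locale noisy_ring =
  fixes n r :: nat and p :: "nat \<Rightarrow> nat" and s q :: real and W :: "nat \<Rightarrow> nat \<Rightarrow> real" and N :: real
  assumes p: "bij_betw p {..<n} {..<n}" and r_pos: "0 < r" and r_le: "16 * r \<le> n"
    and s_pos: "0 < s" and q_nonneg: "0 \<le> q"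
    and sym_W: "\<And>a b. a < n \<Longrightarrow> b < n \<Longrightarrow> W a b = W b a" and diag_W: "\<And>a. a < n \<Longrightarrow> W a a = 0"
    and op_W: "opnorm_le n W N" and N_small: "N \<le> s * (real r ^ 3 / (real n)\<^sup>2)"
begin

definition M :: "nat \<Rightarrow> nat \<Rightarrow> real" where
  "M a b = s * of_bool (ring_adj n r (p a) (p b)) + q"

definition ev :: "nat \<times> bool \<Rightarrow> real" where
  "ev t = s * mu n r (fst t) + (if fst t = 0 then q * n else 0)"

definition mode :: "nat \<times> bool \<Rightarrow> nat \<Rightarrow> real" where
  "mode t a = harmonic n t (p a)"

definition modes :: "(nat \<times> bool) set" where "modes = {..<n} \<times> UNIV"

lemma p_less: "a < n \<Longrightarrow> p a < n" using p by (auto simp: bij_betw_def)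

lemma p_eq_iff: "a < n \<Longrightarrow> b < n \<Longrightarrow> p a = p b \<longleftrightarrow> a = b"
  using p by (auto simp: bij_betw_def inj_on_def)

lemma n_ge: "16 \<le> n" using r_pos r_le by simp

lemma sum_p: "(\<Sum>a<n. g (p a)) = (\<Sum>x<n. g x)"
  using sum.reindex_bij_betw[OF p] .

sublocale perturbed_frame n modes mode M W ev N
proof
  show "finite modes" by (simp add: modes_def)
  show "0 < n" using n_ge by simp
  show "(\<Sum>t\<in>modes. mode t a * mode t b) = (if a = b then real n else 0)" if "a < n" "b < n" for a b
    using harmonic_frame[OF p_less[OF that(1)] p_less[OF that(2)]] p_eq_iff[OF that]
    by (simp add: mode_def modes_def)
  show "M a b = M b a" for a b by (simp add: M_def ring_adj_commute)
  show "mv n M (mode t) a = ev t * mode t a" if t: "t \<in> modes" and a: "a < n" for t a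
  proof -
    obtain m \<sigma> where t': "t = (m, \<sigma>)" "m < n" using t by (auto simp: modes_def)
    have "mv n M (mode t) a = s * (\<Sum>b<n. of_bool (ring_adj n r (p a) (p b)) * harmonic n t (p b)) + q * (\<Sum>b<n. harmonic n t (p b))"
      unfolding sum_distrib_left sum.distrib[symmetric] mv_def M_def mode_def
      by (intro sum.cong refl) (simp add: algebra_simps)
    also have "(\<Sum>b<n. of_bool (ring_adj n r (p a) (p b)) * harmonic n t (p b)) = mu n r (fst t) * harmonic n t (p a)"
      using sum_p[of "\<lambda>y. of_bool (ring_adj n r (p a) y) * harmonic n t y"]
        ring_harmonic_eigen[OF p_less[OF a], of r t] r_le r_pos by simp
    also have "(\<Sum>b<n. harmonic n t (p b)) = (if m = 0 \<and> \<sigma> then real n else 0)"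
      using sum_p[of "harmonic n t"] harmonic_sum[OF t'(2)] t'(1) by simp
    also have "s * (mu n r (fst t) * harmonic n t (p a)) + q * (if m = 0 \<and> \<sigma> then real n else 0) = ev t * mode t a"
      by (auto simp: ev_def mode_def t'(1) harmonic_def algebra_simps)
    finally show ?thesis .
  qed
qed (use sym_W op_W in auto)

text \<open>Frequencies \<open>1\<close> and \<open>n - 1\<close> give the same harmonics up to sign.\<close>
definition low :: "(nat \<times> bool) set" where "low = {1, n - 1} \<times> UNIV"

text \<open>\<open>s G\<close> is the size of the gap around the \<open>m = 1\<close> eigenvalue, and \<open>rho\<close> is, up to
constants, the ratio of that eigenvalue to the gap, because \<open>G rho = r\<close>.\<close>
definition G :: real where "G = real r ^ 3 / (real n)\<^sup>2"

definition rho :: real where "rho = (real n)\<^sup>2 / (real r)\<^sup>2"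

lemma low_subset: "low \<subseteq> modes" using n_ge by (auto simp: low_def modes_def)

lemma real_r: "0 < real r" "16 * real r \<le> real n" "0 < real n"
  using r_pos r_le n_ge by (auto simp flip: of_nat_mult)

lemma G_pos: "0 < G" using real_r by (simp add: G_def)

lemma rho_ge: "256 \<le> rho"
proof -
  have "(16 * real r)\<^sup>2 \<le> (real n)\<^sup>2" using real_r by (intro power_mono) auto
  then show ?thesis using real_r by (simp add: rho_def field_simps)
qed

lemma G_rho: "G * rho = real r"
  using real_r by (simp add: G_def rho_def power2_eq_square power3_eq_cube)

lemma G_le: "256 * G \<le> real r"
  using mult_left_mono[OF rho_ge less_imp_le[OF G_pos]] G_rho by simp

lemma N_le: "N \<le> s * G" using N_small by (simp add: G_def)

lemma sq_sum_G: "G / 3 \<le> sq_sum r / (real n)\<^sup>2" "sq_sum r / (real n)\<^sup>2 \<le> G"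
  unfolding G_def using divide_right_mono[OF sq_sum_bounds(1)[of r], of "(real n)\<^sup>2"]
    divide_right_mono[OF sq_sum_bounds(2)[of r], of "(real n)\<^sup>2"] by (simp_all add: mult.commute)

lemma mu_1_deficit_bounds: "2 * real r - mu n r 1 \<le> real r / 6" "5 * G \<le> 2 * real r - mu n r 1"
proof -
  have "2 * real r - mu n r 1 \<le> 40 * G" using mu_1_deficit_le[of r n] sq_sum_G by simp
  then show "2 * real r - mu n r 1 \<le> real r / 6" using G_le G_pos by linarith
  have "16 * (real 1)\<^sup>2 * sq_sum r / (real n)\<^sup>2 \<le> 2 * real r - mu n r 1"
    using r_le n_ge by (intro mu_deficit_ge) auto
  then show "5 * G \<le> 2 * real r - mu n r 1" using sq_sum_G G_pos by simp
qed

text \<open>The gap grows quadratically in the frequency until the harmonic oscillates within a neighborhood,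
and from then on it is of the order of the eigenvalue itself.\<close>
lemma mu_gap_half:
  assumes "2 \<le> m" "2 * m \<le> n"
  shows "2 * (real m)\<^sup>2 * G \<le> mu n r 1 - mu n r m \<or> 5 / 6 * real r \<le> mu n r 1 - mu n r m"
proof (cases "2 * m * r \<le> n")
  case True
  have m: "4 \<le> (real m)\<^sup>2" using assms(1) power_mono[of 2 "real m" 2] by simp
  have "(16 * (real m)\<^sup>2 - 40) * (sq_sum r / (real n)\<^sup>2) \<le> mu n r 1 - mu n r m"
    using mu_deficit_ge[OF True] mu_1_deficit_le[of r n] n_ge by (simp add: algebra_simps diff_divide_distrib)
  moreover have "6 * (real m)\<^sup>2 * (G / 3) \<le> (16 * (real m)\<^sup>2 - 40) * (sq_sum r / (real n)\<^sup>2)"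
    using m sq_sum_G G_pos by (intro mult_mono) auto
  moreover have "6 * (real m)\<^sup>2 * (G / 3) = 2 * (real m)\<^sup>2 * G" by simp
  ultimately show ?thesis by linarith
next
  case False
  then have "mu n r m \<le> real r" using assms by (intro mu_high_le) auto
  then show ?thesis using mu_1_deficit_bounds by linarith
qed

text \<open>By reflection \<open>m \<mapsto> n - m\<close> it suffices to know the gaps for \<open>2 m \<le> n\<close>.\<close>
lemma mode_cases:
  assumes "t \<in> modes - low"
  obtains "fst t = 0" | m where "2 \<le> m" "2 * m \<le> n" "fst t \<noteq> 0" "fst t = m \<or> fst t = n - m" "fst t < n" "mu n r (fst t) = mu n r m" 
proof -
  obtain m0 \<sigma> where t: "t = (m0, \<sigma>)" "m0 < n" "m0 \<noteq> 1" "m0 \<noteq> n - 1" using assms by (cases t) (auto simp: modes_def low_def)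
  consider "m0 = 0" | "2 \<le> m0" "2 * m0 \<le> n" | "2 \<le> m0" "2 * m0 > n" using t by linarith
  then show ?thesis
  proof cases
    case 3
    have "mu n r (n - m0) = mu n r m0" using t by (intro mu_reflect) auto
    then show ?thesis using 3 t by (intro that(2)[of "n - m0"]) auto
  qed (use t that in auto)
qed

context
  fixes l :: real assumes l: "\<bar>l - s * mu n r 1\<bar> \<le> N"
begin

lemma l_ge: "s * real r \<le> l" "0 < l"
proof -
  have "s * (2 * real r - real r / 6) \<le> s * mu n r 1" using mu_1_deficit_bounds s_pos by (intro mult_left_mono) auto
  moreover have "s * G \<le> s * (real r / 256)" using G_le s_pos by (intro mult_left_mono) auto
  moreover have "0 < s * real r" using s_pos real_r by simp
  ultimately show "s * real r \<le> l" "0 < l" using l N_le by (auto simp: algebra_simps abs_le_iff)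
qed

lemma gap_zero: "fst t = 0 \<Longrightarrow> 4 * s * G + q * n \<le> ev t - l"
proof -
  assume "fst t = 0"
  then have "ev t = s * (2 * real r) + q * n" by (simp add: ev_def mu_0)
  moreover have "s * (5 * G) \<le> s * (2 * real r - mu n r 1)" using mu_1_deficit_bounds s_pos by (intro mult_left_mono) auto
  ultimately show ?thesis using l N_le by (auto simp: algebra_simps abs_le_iff)
qed

lemma gap_nonzero:
  assumes m: "2 \<le> m" "2 * m \<le> n" and t: "fst t \<noteq> 0" "mu n r (fst t) = mu n r m"
  shows "s * (real m)\<^sup>2 * G \<le> l - ev t \<or> s * real r / 2 \<le> l - ev t"
proof -
  have ev: "ev t = s * mu n r m" using t by (simp add: ev_def)
  have m4: "1 \<le> (real m)\<^sup>2" using m by simp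
  show ?thesis using mu_gap_half[OF m]
  proof
    assume "2 * (real m)\<^sup>2 * G \<le> mu n r 1 - mu n r m"
    then have "s * (2 * (real m)\<^sup>2 * G) \<le> s * (mu n r 1 - mu n r m)" using s_pos by (intro mult_left_mono) auto
    moreover have "s * G * 1 \<le> s * G * (real m)\<^sup>2" using m4 s_pos G_pos by (intro mult_left_mono) auto
    ultimately have "s * (real m)\<^sup>2 * G \<le> l - ev t"
      using l N_le unfolding ev by (simp add: algebra_simps abs_le_iff)
    then show ?thesis ..
  next
    assume "5 / 6 * real r \<le> mu n r 1 - mu n r m"
    then have "s * (5 / 6 * real r) \<le> s * (mu n r 1 - mu n r m)" using s_pos by (intro mult_left_mono) auto
    moreover have "s * (256 * G) \<le> s * real r" using G_le s_pos by (intro mult_left_mono) auto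
    moreover have "0 < s * real r" using s_pos real_r by simp
    ultimately have "s * real r / 2 \<le> l - ev t"
      using l N_le unfolding ev by (simp add: algebra_simps abs_le_iff)
    then show ?thesis ..
  qed
qed

lemma sep: 
  assumes "t \<in> modes - low" shows "4 * s * G \<le> \<bar>l - ev t\<bar>"
  using assms
proof (cases rule: mode_cases)
  case 1
  have "0 \<le> q * n" using q_nonneg by simp
  then show ?thesis using gap_zero[OF 1] by linarith
next
  case (2 m)
  have "s * G * 4 \<le> s * G * (real m)\<^sup>2"
    using 2(1) power_mono[of 2 "real m" 2] s_pos G_pos by (intro mult_left_mono) auto
  moreover have "s * (256 * G) \<le> s * real r" using G_le s_pos by (intro mult_left_mono) auto
  moreover have "0 < s * G" using s_pos G_pos by simp
  ultimately show ?thesis using gap_nonzero[OF 2(1,2,3,6)] by (auto simp: algebra_simps)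
qed

lemma sep': "t \<in> modes - low \<Longrightarrow> l \<noteq> ev t"
  using sep[of t] mult_pos_pos[OF s_pos G_pos] by auto

text \<open>The factor by which noise along frequency \<open>m\<close> enters \<open>M u\<close>; cosine and sine share it.\<close>
definition ratio :: "nat \<Rightarrow> real" where "ratio m = ev (m, True) / (l - ev (m, True))"

lemma ratio_eq: "ev t / (l - ev t) = ratio (fst t)"
  by (simp add: ratio_def ev_def)

lemma ratio_0: "(ratio 0)\<^sup>2 \<le> rho\<^sup>2 / 4"
proof -
  define Q where "Q = q * n"
  have Q: "0 \<le> Q" using q_nonneg by (simp add: Q_def)
  have g: "4 * s * G + Q \<le> ev (0, True) - l" using gap_zero[of "(0, True)"] by (simp add: Q_def)
  have e: "ev (0, True) = 2 * s * real r + Q" by (simp add: ev_def mu_0 Q_def)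
  have sG: "0 < s * G" using s_pos G_pos by simp
  have sr: "s * G * rho = s * real r" using G_rho by simp
  have "\<bar>ratio 0\<bar> = ev (0, True) / (ev (0, True) - l)"
    using g Q sG e s_pos by (simp add: ratio_def abs_divide)
  also have "\<dots> \<le> rho / 2"
  proof -
    have "Q * 1 \<le> Q * (rho / 2)" using Q rho_ge by (intro mult_left_mono) auto
    moreover have "rho / 2 * (4 * s * G + Q) = 2 * (s * G * rho) + Q * (rho / 2)"
      by (simp add: algebra_simps)
    ultimately have "ev (0, True) \<le> rho / 2 * (4 * s * G + Q)"
      unfolding e using sr by linarith
    also have "\<dots> \<le> rho / 2 * (ev (0, True) - l)" using g rho_ge by (intro mult_left_mono) auto
    finally show ?thesis using g Q sG by (simp add: divide_le_eq)
  qed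
  finally have "\<bar>ratio 0\<bar>\<^sup>2 \<le> (rho / 2)\<^sup>2" by (intro power_mono) auto
  then show ?thesis by (simp add: power_divide)
qed

text \<open>
  The first two terms cover \<open>m\<close> and \<open>n - m\<close> in the quadratic range of the gap, the last one the range where
  the gap is of order \<open>r\<close>. Their sum avoids splitting the range of summation later.\<close>
lemma ratio_nonzero:
  assumes m: "2 \<le> m" "m < n - 1"
  shows "(ratio m)\<^sup>2 \<le> 4 * rho\<^sup>2 * (1 / real m ^ 4) + 4 * rho\<^sup>2 * (1 / real (n - m) ^ 4) + 4 / (real r)\<^sup>2 * (mu n r m)\<^sup>2"
proof -
  have t: "(m, True) \<in> modes - low" using m by (auto simp: modes_def low_def)
  show ?thesis using t
  proof (cases rule: mode_cases)
    case 1 then show ?thesis using m by simp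
  next
    case (2 j)
    have ev: "ev (m, True) = s * mu n r m" using m by (simp add: ev_def)
    have sr: "0 < s * real r" "0 < s * G" using s_pos real_r G_pos by auto
    consider "s * (real j)\<^sup>2 * G \<le> l - ev (m, True)" | "s * real r / 2 \<le> l - ev (m, True)"
      using gap_nonzero[OF 2(1,2,3,6)] by blast
    then show ?thesis
    proof cases
      case 1
      have j: "0 < (real j)\<^sup>2" using 2 by simp
      have pos: "0 < s * (real j)\<^sup>2 * G" using s_pos G_pos j by simp
      have "\<bar>ratio m\<bar> = s * \<bar>mu n r m\<bar> / (l - ev (m, True))"
        using 1 pos s_pos by (simp add: ratio_def abs_divide abs_mult ev)
      also have "\<dots> \<le> s * (2 * real r) / (s * (real j)\<^sup>2 * G)"
        using s_pos abs_mu_le 1 pos by (intro frac_le mult_left_mono) auto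
      also have "\<dots> = 2 * rho / (real j)\<^sup>2"
        using s_pos G_pos j by (simp add: G_rho[symmetric] field_simps)
      finally have "\<bar>ratio m\<bar>\<^sup>2 \<le> (2 * rho / (real j)\<^sup>2)\<^sup>2" by (intro power_mono) auto
      also have "\<dots> = 4 * rho\<^sup>2 * (1 / real j ^ 4)" by (simp add: power_divide power_mult_distrib flip: power_mult)
      finally have *: "(ratio m)\<^sup>2 \<le> 4 * rho\<^sup>2 * (1 / real j ^ 4)" by simp
      have nonneg: "0 \<le> 4 * rho\<^sup>2 * (1 / real m ^ 4)" "0 \<le> 4 * rho\<^sup>2 * (1 / real (n - m) ^ 4)"
        "0 \<le> 4 / (real r)\<^sup>2 * (mu n r m)\<^sup>2" by simp_all
      have "j = m \<or> j = n - m" using 2 m by auto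
      then show ?thesis
      proof
        assume j: "j = m" show ?thesis using *[unfolded j] nonneg by linarith
      next
        assume j: "j = n - m" show ?thesis using *[unfolded j] nonneg by linarith
      qed
    next
      case 2
      have "\<bar>ratio m\<bar> = s * \<bar>mu n r m\<bar> / (l - ev (m, True))"
        using 2 sr s_pos by (simp add: ratio_def abs_divide abs_mult ev)
      also have "\<dots> \<le> s * \<bar>mu n r m\<bar> / (s * real r / 2)"
        using s_pos sr 2 by (intro frac_le mult_left_mono) auto
      also have "\<dots> = 2 * \<bar>mu n r m\<bar> / real r" using s_pos by simp
      finally have "\<bar>ratio m\<bar>\<^sup>2 \<le> (2 * \<bar>mu n r m\<bar> / real r)\<^sup>2" by (intro power_mono) auto
      also have "\<dots> = 4 / (real r)\<^sup>2 * (mu n r m)\<^sup>2" by (simp add: power_divide power_mult_distrib)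
      finally have "(ratio m)\<^sup>2 \<le> 4 / (real r)\<^sup>2 * (mu n r m)\<^sup>2" by simp
      moreover have "0 \<le> 4 * rho\<^sup>2 * (1 / real m ^ 4)" "0 \<le> 4 * rho\<^sup>2 * (1 / real (n - m) ^ 4)" by simp_all
      ultimately show ?thesis by linarith
    qed
  qed
qed

end

text \<open>Parseval's identity for one row of the lattice, which has \<open>2 r\<close> entries equal to \<open>1\<close>.\<close>
lemma sum_mu_power2: "(\<Sum>m<n. (mu n r m)\<^sup>2) = 2 * real r * n"
proof -
  define b where "b = (\<lambda>a. of_bool (ring_adj n r (p 0) (p a)) :: real)"
  have 0: "0 < n" using n_ge by simp
  have b: "inn n (mode t) b = mu n r (fst t) * mode t 0" for t
  proof -
    have "inn n (mode t) b = (\<Sum>a<n. of_bool (ring_adj n r (p 0) (p a)) * harmonic n t (p a))"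
      by (simp add: inn_def b_def mode_def mult.commute)
    then show ?thesis
      using sum_p[of "\<lambda>y. of_bool (ring_adj n r (p 0) y) * harmonic n t y"]
        ring_harmonic_eigen[OF p_less[OF 0], of r t] r_le r_pos by (simp add: mode_def)
  qed
  have "inn n b b = (\<Sum>a<n. of_bool (ring_adj n r (p 0) (p a)))"
    by (simp add: inn_def b_def flip: of_bool_conj)
  also have "\<dots> = (\<Sum>x<n. of_bool (ring_adj n r (p 0) x))"
    using sum_p[of "\<lambda>x. of_bool (ring_adj n r (p 0) x) :: real"] .
  also have "\<dots> = real (card {y. y < n \<and> ring_adj n r (p 0) y})"
    by (simp add: of_bool_def sum.If_cases Int_def lessThan_def)
  also have "\<dots> = 2 * real r"
    using card_ring_adj[OF p_less[OF 0], of r] r_le r_pos by simp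
  finally have "2 * real r = (1 / n) * (\<Sum>t\<in>modes. (mu n r (fst t) * mode t 0) * (mu n r (fst t) * mode t 0))"
    using parseval[of b b] by (simp add: b)
  also have "(\<Sum>t\<in>modes. (mu n r (fst t) * mode t 0) * (mu n r (fst t) * mode t 0))
      = (\<Sum>m<n. (mu n r m)\<^sup>2 * ((mode (m, True) 0)\<^sup>2 + (mode (m, False) 0)\<^sup>2))"
    unfolding modes_def sum_modes[OF finite_lessThan]
    by (simp add: power2_eq_square algebra_simps)
  also have "\<dots> = (\<Sum>m<n. (mu n r m)\<^sup>2)" by (simp add: mode_def harmonic_norm)
  finally show ?thesis using n_pos by (simp add: field_simps)
qed

lemma modes_minus_low: "modes - low = ({..<n} - {1, n - 1}) \<times> UNIV"
  by (auto simp: modes_def low_def)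

text \<open>The sum has the order \<open>rho\<^sup>2\<close> of its first terms: the low frequencies form a convergent series \<open>\<Sum> 1 / m\<^sup>4\<close> and
the high ones are damped by the decay of \<open>mu\<close>, contributing \<open>O(n / r)\<close>.\<close>
lemma sum_ratio_power2:
  assumes l: "\<bar>l - s * mu n r 1\<bar> \<le> N"
  shows "(\<Sum>m\<in>{..<n} - {1, n - 1}. (ratio l m)\<^sup>2) \<le> (4 * rho)\<^sup>2"
proof -
  have split: "{..<n} - {1, n - 1} = insert 0 {2..<n-1}" using n_ge by auto
  have refl: "(\<Sum>m=2..<n-1. 1 / real (n - m) ^ 4) \<le> 1"
  proof -
    have "(\<Sum>m=2..<n-1. 1 / real (n - m) ^ 4) = (\<Sum>m=2..<n-1. 1 / real m ^ 4)"
      by (rule sum.reindex_bij_witness[of _ "\<lambda>m. n - m" "\<lambda>m. n - m"]) auto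
    then show ?thesis using sum_inverse_fourth_powers_le[of "n - 1"] by simp
  qed
  have mus: "(\<Sum>m=2..<n-1. (mu n r m)\<^sup>2) \<le> 2 * real r * n"
    unfolding sum_mu_power2[symmetric] by (rule sum_mono2) auto
  have nr: "8 * (real n / real r) \<le> rho\<^sup>2"
  proof -
    have x: "16 \<le> real n / real r" using real_r by (simp add: field_simps)
    have "8 * (real n / real r) \<le> (real n / real r) * (real n / real r)" using x by (intro mult_right_mono) auto
    also have "\<dots> = rho" by (simp add: rho_def power2_eq_square)
    also have "\<dots> \<le> rho\<^sup>2" using rho_ge by (simp add: power2_eq_square)
    finally show ?thesis .
  qed
  have "(\<Sum>m\<in>{..<n} - {1, n - 1}. (ratio l m)\<^sup>2) = (ratio l 0)\<^sup>2 + (\<Sum>m=2..<n-1. (ratio l m)\<^sup>2)"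
    unfolding split by simp
  also have "\<dots> \<le> rho\<^sup>2 / 4 + (\<Sum>m=2..<n-1. 4 * rho\<^sup>2 * (1 / real m ^ 4) + 4 * rho\<^sup>2 * (1 / real (n - m) ^ 4) + 4 / (real r)\<^sup>2 * (mu n r m)\<^sup>2)"
    by (intro add_mono sum_mono ratio_0[OF l] ratio_nonzero[OF l]) auto
  also have "(\<Sum>m=2..<n-1. 4 * rho\<^sup>2 * (1 / real m ^ 4) + 4 * rho\<^sup>2 * (1 / real (n - m) ^ 4) + 4 / (real r)\<^sup>2 * (mu n r m)\<^sup>2)
     = 4 * rho\<^sup>2 * (\<Sum>m=2..<n-1. 1 / real m ^ 4) + 4 * rho\<^sup>2 * (\<Sum>m=2..<n-1. 1 / real (n - m) ^ 4) + 4 / (real r)\<^sup>2 * (\<Sum>m=2..<n-1. (mu n r m)\<^sup>2)"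
    by (simp only: sum.distrib sum_distrib_left)
  also have "\<dots> \<le> 4 * rho\<^sup>2 * 1 + 4 * rho\<^sup>2 * 1 + 4 / (real r)\<^sup>2 * (2 * real r * n)"
    by (intro add_mono mult_left_mono refl sum_inverse_fourth_powers_le mus) auto
  also have "4 / (real r)\<^sup>2 * (2 * real r * n) = 8 * (real n / real r)"
    using real_r by (simp add: power2_eq_square)
  finally have "(\<Sum>m\<in>{..<n} - {1, n - 1}. (ratio l m)\<^sup>2) \<le> rho\<^sup>2 / 4 + (8 * rho\<^sup>2 + rho\<^sup>2)" using nr by linarith
  moreover have "(4 * rho)\<^sup>2 = 16 * rho\<^sup>2" "0 \<le> rho\<^sup>2" by (simp_all add: power_mult_distrib)
  ultimately show ?thesis by linarith
qed

lemma weighted_ratio_norm: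
  assumes l: "\<bar>l - s * mu n r 1\<bar> \<le> N"
  shows "L2_set (\<lambda>t. ev t / (l - ev t) * mode t a) (modes - low) \<le> 4 * rho"
proof -
  have "(\<Sum>t\<in>modes - low. (ev t / (l - ev t) * mode t a)\<^sup>2) = (\<Sum>m\<in>{..<n} - {1, n - 1}. (ratio l m)\<^sup>2 * ((mode (m, True) a)\<^sup>2 + (mode (m, False) a)\<^sup>2))"
    unfolding modes_minus_low ratio_eq[OF l] sum_modes[OF finite_Diff[OF finite_lessThan]]
    by (simp add: power_mult_distrib algebra_simps)
  also have "\<dots> = (\<Sum>m\<in>{..<n} - {1, n - 1}. (ratio l m)\<^sup>2)" by (simp add: mode_def harmonic_norm)
  also have "\<dots> \<le> (4 * rho)\<^sup>2" by (rule sum_ratio_power2[OF l])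
  finally have "L2_set (\<lambda>t. ev t / (l - ev t) * mode t a) (modes - low) \<le> sqrt ((4 * rho)\<^sup>2)"
    unfolding L2_set_def by (rule real_sqrt_le_mono)
  also have "\<dots> = 4 * rho" using rho_ge by (intro real_sqrt_unique) auto
  finally show ?thesis .
qed

lemma ratio_norm:
  assumes l: "\<bar>l - s * mu n r 1\<bar> \<le> N"
  shows "L2_set (\<lambda>t. ev t / (l - ev t)) (modes - low) \<le> 6 * rho"
proof -
  have "(\<Sum>t\<in>modes - low. (ev t / (l - ev t))\<^sup>2) = 2 * (\<Sum>m\<in>{..<n} - {1, n - 1}. (ratio l m)\<^sup>2)"
    unfolding modes_minus_low ratio_eq[OF l] sum_modes[OF finite_Diff[OF finite_lessThan]]
    by (simp add: sum_distrib_left)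
  also have "\<dots> \<le> 2 * (4 * rho)\<^sup>2" using sum_ratio_power2[OF l] by simp
  also have "\<dots> \<le> (6 * rho)\<^sup>2" by (simp add: power_mult_distrib)
  finally have "L2_set (\<lambda>t. ev t / (l - ev t)) (modes - low) \<le> sqrt ((6 * rho)\<^sup>2)"
    unfolding L2_set_def by (rule real_sqrt_le_mono)
  also have "\<dots> = 6 * rho" using rho_ge by (intro real_sqrt_unique) auto
  finally show ?thesis .
qed

end

section \<open>Second and third eigenpair of a noisy ring lattice\<close>

text \<open>The cross product of the two rows, unless the rows are parallel. This is the dimension count in the
lower bound for the third eigenvalue.\<close>
lemma nontrivial_kernel_2_3:
  fixes a1 a2 a3 b1 b2 b3 :: real
  shows "\<exists>x y z. (x \<noteq> 0 \<or> y \<noteq> 0 \<or> z \<noteq> 0) \<and> a1 * x + a2 * y + a3 * z = 0 \<and> b1 * x + b2 * y + b3 * z = 0"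
proof -
  define x y z where "x = a2 * b3 - a3 * b2" and "y = a3 * b1 - a1 * b3" and "z = a1 * b2 - a2 * b1"
  have k: "a1 * x + a2 * y + a3 * z = 0" "b1 * x + b2 * y + b3 * z = 0"
    by (simp_all add: x_def y_def z_def algebra_simps)
  have perp: "\<exists>x y z. (x \<noteq> 0 \<or> y \<noteq> 0 \<or> z \<noteq> 0) \<and> c1 * x + c2 * y + c3 * z = 0" for c1 c2 c3 :: real
  proof (cases "c1 = 0")
    case True then show ?thesis by (intro exI[of _ 1] exI[of _ 0]) auto
  next
    case False then show ?thesis by (intro exI[of _ "- c2"] exI[of _ c1] exI[of _ 0]) auto
  qed
  show ?thesis
  proof (cases "x = 0 \<and> y = 0 \<and> z = 0")
    case False with k show ?thesis by blast
  next
    case True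
    then have par: "a2 * b3 = a3 * b2" "a3 * b1 = a1 * b3" "a1 * b2 = a2 * b1" by (auto simp: x_def y_def z_def)
    show ?thesis
    proof (cases "a1 = 0 \<and> a2 = 0 \<and> a3 = 0")
      case True
      then show ?thesis using perp[of b1 b2 b3] by auto
    next
      case False
      obtain x y z where xyz: "x \<noteq> 0 \<or> y \<noteq> 0 \<or> z \<noteq> 0" "a1 * x + a2 * y + a3 * z = 0" using perp by blast
      have "a1 * (b1 * x + b2 * y + b3 * z) = b1 * (a1 * x) + (a1 * b2) * y + (a1 * b3) * z"
        "a2 * (b1 * x + b2 * y + b3 * z) = (a2 * b1) * x + b2 * (a2 * y) + (a2 * b3) * z"
        "a3 * (b1 * x + b2 * y + b3 * z) = (a3 * b1) * x + (a3 * b2) * y + b3 * (a3 * z)"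
        by (simp_all add: algebra_simps)
      moreover have "b1 * (a1 * x) + (a2 * b1) * y + (a3 * b1) * z = b1 * (a1 * x + a2 * y + a3 * z)"
        "(a1 * b2) * x + b2 * (a2 * y) + (a3 * b2) * z = b2 * (a1 * x + a2 * y + a3 * z)"
        "(a1 * b3) * x + (a2 * b3) * y + b3 * (a3 * z) = b3 * (a1 * x + a2 * y + a3 * z)"
        by (simp_all add: algebra_simps)
      ultimately have "a1 * (b1 * x + b2 * y + b3 * z) = 0" "a2 * (b1 * x + b2 * y + b3 * z) = 0" "a3 * (b1 * x + b2 * y + b3 * z) = 0"
        unfolding xyz(2) using par by (metis mult_zero_right)+
      then have "b1 * x + b2 * y + b3 * z = 0" using False xyz by auto
      then show ?thesis using xyz by blast
    qed
  qed
qed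

text \<open>The content of a spectral decomposition in terms of entries, where a diagonal shift of the matrix is
a shift of the eigenvalues.\<close>
definition spectral_basis :: "nat \<Rightarrow> (nat \<Rightarrow> nat \<Rightarrow> real) \<Rightarrow> (nat \<Rightarrow> nat \<Rightarrow> real) \<Rightarrow> (nat \<Rightarrow> real) \<Rightarrow> bool" where
  "spectral_basis n A u e \<longleftrightarrow>
     (\<forall>j<n. \<forall>l<n. inn n (u j) (u l) = (if j = l then 1 else 0)) \<and>
     (\<forall>a<n. \<forall>b<n. (\<Sum>l<n. u l a * u l b) = (if a = b then 1 else 0)) \<and>
     antimono_on {..<n} e \<and>
     (\<forall>a<n. \<forall>b<n. A a b = (\<Sum>l<n. u l a * e l * u l b))"

lemma spectral_basis_mv:
  assumes "spectral_basis n A u e" "a < n"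
  shows "mv n A x a = (\<Sum>l<n. e l * inn n (u l) x * u l a)"
proof -
  have "mv n A x a = (\<Sum>b<n. \<Sum>l<n. u l a * e l * u l b * x b)"
    using assms by (simp add: mv_def spectral_basis_def sum_distrib_right)
  also have "\<dots> = (\<Sum>l<n. \<Sum>b<n. u l a * e l * u l b * x b)" by (rule sum.swap)
  also have "\<dots> = (\<Sum>l<n. e l * inn n (u l) x * u l a)"
    by (simp add: inn_def sum_distrib_left mult_ac)
  finally show ?thesis .
qed

lemma spectral_basis_eigen:
  assumes s: "spectral_basis n A u e" and "a < n" and j: "j < n"
  shows "mv n A (u j) a = e j * u j a"
proof -
  have "mv n A (u j) a = (\<Sum>l<n. if l = j then e j * u j a else 0)"
    unfolding spectral_basis_mv[OF assms(1,2)] using s j by (intro sum.cong) (auto simp: spectral_basis_def)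
  then show ?thesis using j by simp
qed

lemma spectral_basis_quadratic_form:
  assumes s: "spectral_basis n A u e"
  shows "inn n x (mv n A x) = (\<Sum>l<n. e l * (inn n (u l) x)\<^sup>2)"
proof -
  have "inn n x (mv n A x) = (\<Sum>a<n. \<Sum>l<n. e l * inn n (u l) x * (u l a * x a))"
    unfolding inn_def[of n x] using spectral_basis_mv[OF s]
    by (intro sum.cong refl) (simp add: sum_distrib_left mult_ac)
  also have "\<dots> = (\<Sum>l<n. \<Sum>a<n. e l * inn n (u l) x * (u l a * x a))" by (rule sum.swap)
  also have "\<dots> = (\<Sum>l<n. e l * inn n (u l) x * inn n (u l) x)"
    by (simp only: sum_distrib_left[symmetric] inn_def)
  finally show ?thesis by (simp add: power2_eq_square mult.assoc)
qed

lemma spectral_basis_parseval: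
  assumes s: "spectral_basis n A u e"
  shows "inn n x x = (\<Sum>l<n. (inn n (u l) x)\<^sup>2)"
proof -
  have "(\<Sum>l<n. (inn n (u l) x)\<^sup>2) = (\<Sum>l<n. \<Sum>a<n. \<Sum>b<n. (u l a * u l b) * (x a * x b))"
    unfolding power2_eq_square inn_def by (simp add: sum_product mult_ac)
  also have "\<dots> = (\<Sum>a<n. \<Sum>l<n. \<Sum>b<n. (u l a * u l b) * (x a * x b))" by (rule sum.swap)
  also have "\<dots> = (\<Sum>a<n. \<Sum>b<n. \<Sum>l<n. (u l a * u l b) * (x a * x b))"
    by (intro sum.cong refl sum.swap)
  also have "\<dots> = (\<Sum>a<n. \<Sum>b<n. (if a = b then 1 else 0) * (x a * x b))"
    using s by (simp add: sum_distrib_right[symmetric] spectral_basis_def)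
  also have "\<dots> = inn n x x" by (simp add: inn_def if_distrib[of "\<lambda>c. c * _"] cong: if_cong)
  finally show ?thesis ..
qed

lemma spectral_decomposition_basis:
  assumes "spectral_decomposition n A U eig"
  shows "spectral_basis n (\<lambda>a b. A $$ (a, b)) (\<lambda>l a. U $$ (a, l)) eig"
proof -
  have U: "U \<in> carrier_mat n n" and 1: "transpose_mat U * U = 1\<^sub>m n" and 2: "U * transpose_mat U = 1\<^sub>m n"
    and mono: "antimono_on {..<n} eig" and A: "A = U * mat_diag n eig * transpose_mat U"
    using assms by (auto simp: spectral_decomposition_def)
  have "inn n (\<lambda>a. U $$ (a, j)) (\<lambda>a. U $$ (a, l)) = (if j = l then 1 else 0)" if "j < n" "l < n" for j l
  proof -
    have "(transpose_mat U * U) $$ (j, l) = inn n (\<lambda>a. U $$ (a, j)) (\<lambda>a. U $$ (a, l))"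
      using that U by (simp add: scalar_prod_def inn_def atLeast0LessThan)
    then show ?thesis using 1 that by simp
  qed
  moreover have "(\<Sum>l<n. U $$ (a, l) * U $$ (b, l)) = (if a = b then 1 else 0)" if "a < n" "b < n" for a b
  proof -
    have "(U * transpose_mat U) $$ (a, b) = (\<Sum>l<n. U $$ (a, l) * U $$ (b, l))"
      using that U by (simp add: scalar_prod_def atLeast0LessThan)
    then show ?thesis using 2 that by simp
  qed
  moreover have "A $$ (a, b) = (\<Sum>l<n. U $$ (a, l) * eig l * U $$ (b, l))" if "a < n" "b < n" for a b
    using that U unfolding A by (simp add: mat_diag_mult_right[OF U] scalar_prod_def atLeast0LessThan mult_ac)
  ultimately show ?thesis using mono by (auto simp: spectral_basis_def)
qed

lemma spectral_angle_eq:
  assumes s: "spectral_decomposition n A U eig" and n: "2 < n" and a: "a < n"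
  shows "spectral_angle A U a = Arg (Complex (eig 1 * U $$ (a, 1)) (eig 2 * U $$ (a, 2)))"
proof -
  have U: "U \<in> carrier_mat n n" using s by (simp add: spectral_decomposition_def)
  have A: "A \<in> carrier_mat n n" using s U by (auto simp: spectral_decomposition_def mat_diag_def)
  note b = spectral_decomposition_basis[OF s]
  have sym: "A $$ (c, a) = A $$ (a, c)" if "c < n" for c
    using b that a by (simp add: spectral_basis_def mult_ac)
  have "scalar_prod (col U l) (col A a) = eig l * U $$ (a, l)" if "l < n" for l
  proof -
    have "scalar_prod (col U l) (col A a) = mv n (\<lambda>a b. A $$ (a, b)) (\<lambda>a. U $$ (a, l)) a"
      using U A that a sym by (simp add: scalar_prod_def mv_def atLeast0LessThan mult.commute)
    then show ?thesis using spectral_basis_eigen[OF b a that] by simp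
  qed
  then show ?thesis using n by (simp add: spectral_angle_def)
qed

context noisy_ring
begin

lemma inn_mode_M: "t \<in> modes \<Longrightarrow> inn n (mode t) (mv n M x) = ev t * inn n (mode t) x"
proof -
  assume t: "t \<in> modes"
  have "inn n (mode t) (mv n M x) = inn n (mv n M (mode t)) x" by (rule inn_mv_sym[OF symM])
  also have "\<dots> = inn n (\<lambda>a. ev t * mode t a + 0 * 0) x" using eigen[OF t] by (intro inn_cong) auto
  also have "\<dots> = ev t * inn n (mode t) x" by (subst inn_lin_left) simp
  finally show ?thesis .
qed

lemma mu_le_mu_1:
  assumes "0 < m" "m < n" shows "mu n r m \<le> mu n r 1"
proof (cases "m = 1 \<or> m = n - 1")
  case True
  then show ?thesis using mu_reflect[of 1 n r] n_ge by auto
next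
  case False
  then have "(m, True) \<in> modes - low" using assms by (auto simp: modes_def low_def)
  then show ?thesis
  proof (cases rule: mode_cases)
    case 1 then show ?thesis using assms by simp
  next
    case (2 j)
    have "0 \<le> 2 * (real j)\<^sup>2 * G" using G_pos by simp
    moreover have "0 \<le> 5 / 6 * real r" by simp
    ultimately show ?thesis using mu_gap_half[OF 2(1,2)] 2(6) unfolding fst_conv by (smt (verit))
  qed
qed

lemma inn_const: "inn n (mode (0, True)) x = (\<Sum>a<n. x a)"
  by (simp add: inn_def mode_def harmonic_def)

lemma sum_mode: "m < n \<Longrightarrow> (\<Sum>a<n. mode (m, \<sigma>) a) = (if m = 0 \<and> \<sigma> then real n else 0)"
  unfolding mode_def using sum_p[of "harmonic n (m, \<sigma>)"] harmonic_sum[of m n \<sigma>] by simp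

lemma quadratic_form_M: "inn n x (mv n M x) = (1 / n) * (\<Sum>t\<in>modes. ev t * (inn n (mode t) x)\<^sup>2)"
  unfolding parseval[of x "mv n M x"]
  by (intro arg_cong[where f = "\<lambda>y. 1 / n * y"] sum.cong refl) (simp add: inn_mode_M power2_eq_square)

lemma quadratic_form_W: "\<bar>inn n x (mv n W x)\<bar> \<le> N * inn n x x"
  using op_W by (simp add: opnorm_le_def nrm_power2[symmetric] power2_eq_square mult.assoc)

lemma inn_self_pos: "a < n \<Longrightarrow> x a \<noteq> 0 \<Longrightarrow> 0 < inn n x x"
  unfolding inn_def power2_eq_square[symmetric] by (rule sum_pos2[of _ a]) auto

context
  fixes A u e
  assumes s: "spectral_basis n A u e" and A: "\<And>a b. a < n \<Longrightarrow> b < n \<Longrightarrow> A a b = M a b + W a b"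
begin

lemma mv_A: "a < n \<Longrightarrow> mv n A x a = mv n M x a + mv n W x a"
  unfolding mv_def sum.distrib[symmetric] by (intro sum.cong refl) (simp add: A distrib_right)

lemma quadratic_form_A: "inn n x (mv n A x) = inn n x (mv n M x) + inn n x (mv n W x)"
proof -
  have "inn n x (mv n A x) = inn n x (\<lambda>a. 1 * mv n M x a + 1 * mv n W x a)"
    by (intro inn_cong) (auto simp: mv_A)
  then show ?thesis by (subst (asm) inn_lin_right) simp
qed

lemma orthonormal: "j < n \<Longrightarrow> l < n \<Longrightarrow> inn n (u j) (u l) = (if j = l then 1 else 0)"
  using s by (simp add: spectral_basis_def)

lemma e_mono: "j \<le> l \<Longrightarrow> l < n \<Longrightarrow> e l \<le> e j"
  using s by (auto simp: spectral_basis_def monotone_on_def)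

text \<open>Weyl's inequality by hand: some nonzero vector in the span of the top two eigenvectors is orthogonal to the
constant vector, and on that hyperplane \<open>M\<close> is at most its \<open>m = 1\<close> eigenvalue.\<close>
lemma second_eigenvalue_le: "e 1 \<le> s * mu n r 1 + N"
proof -
  have n01: "0 < n" "1 < n" using n_ge by auto
  define \<alpha> \<beta> where "\<alpha> = (if (\<Sum>a<n. u 0 a) = 0 \<and> (\<Sum>a<n. u 1 a) = 0 then 1 else \<Sum>a<n. u 1 a)"
    and "\<beta> = - (\<Sum>a<n. u 0 a)"
  define x where "x = (\<lambda>a. \<alpha> * u 0 a + \<beta> * u 1 a)"
  have x0: "inn n (mode (0, True)) x = 0"
    unfolding x_def inn_lin_right inn_const by (auto simp: \<alpha>_def \<beta>_def)
  have ux: "inn n (u l) x = (if l = 0 then \<alpha> else if l = 1 then \<beta> else 0)" if "l < n" for l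
    unfolding x_def inn_lin_right using orthonormal that n01 by simp
  have xx: "inn n x x = \<alpha>\<^sup>2 + \<beta>\<^sup>2"
    unfolding x_def inn_lin_right unfolding inn_lin_left using orthonormal n01 by (simp add: power2_eq_square)
  have pos: "0 < inn n x x" unfolding xx by (auto simp: \<alpha>_def \<beta>_def add_pos_nonneg add_nonneg_pos)
  have split: "{..<n} = {0, 1} \<union> {2..<n}" using n_ge by auto
  have "inn n x (mv n A x) = (\<Sum>l\<in>{0, 1}. e l * (inn n (u l) x)\<^sup>2) + (\<Sum>l=2..<n. e l * (inn n (u l) x)\<^sup>2)"
    unfolding spectral_basis_quadratic_form[OF s] split by (rule sum.union_disjoint) auto
  also have "(\<Sum>l=2..<n. e l * (inn n (u l) x)\<^sup>2) = 0" using ux by (intro sum.neutral) auto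
  also have "(\<Sum>l\<in>{0, 1}. e l * (inn n (u l) x)\<^sup>2) = e 0 * \<alpha>\<^sup>2 + e 1 * \<beta>\<^sup>2" using ux n01 by simp
  finally have Q: "inn n x (mv n A x) = e 0 * \<alpha>\<^sup>2 + e 1 * \<beta>\<^sup>2" by simp
  have "e 1 * inn n x x \<le> inn n x (mv n A x)"
    unfolding Q xx using e_mono[of 0 1] n01 by (simp add: distrib_left mult_right_mono)
  also have "\<dots> \<le> inn n x (mv n M x) + N * inn n x x"
    unfolding quadratic_form_A using quadratic_form_W[of x] by linarith
  also have "inn n x (mv n M x) \<le> (1 / n) * (\<Sum>t\<in>modes. s * mu n r 1 * (inn n (mode t) x * inn n (mode t) x))"
    unfolding quadratic_form_M
  proof (intro mult_left_mono sum_mono)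
    fix t assume t: "t \<in> modes"
    show "ev t * (inn n (mode t) x)\<^sup>2 \<le> s * mu n r 1 * (inn n (mode t) x * inn n (mode t) x)"
    proof (cases "fst t = 0")
      case True
      then have "t = (0, True) \<or> t = (0, False)" by (cases t) auto
      moreover have "inn n (mode (0, False)) x = 0" by (simp add: inn_def mode_def harmonic_def)
      ultimately have "inn n (mode t) x = 0" using x0 by auto
      then show ?thesis by simp
    next
      case False
      then have "ev t \<le> s * mu n r 1" using t s_pos mu_le_mu_1[of "fst t"] by (auto simp: ev_def modes_def)
      then show ?thesis by (simp add: mult_right_mono flip: power2_eq_square)
    qed
  qed simp
  also have "(1 / n) * (\<Sum>t\<in>modes. s * mu n r 1 * (inn n (mode t) x * inn n (mode t) x)) = s * mu n r 1 * inn n x x"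
    unfolding parseval[of x x] by (simp add: sum_distrib_left)
  finally have "e 1 * inn n x x \<le> (s * mu n r 1 + N) * inn n x x" by (simp add: distrib_right)
  then show ?thesis using pos by (simp only: mult_le_cancel_right_pos)
qed

text \<open>Dually, some nonzero combination of the constant vector and the two \<open>m = 1\<close> harmonics is orthogonal to the
top two eigenvectors.\<close>
lemma third_eigenvalue_ge: "s * mu n r 1 - N \<le> e 2"
proof -
  have n2: "2 < n" "0 < n" "1 < n" using n_ge by auto
  define t0 t1 t2 :: "nat \<times> bool" where "t0 = (0, True)" and "t1 = (1, True)" and "t2 = (1, False)"
  have T: "t0 \<in> modes" "t1 \<in> modes" "t2 \<in> modes" using n2 by (auto simp: t0_def t1_def t2_def modes_def)
  obtain \<alpha> \<beta> \<gamma> where nz: "\<alpha> \<noteq> 0 \<or> \<beta> \<noteq> 0 \<or> \<gamma> \<noteq> 0"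
    and 0: "inn n (u 0) (mode t0) * \<alpha> + inn n (u 0) (mode t1) * \<beta> + inn n (u 0) (mode t2) * \<gamma> = 0"
    and 1: "inn n (u 1) (mode t0) * \<alpha> + inn n (u 1) (mode t1) * \<beta> + inn n (u 1) (mode t2) * \<gamma> = 0"
    using nontrivial_kernel_2_3[of "inn n (u 0) (mode t0)" "inn n (u 0) (mode t1)" "inn n (u 0) (mode t2)"] by blast
  define x where "x = (\<lambda>a. 1 * (\<alpha> * mode t0 a + \<beta> * mode t1 a) + \<gamma> * mode t2 a)"
  have u0: "inn n (u 0) x = 0" "inn n (u 1) x = 0"
    unfolding x_def inn_lin_right using 0 1 by (simp_all add: algebra_simps)
  have sum_x: "(\<Sum>a<n. x a) = \<alpha> * n"
    unfolding x_def using sum_mode n2 by (simp add: sum.distrib sum_distrib_left[symmetric] t0_def t1_def t2_def)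
  have pos: "0 < inn n x x"
  proof (rule ccontr)
    assume "\<not> 0 < inn n x x"
    then have z: "x a = 0" if "a < n" for a using inn_self_pos[of a x] that by blast
    then have a0: "\<alpha> = 0" using sum_x n2 by simp
    obtain a where a: "a < n" "p a = 0" using p n2 unfolding bij_betw_def by (metis imageE lessThan_iff)
    obtain b where b: "b < n" "p b = 1" using p n2 unfolding bij_betw_def by (metis imageE lessThan_iff)
    have b0: "\<beta> = 0" using z[OF a(1)] a a0 by (simp add: x_def t0_def t1_def t2_def mode_def harmonic_def)
    have "0 < sin (2 * pi / n)" using n_ge by (intro sin_gt_zero) (auto simp: field_simps)
    then have "\<gamma> = 0" using z[OF b(1)] b a0 b0 by (simp add: x_def t0_def t1_def t2_def mode_def harmonic_def)
    then show False using nz a0 b0 by simp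
  qed
  have split: "{..<n} = {0, 1} \<union> {2..<n}" using n_ge by auto
  have "inn n x (mv n A x) = (\<Sum>l=2..<n. e l * (inn n (u l) x)\<^sup>2)"
    unfolding spectral_basis_quadratic_form[OF s] split using u0 by (subst sum.union_disjoint) auto
  also have "\<dots> \<le> (\<Sum>l=2..<n. e 2 * (inn n (u l) x)\<^sup>2)"
    using e_mono by (intro sum_mono mult_right_mono) auto
  also have "\<dots> = e 2 * inn n x x"
    unfolding spectral_basis_parseval[OF s] split using u0 by (subst sum.union_disjoint) (auto simp: sum_distrib_left)
  finally have up: "inn n x (mv n A x) \<le> e 2 * inn n x x" .
  have ev12: "ev t1 = s * mu n r 1" "ev t2 = s * mu n r 1" by (simp_all add: ev_def t1_def t2_def)
  have "inn n x (mv n M x) = inn n x (\<lambda>a. (s * mu n r 1) * x a + ((ev t0 - s * mu n r 1) * \<alpha>) * mode t0 a)"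
  proof (intro inn_cong refl)
    fix a assume a: "a < n"
    have "mv n M x a = \<alpha> * mv n M (mode t0) a + \<beta> * mv n M (mode t1) a + \<gamma> * mv n M (mode t2) a"
      unfolding x_def mv_lin by simp
    then show "mv n M x a = (s * mu n r 1) * x a + ((ev t0 - s * mu n r 1) * \<alpha>) * mode t0 a"
      using a T by (simp add: eigen ev12 x_def algebra_simps)
  qed
  also have "\<dots> = s * mu n r 1 * inn n x x + (ev t0 - s * mu n r 1) * \<alpha>\<^sup>2 * n"
  proof -
    have "inn n x (mode t0) = \<alpha> * n" using sum_x by (simp only: inn_commute[of n x] t0_def inn_const)
    then show ?thesis unfolding inn_lin_right by (simp add: power2_eq_square)
  qed
  also have "\<dots> \<ge> s * mu n r 1 * inn n x x"
  proof -
    have "s * mu n r 1 \<le> s * (2 * real r)" using s_pos mu_le by (intro mult_left_mono) auto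
    moreover have "0 \<le> q * n" using q_nonneg by simp
    ultimately have "0 \<le> ev t0 - s * mu n r 1" by (simp add: ev_def t0_def mu_0)
    then show ?thesis by simp
  qed
  finally have "s * mu n r 1 * inn n x x - N * inn n x x \<le> inn n x (mv n A x)"
    unfolding quadratic_form_A using quadratic_form_W[of x] by linarith
  with up have "(s * mu n r 1 - N) * inn n x x \<le> e 2 * inn n x x" by (simp add: left_diff_distrib)
  then show ?thesis using pos by (simp only: mult_le_cancel_right_pos)
qed

lemma eigenvalues_near:
  assumes "l \<in> {1, 2}" shows "\<bar>e l - s * mu n r 1\<bar> \<le> N"
  using assms second_eigenvalue_le third_eigenvalue_ge e_mono[of 1 2] n_ge by auto

lemma eigenpair_u: "l < n \<Longrightarrow> eigenpair (e l) (u l)"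
  unfolding eigenpair_def using spectral_basis_eigen[OF s] mv_A orthonormal[of l l]
  by (simp add: L2_set_def inn_def power2_eq_square)

end

definition coef :: "bool \<Rightarrow> (nat \<Rightarrow> real) \<Rightarrow> real" where
  "coef \<sigma> u = inn n (mode (1, \<sigma>)) u"

lemma mode_reflect: "mode (n - 1, True) a = mode (1, True) a" "mode (n - 1, False) a = - mode (1, False) a"
proof -
  have "2 * pi * real (n - 1) * real (p a) / n = 2 * pi * real (p a) - 2 * pi * real (p a) / n"
    using n_ge by (simp add: of_nat_diff field_simps)
  then show "mode (n - 1, True) a = mode (1, True) a" "mode (n - 1, False) a = - mode (1, False) a"
    by (simp_all add: mode_def harmonic_def cos_diff sin_diff cos_integer_2pi sin_integer_2pi)
qed

lemma coef_reflect: "inn n (mode (n - 1, True)) u = coef True u" "inn n (mode (n - 1, False)) u = - coef False u"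
  unfolding coef_def inn_def mode_reflect by (simp_all add: sum_negf)

lemma sum_low: "(\<Sum>t\<in>low. g t) = g (1, True) + g (1, False) + g (n - 1, True) + g (n - 1, False)"
  using n_ge unfolding low_def by (subst sum_modes) (auto simp: add.assoc)

lemma ev_low: "t \<in> low \<Longrightarrow> ev t = s * mu n r 1"
  using mu_reflect[of 1 n r] n_ge by (auto simp: low_def ev_def)

text \<open>The part of \<open>M u\<close> in the \<open>m = 1\<close> plane.\<close>
definition main :: "(nat \<Rightarrow> real) \<Rightarrow> nat \<Rightarrow> real" where
  "main u a = 2 * s * mu n r 1 / n * (coef True u * mode (1, True) a + coef False u * mode (1, False) a)"

lemma main_eq: "main u a = (1 / n) * (\<Sum>t\<in>low. ev t * inn n (mode t) u * mode t a)"
proof -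
  have "(\<Sum>t\<in>low. ev t * inn n (mode t) u * mode t a) = (\<Sum>t\<in>low. s * mu n r 1 * inn n (mode t) u * mode t a)"
    by (intro sum.cong refl) (simp add: ev_low)
  also have "\<dots> = 2 * s * mu n r 1 * (coef True u * mode (1, True) a + coef False u * mode (1, False) a)"
    unfolding sum_low coef_reflect mode_reflect by (simp add: coef_def algebra_simps)
  finally show ?thesis by (simp add: main_def)
qed

lemma abs_mode_le_1: "\<bar>mode t a\<bar> \<le> 1" by (simp add: mode_def abs_harmonic_le_1)

lemma nrm_mode_le: "nrm n (mode t) \<le> sqrt n"
proof -
  have "nrm n (mode t) \<le> nrm n (\<lambda>_. 1)" using abs_mode_le_1 by (intro nrm_mono) simp
  then show ?thesis by (simp add: L2_set_constant)
qed

lemma abs_inn_mode_le: "nrm n u = 1 \<Longrightarrow> \<bar>inn n (mode t) u\<bar> \<le> sqrt n"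
  using inn_le[of n "mode t" u] nrm_mode_le[of t] by simp

lemma mu_1_bounds: "real r \<le> mu n r 1" "mu n r 1 \<le> 2 * real r"
  using mu_1_deficit_bounds(1) mu_le[of n r 1] real_r by auto

text \<open>The two noise terms of row \<open>a\<close>. The bias \<open>M u - main u\<close> is at most \<open>4 N rho / sqrt n\<close>. The noise \<open>W u\<close>
at \<open>a\<close> is \<open>O(L)\<close> because the coefficients of \<open>M u\<close> along all harmonics sum to \<open>O(s r sqrt n)\<close>, which
cancels the factor \<open>1 / l\<close> of the Neumann series. The term in \<open>u a\<close> is absorbed into the left-hand side
because \<open>N / l\<close> is small.\<close>
lemma entry_approx:
  assumes l: "\<bar>l - s * mu n r 1\<bar> \<le> N" and u: "eigenpair l u" and a: "a < n" and L: "0 \<le> L"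
    and walks: "\<And>t j. t \<in> modes \<Longrightarrow> j < n \<Longrightarrow> \<bar>walk n W a j (mode t)\<bar> \<le> L * nrm n ((mv n (minor a W) ^^ j) (mode t))"
  shows "\<bar>l * u a - main u a\<bar> \<le> 56 * L + 44 * (N * rho / sqrt n)"
proof -
  have n0: "0 < real n" "0 < sqrt n" using real_r by auto
  have u1: "nrm n u = 1" and eq: "\<And>b. b < n \<Longrightarrow> l * u b = mv n M u b + mv n W u b"
    using u by (auto simp: eigenpair_def)
  have lr: "s * real r \<le> l" "0 < l" using l_ge[OF l] by auto
  have sr: "0 < s * real r" using s_pos real_r by simp
  have Nrho: "N * rho \<le> s * real r"
    using mult_right_mono[OF N_le, of rho] rho_ge G_rho by (simp add: mult.assoc)
  have N256: "N * 256 \<le> N * rho" using rho_ge N_nonneg by (intro mult_left_mono) auto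
  have N2l: "2 * N \<le> l" using N256 Nrho lr N_nonneg by linarith
  define x y where "x = mv n W u a" and "y = mv n M u a"
  \<comment> \<open>\<open>y\<close> is close to \<open>main u a\<close>, and \<open>x\<close> is bounded in terms of itself and \<open>y\<close>.\<close>
  define E where "E = N * rho / sqrt n"
  have E0: "0 \<le> E" using N_nonneg rho_ge n0 by (simp add: E_def)
  have bias: "\<bar>y - main u a\<bar> \<le> 4 * E"
    using row_bias_le[OF u low_subset sep'[OF l] a weighted_ratio_norm[OF l]]
    unfolding main_eq y_def E_def by (simp add: mult_ac)
  define c where "c t = (1 / n) * (ev t * inn n (mode t) u)" for t
  have sumc: "(\<Sum>t\<in>modes. \<bar>c t\<bar>) \<le> (1 / n) * (sqrt n * (14 * (s * real r)))"
  proof -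
    have "(\<Sum>t\<in>low. \<bar>ev t * inn n (mode t) u\<bar>) \<le> (\<Sum>t\<in>low. 2 * (s * real r) * sqrt n)"
    proof (rule sum_mono)
      fix t assume t: "t \<in> low"
      have "\<bar>ev t\<bar> \<le> 2 * (s * real r)"
        using mu_1_bounds s_pos real_r unfolding ev_low[OF t] by (simp add: abs_mult)
      then show "\<bar>ev t * inn n (mode t) u\<bar> \<le> 2 * (s * real r) * sqrt n"
        unfolding abs_mult using sr by (intro mult_mono abs_inn_mode_le[OF u1]) auto
    qed
    also have "\<dots> = 8 * (s * real r) * sqrt n" unfolding sum_low by simp
    finally have "(\<Sum>t\<in>low. \<bar>ev t * inn n (mode t) u\<bar>) \<le> 8 * (s * real r) * sqrt n" .
    moreover have "(\<Sum>t\<in>modes - low. \<bar>ev t * inn n (mode t) u\<bar>) \<le> sqrt n * N * (6 * rho)"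
      by (rule coeff_weight_le[OF u low_subset sep'[OF l] ratio_norm[OF l]])
    moreover have "sqrt n * N * (6 * rho) \<le> sqrt n * (6 * (s * real r))"
      using mult_left_mono[OF Nrho, of "6 * sqrt n"] n0 by (simp add: mult_ac)
    ultimately have "(\<Sum>t\<in>modes. \<bar>ev t * inn n (mode t) u\<bar>) \<le> sqrt n * (14 * (s * real r))"
      unfolding sum.subset_diff[OF low_subset finite_I] by (simp add: algebra_simps)
    then have "(1 / n) * (\<Sum>t\<in>modes. \<bar>ev t * inn n (mode t) u\<bar>) \<le> (1 / n) * (sqrt n * (14 * (s * real r)))"
      by (rule mult_left_mono) simp
    then show ?thesis by (simp add: c_def abs_mult sum_distrib_left)
  qed
  have "\<bar>x\<bar> \<le> 2 * L * sqrt n / l * (\<Sum>t\<in>modes. \<bar>c t\<bar>) + 2 * N\<^sup>2 / l * \<bar>u a\<bar> + N / 2 ^ n"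
    unfolding x_def
  proof (rule row_noise_le[OF op_W diag_W[OF a] _ a lr(2) N2l eq u1])
    show "W b a = W a b" if "b < n" for b using sym_W a that by simp
    show "mv n M u b = (\<Sum>t\<in>modes. c t * mode t b)" if "b < n" for b
      unfolding mv_M_expansion[OF that] by (simp add: c_def sum_distrib_left mult.assoc)
  qed (use walks L nrm_mode_le in auto)
  moreover have "2 * L * sqrt n / l * (\<Sum>t\<in>modes. \<bar>c t\<bar>) \<le> 28 * L"
  proof -
    have "2 * L * sqrt n / l * (\<Sum>t\<in>modes. \<bar>c t\<bar>) \<le> 2 * L * sqrt n / l * ((1 / n) * (sqrt n * (14 * (s * real r))))"
      using sumc L lr by (intro mult_left_mono) auto
    also have "\<dots> = 28 * L * (s * real r / l) * (sqrt n * sqrt n / n)"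
    proof -
      have "2 * L * S / l * ((1 / m) * (S * (14 * X))) = 28 * L * (X / l) * (S * S / m)" for S X m :: real by simp
      then show ?thesis .
    qed
    also have "sqrt n * sqrt n / n = 1" using n0 by simp
    also have "28 * L * (s * real r / l) * 1 = 28 * L * (s * real r / l)" by simp
    also have "\<dots> \<le> 28 * L * 1" using lr L by (intro mult_left_mono) auto
    finally show ?thesis by simp
  qed
  moreover have "N / 2 ^ n \<le> E"
  proof -
    have "sqrt n \<le> n" using n_ge real_sqrt_le_iff[of "real n" "(real n)\<^sup>2"] by (simp add: power2_eq_square)
    also have "\<dots> \<le> 2 ^ n" by (metis less_imp_le of_nat_less_two_power)
    finally have "N * sqrt n \<le> N * rho * 2 ^ n"
      using N256 N_nonneg by (intro mult_mono) auto
    then show ?thesis using n0 by (simp add: E_def field_simps)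
  qed
  moreover have "2 * N\<^sup>2 / l * \<bar>u a\<bar> = 2 * (N / l)\<^sup>2 * \<bar>y + x\<bar>"
  proof -
    have "y + x = l * u a" using eq[OF a] by (simp add: x_def y_def)
    then have "l * \<bar>u a\<bar> = \<bar>y + x\<bar>" using lr by (simp add: abs_mult)
    then have "\<bar>u a\<bar> = \<bar>y + x\<bar> / l" using lr by (simp add: field_simps)
    then show ?thesis by (simp add: power2_eq_square)
  qed
  ultimately have x1: "\<bar>x\<bar> \<le> 28 * L + 2 * (N / l)\<^sup>2 * \<bar>y + x\<bar> + E" by linarith
  have Nl: "0 \<le> N / l" "N / l * rho \<le> 1" 
    using N_nonneg lr Nrho by (auto simp: field_simps)
  have Nl': "N / l \<le> 1 / 256"
    using mult_left_mono[OF rho_ge Nl(1)] Nl(2) by simp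
  have sq: "2 * (N / l)\<^sup>2 \<le> 2 / 256 * (N / l)" 
    using mult_right_mono[OF Nl' Nl(1)] by (simp add: power2_eq_square)
  then have sq': "2 * (N / l)\<^sup>2 \<le> 1 / 2" using Nl' by linarith
  have "2 * (N / l)\<^sup>2 * \<bar>y + x\<bar> \<le> 2 * (N / l)\<^sup>2 * \<bar>y\<bar> + 1 / 2 * \<bar>x\<bar>"
  proof -
    have "2 * (N / l)\<^sup>2 * \<bar>y + x\<bar> \<le> 2 * (N / l)\<^sup>2 * (\<bar>y\<bar> + \<bar>x\<bar>)" by (intro mult_left_mono) auto
    also have "\<dots> \<le> 2 * (N / l)\<^sup>2 * \<bar>y\<bar> + 1 / 2 * \<bar>x\<bar>"
      unfolding distrib_left using sq' by (intro add_left_mono mult_right_mono) auto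
    finally show ?thesis .
  qed
  with x1 have x2: "\<bar>x\<bar> \<le> 56 * L + 4 * (N / l)\<^sup>2 * \<bar>y\<bar> + 2 * E" by linarith
  have mainb: "\<bar>main u a\<bar> \<le> 8 * (s * real r) / sqrt n"
  proof -
    have t: "\<bar>coef \<sigma> u * mode (1, \<sigma>) a\<bar> \<le> sqrt n * 1" for \<sigma>
      unfolding abs_mult coef_def by (intro mult_mono abs_inn_mode_le[OF u1] abs_mode_le_1) auto
    have "\<bar>main u a\<bar> \<le> (2 * s * mu n r 1 / n) * (2 * sqrt n)"
      unfolding main_def abs_mult using t[of True] t[of False] mu_1_bounds s_pos real_r
      by (intro mult_mono) (auto simp: abs_mult intro: order_trans[OF abs_triangle_ineq])
    also have "\<dots> \<le> (2 * s * (2 * real r) / n) * (2 * sqrt n)"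
      using mu_1_bounds s_pos n0 by (intro mult_right_mono divide_right_mono mult_left_mono) auto
    also have "\<dots> = 8 * (s * real r) / sqrt n"
      using n0 real_sqrt_mult_self[of "real n"] by (simp add: field_simps)
    finally show ?thesis .
  qed
  have "4 * (N / l)\<^sup>2 * \<bar>y\<bar> \<le> 2 * E"
  proof -
    have "4 * (N / l)\<^sup>2 * \<bar>y\<bar> \<le> 4 * (N / l)\<^sup>2 * (8 * (s * real r) / sqrt n + 4 * E)"
      using bias mainb by (intro mult_left_mono) auto
    also have "\<dots> \<le> (4 / 256 * (N / l)) * (8 * (s * real r) / sqrt n) + 1 * E"
    proof -
      have "4 * (N / l)\<^sup>2 * (8 * (s * real r) / sqrt n) \<le> (4 / 256 * (N / l)) * (8 * (s * real r) / sqrt n)"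
        using sq sr n0 by (intro mult_right_mono) auto
      moreover have "4 * (N / l)\<^sup>2 * (4 * E) \<le> 1 * E"
      proof -
        have "16 * (N / l)\<^sup>2 \<le> 1" using sq Nl' by linarith
        then have "16 * (N / l)\<^sup>2 * E \<le> 1 * E" using E0 by (rule mult_right_mono)
        then show ?thesis by simp
      qed
      ultimately show ?thesis by (simp add: distrib_left)
    qed
    also have "(4 / 256 * (N / l)) * (8 * (s * real r) / sqrt n) \<le> N / sqrt n"
    proof -
      have "N * (s * real r) \<le> N * l" using lr N_nonneg by (intro mult_left_mono) auto
      then have "N / l * (s * real r) \<le> N" using lr by (simp add: field_simps)
      define Q where "Q = N / l * (s * real r) / sqrt n"
      have "Q \<le> N / sqrt n"
        unfolding Q_def using \<open>N / l * (s * real r) \<le> N\<close> n0 by (intro divide_right_mono) auto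
      moreover have "0 \<le> Q" using N_nonneg lr sr n0 by (simp add: Q_def)
      ultimately have "Q / 8 \<le> N / sqrt n" by linarith
      moreover have "(4 / 256 * (N / l)) * (8 * (s * real r) / sqrt n) = Q / 8" by (simp add: Q_def)
      ultimately show ?thesis by (simp only:)
    qed
    also have "N / sqrt n \<le> E" using N256 N_nonneg n0 unfolding E_def by (intro divide_right_mono) auto
    finally show ?thesis by simp
  qed
  then have "\<bar>x\<bar> \<le> 56 * L + 4 * E" using x2 by linarith
  then have "\<bar>x + (y - main u a)\<bar> \<le> 56 * L + 8 * E" using bias by linarith
  moreover have "l * u a - main u a = x + (y - main u a)" using eq[OF a] by (simp add: x_def y_def)
  ultimately show ?thesis using E0 by (simp add: E_def)
qed

lemma coef_gram:
  assumes lu: "\<bar>l - s * mu n r 1\<bar> \<le> N" and u: "eigenpair l u" and lv: "\<bar>l' - s * mu n r 1\<bar> \<le> N" and v: "eigenpair l' v"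
  shows "\<bar>inn n u v - 2 / n * (coef True u * coef True v + coef False u * coef False v)\<bar> \<le> (N / (4 * s * G))\<^sup>2"
proof -
  have E: "(1 / n) * (\<Sum>t\<in>low. inn n (mode t) u * inn n (mode t) v) = 2 / n * (coef True u * coef True v + coef False u * coef False v)"
    unfolding sum_low coef_reflect coef_def[symmetric] by (simp add: distrib_left)
  have "0 < 4 * s * G" using s_pos G_pos by simp
  then show ?thesis unfolding E[symmetric] by (rule leak_le[OF u v low_subset _ sep[OF lu] sep[OF lv]])
qed

end

section \<open>Angles on the circle and nearest nodes\<close>

text \<open>The distance of an angle from \<open>0\<close> modulo \<open>2 \<pi>\<close>. Both the distance of spectral angles and, after scaling, the
ring distance are values of it, so that they can be compared through its triangle inequality.\<close>
definition circ_dist :: "real \<Rightarrow> real" where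
  "circ_dist x = arccos (cos x)"

lemma circ_dist_bounds: "0 \<le> circ_dist x" "circ_dist x \<le> pi"
  by (auto simp: circ_dist_def arccos_lbound arccos_ubound)

lemma cos_circ_dist: "cos (circ_dist x) = cos x"
  by (simp add: circ_dist_def)

lemma circ_dist_minus: "circ_dist (- x) = circ_dist x"
  by (simp add: circ_dist_def)

lemma circ_dist_eqI: "cos x = cos y \<Longrightarrow> 0 \<le> y \<Longrightarrow> y \<le> pi \<Longrightarrow> circ_dist x = y"
  by (simp add: circ_dist_def arccos_cos)

lemma circ_dist_triangle: "circ_dist (x + y) \<le> circ_dist x + circ_dist y"
proof (cases "circ_dist x + circ_dist y \<le> pi")
  case True
  define a b where "a = circ_dist x" and "b = circ_dist y"
  have ab: "0 \<le> a" "a \<le> pi" "0 \<le> b" "b \<le> pi" "cos a = cos x" "cos b = cos y"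
    by (simp_all add: a_def b_def circ_dist_bounds cos_circ_dist)
  have "(sin a)\<^sup>2 = (sin x)\<^sup>2" "(sin b)\<^sup>2 = (sin y)\<^sup>2" using ab by (simp_all add: sin_squared_eq)
  then have "\<bar>sin a\<bar> = \<bar>sin x\<bar>" "\<bar>sin b\<bar> = \<bar>sin y\<bar>" by (simp_all add: power2_eq_iff abs_eq_iff)
  moreover have "0 \<le> sin a" "0 \<le> sin b" using ab by (auto intro: sin_ge_zero)
  ultimately have "sin x * sin y \<le> sin a * sin b"
    by (metis abs_ge_self abs_mult abs_of_nonneg)
  then have "cos (a + b) \<le> cos (x + y)" using ab by (simp add: cos_add)
  then have "arccos (cos (x + y)) \<le> arccos (cos (a + b))" by (intro arccos_le_arccos) auto
  also have "\<dots> = a + b" using True ab by (intro arccos_cos) (auto simp: a_def b_def)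
  finally show ?thesis by (simp add: circ_dist_def a_def b_def)
next
  case False
  then show ?thesis using circ_dist_bounds(2)[of "x + y"] by linarith
qed

lemma angle_dist_circ_dist:
  assumes "- pi < a" "a \<le> pi" "- pi < b" "b \<le> pi"
  shows "angle_dist a b = circ_dist (a - b)"
proof (cases "\<bar>a - b\<bar> \<le> pi")
  case True
  then show ?thesis by (subst circ_dist_eqI[of _ "\<bar>a - b\<bar>"]) (auto simp: angle_dist_def)
next
  case False
  have "cos (a - b) = cos (2 * pi - \<bar>a - b\<bar>)" by (simp add: cos_diff)
  then have "circ_dist (a - b) = 2 * pi - \<bar>a - b\<bar>" using False assms by (intro circ_dist_eqI) auto
  then show ?thesis using False by (simp add: angle_dist_def)
qed

lemma ring_dist_circ_dist:
  assumes "x < n" "y < n"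
  shows "circ_dist (2 * pi * real x / n - 2 * pi * real y / n) = 2 * pi / n * ring_dist n x y"
proof -
  define z where "z = \<bar>real x - real y\<bar>"
  have n: "0 < real n" using assms by simp
  have z: "0 \<le> z" "z < real n" using assms by (auto simp: z_def)
  have c: "cos (2 * pi * real x / n - 2 * pi * real y / n) = cos (2 * pi * z / n)"
  proof -
    have "\<bar>2 * pi * real x / n - 2 * pi * real y / n\<bar> = 2 * pi * z / n"
      by (simp add: z_def diff_divide_distrib[symmetric] right_diff_distrib[symmetric] abs_mult)
    then show ?thesis by (metis cos_abs_real)
  qed
  have rd: "real_of_int (ring_dist n x y) = min z (real n - z)"
    by (simp add: ring_dist_def z_def of_int_min)
  show ?thesis
  proof (cases "2 * z \<le> n")
    case True
    then have "circ_dist (2 * pi * real x / n - 2 * pi * real y / n) = 2 * pi * z / n"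
      using n z c by (intro circ_dist_eqI) (auto simp: field_simps)
    then show ?thesis using True by (simp add: rd)
  next
    case False
    have "cos (2 * pi * z / n) = cos (2 * pi * (real n - z) / n)"
      using n by (simp add: right_diff_distrib diff_divide_distrib cos_diff)
    then have "circ_dist (2 * pi * real x / n - 2 * pi * real y / n) = 2 * pi * (real n - z) / n"
      using n z c False by (intro circ_dist_eqI) (auto simp: field_simps)
    then show ?thesis using False by (simp add: rd)
  qed
qed

lemma Arg_near:
  assumes R: "0 < R" and X: "\<bar>x / R - cos t\<bar> \<le> e" and Y: "\<bar>y / R - sin t\<bar> \<le> e" and e: "e \<le> 1 / 4"
  shows "circ_dist (Arg (Complex x y) - t) \<le> 8 * e"
proof -
  define z where "z = Complex (x / R) (y / R)"
  define w where "w = z * cis (- t)"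
  define th where "th = Arg z"
  have "Complex x y = of_real R * z" using R by (simp add: z_def complex_eq_iff)
  then have Arg: "Arg (Complex x y) = th" using R by (simp add: th_def Arg_times_of_real)
  have e0: "0 \<le> e" using X by linarith
  have "cmod (z - cis t) \<le> \<bar>Re (z - cis t)\<bar> + \<bar>Im (z - cis t)\<bar>" by (rule cmod_le)
  also have "\<dots> \<le> 2 * e" using X Y by (simp add: z_def)
  finally have "cmod (z - cis t) \<le> 2 * e" .
  moreover have "w - 1 = (z - cis t) * cis (- t)" by (simp add: w_def algebra_simps cis_mult)
  ultimately have w: "cmod (w - 1) \<le> 2 * e" by (simp add: norm_mult)
  have re: "1 - 2 * e \<le> Re w" using abs_Re_le_cmod[of "w - 1"] w by simp
  have im: "\<bar>Im w\<bar> \<le> 2 * e" using abs_Im_le_cmod[of "w - 1"] w by simp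
  have mod: "1 / 2 \<le> cmod w" using re e complex_Re_le_cmod[of w] by linarith
  have zw: "cmod z = cmod w" by (simp add: w_def norm_mult)
  have "w = rcis (cmod z) th * rcis 1 (- t)" by (simp add: w_def th_def rcis_cmod_Arg cis_rcis_eq[symmetric])
  also have "\<dots> = rcis (cmod w) (th - t)" by (simp only: rcis_mult zw) simp
  finally have "w = rcis (cmod w) (th - t)" .
  then have rw: "Re w = cmod w * cos (th - t)" "Im w = cmod w * sin (th - t)" by (metis Re_rcis, metis Im_rcis)
  define D where "D = circ_dist (th - t)"
  have D: "0 \<le> D" "D \<le> pi" "cos D = cos (th - t)" by (simp_all add: D_def circ_dist_bounds cos_circ_dist)
  have "0 < Re w" using re e by linarith
  then have "0 < cmod w * cos D" unfolding rw(1) D(3) .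
  then have "0 < cos D" using mod by (simp add: zero_less_mult_iff)
  then have D2: "D \<le> pi / 2" using D cos_monotone_0_pi_le[of "pi / 2" D] by (cases "D \<le> pi / 2") auto
  have "(sin D)\<^sup>2 = (sin (th - t))\<^sup>2" using D by (simp add: sin_squared_eq)
  then have "\<bar>sin D\<bar> = \<bar>sin (th - t)\<bar>" by (simp add: power2_eq_iff abs_eq_iff)
  then have sD: "sin D = \<bar>sin (th - t)\<bar>" using sin_ge_zero D by (metis abs_of_nonneg)
  have "1 / 2 * \<bar>sin (th - t)\<bar> \<le> cmod w * \<bar>sin (th - t)\<bar>" using mod by (intro mult_right_mono) auto
  also have "\<dots> \<le> 2 * e" using im rw(2) by (simp add: abs_mult)
  finally have "sin D \<le> 4 * e" using sD by simp
  moreover have "2 / pi * D \<le> sin D" by (rule sin_ge_chord[OF D(1) D2])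
  ultimately have "2 / pi * D \<le> 4 * e" by linarith
  then have "D \<le> pi / 2 * (4 * e)" by (simp add: field_simps)
  also have "\<dots> \<le> 2 * (4 * e)" using e0 pi_less_4 by (intro mult_right_mono) auto
  finally show ?thesis unfolding Arg D_def by simp
qed

text \<open>Two nearly orthonormal coordinate vectors in the plane are close to a rotated orthonormal frame, which may
be reflected: \<open>\<sigma>\<close> is the orientation.\<close>
lemma nearly_orthonormal_pair:
  fixes a b c d \<delta> :: real
  assumes 1: "\<bar>a\<^sup>2 + b\<^sup>2 - 1\<bar> \<le> \<delta>" and 2: "\<bar>c\<^sup>2 + d\<^sup>2 - 1\<bar> \<le> \<delta>" and 3: "\<bar>a * c + b * d\<bar> \<le> \<delta>" and \<delta>: "\<delta> \<le> 1 / 4"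
  shows "\<exists>\<psi> \<sigma>. \<bar>\<sigma>\<bar> = 1 \<and> (\<forall>\<phi>. \<bar>a * cos \<phi> + b * sin \<phi> - cos (\<sigma> * (\<phi> - \<psi>))\<bar> \<le> 4 * \<delta>
     \<and> \<bar>c * cos \<phi> + d * sin \<phi> - sin (\<sigma> * (\<phi> - \<psi>))\<bar> \<le> 4 * \<delta>)"
proof -
  have d0: "0 \<le> \<delta>" by (rule order_trans[OF abs_ge_zero 1])
  define R where "R = sqrt (a\<^sup>2 + b\<^sup>2)"
  have close: "\<bar>x - 1\<bar> \<le> \<bar>x\<^sup>2 - 1\<bar>" if "0 \<le> x" for x :: real
  proof -
    have "\<bar>x - 1\<bar> * 1 \<le> \<bar>x - 1\<bar> * \<bar>x + 1\<bar>" using that by (intro mult_left_mono) auto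
    also have "\<dots> = \<bar>x\<^sup>2 - 1\<bar>" by (simp add: abs_mult[symmetric] power2_eq_square algebra_simps)
    finally show ?thesis by simp
  qed
  have R2: "R\<^sup>2 = a\<^sup>2 + b\<^sup>2" "0 \<le> R" by (simp_all add: R_def)
  then have R1: "\<bar>R - 1\<bar> \<le> \<delta>" using close[of R] 1 by simp
  then have Rpos: "3 / 4 \<le> R" "0 < R" using \<delta> by linarith+
  have "(a / R)\<^sup>2 + (b / R)\<^sup>2 = 1"
    using Rpos by (simp add: power_divide add_divide_distrib[symmetric] R2(1)[symmetric])
  then obtain \<psi> where "a / R = cos \<psi>" "b / R = sin \<psi>" using sincos_total_2pi by metis
  then have ab: "a = R * cos \<psi>" "b = R * sin \<psi>" using Rpos by (auto simp: field_simps)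
  \<comment> \<open>The coordinates of \<open>(c, d)\<close> in the frame given by the direction \<open>\<psi>\<close> of \<open>(a, b)\<close>.\<close>
  define x y where "x = c * cos \<psi> + d * sin \<psi>" and "y = d * cos \<psi> - c * sin \<psi>"
  have cd: "c = x * cos \<psi> - y * sin \<psi>" "d = x * sin \<psi> + y * cos \<psi>"
  proof -
    have "x * cos \<psi> - y * sin \<psi> = c * ((cos \<psi>)\<^sup>2 + (sin \<psi>)\<^sup>2)" "x * sin \<psi> + y * cos \<psi> = d * ((cos \<psi>)\<^sup>2 + (sin \<psi>)\<^sup>2)"
    proof -
      have "(c * C + d * S) * C - (d * C - c * S) * S = c * (C\<^sup>2 + S\<^sup>2)"
        "(c * C + d * S) * S + (d * C - c * S) * C = d * (C\<^sup>2 + S\<^sup>2)" for C S :: real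
        by (simp_all add: algebra_simps power2_eq_square)
      then show "x * cos \<psi> - y * sin \<psi> = c * ((cos \<psi>)\<^sup>2 + (sin \<psi>)\<^sup>2)" "x * sin \<psi> + y * cos \<psi> = d * ((cos \<psi>)\<^sup>2 + (sin \<psi>)\<^sup>2)"
        unfolding x_def y_def by blast+
    qed
    then show "c = x * cos \<psi> - y * sin \<psi>" "d = x * sin \<psi> + y * cos \<psi>"
      by (simp_all only: sin_cos_squared_add2 mult_1_right)
  qed
  have xy: "c\<^sup>2 + d\<^sup>2 = x\<^sup>2 + y\<^sup>2"
  proof -
    have "(x * C - y * S)\<^sup>2 + (x * S + y * C)\<^sup>2 = (x\<^sup>2 + y\<^sup>2) * (C\<^sup>2 + S\<^sup>2)" for C S :: real
      by (simp add: algebra_simps power2_eq_square)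
    then have "c\<^sup>2 + d\<^sup>2 = (x\<^sup>2 + y\<^sup>2) * ((cos \<psi>)\<^sup>2 + (sin \<psi>)\<^sup>2)" unfolding cd by blast
    then show ?thesis by simp
  qed
  have "R * x = a * c + b * d" by (simp add: ab x_def algebra_simps)
  then have "R * \<bar>x\<bar> \<le> \<delta>" using 3 Rpos by (metis abs_mult abs_of_pos)
  moreover have "3 / 4 * \<bar>x\<bar> \<le> R * \<bar>x\<bar>" using Rpos by (intro mult_right_mono) auto
  ultimately have x: "\<bar>x\<bar> \<le> 4 / 3 * \<delta>" by simp
  have "x\<^sup>2 \<le> (4 / 3 * \<delta>)\<^sup>2" using x by (metis abs_ge_zero power2_abs power_mono)
  also have "\<dots> \<le> 16 / 9 * (1 / 4 * \<delta>)"
    using mult_right_mono[OF \<delta>, of \<delta>] order_trans[OF abs_ge_zero R1] unfolding power2_eq_square by simp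
  finally have "x\<^sup>2 \<le> 16 / 9 * (1 / 4 * \<delta>)" .
  then have "\<bar>y\<^sup>2 - 1\<bar> \<le> 2 * \<delta>"
    using 2[unfolded xy] zero_le_power2[of x] order_trans[OF abs_ge_zero R1] by linarith
  then have y: "\<bar>\<bar>y\<bar> - 1\<bar> \<le> 2 * \<delta>" using close[of "\<bar>y\<bar>"] by simp
  define \<sigma> :: real where "\<sigma> = (if 0 \<le> y then 1 else - 1)"
  have main: "\<bar>a * cos \<phi> + b * sin \<phi> - cos (\<sigma> * (\<phi> - \<psi>))\<bar> \<le> 4 * \<delta> \<and> \<bar>c * cos \<phi> + d * sin \<phi> - sin (\<sigma> * (\<phi> - \<psi>))\<bar> \<le> 4 * \<delta>" for \<phi>
  proof
    have "a * cos \<phi> + b * sin \<phi> - cos (\<sigma> * (\<phi> - \<psi>)) = (R - 1) * cos (\<phi> - \<psi>)"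
      by (auto simp: ab cos_diff \<sigma>_def algebra_simps)
    also have "\<bar>\<dots>\<bar> \<le> \<bar>R - 1\<bar> * 1" unfolding abs_mult by (intro mult_left_mono) auto
    also have "\<dots> \<le> 4 * \<delta>" using order_trans[OF R1, of "4 * \<delta>"] d0 by simp
    finally show "\<bar>a * cos \<phi> + b * sin \<phi> - cos (\<sigma> * (\<phi> - \<psi>))\<bar> \<le> 4 * \<delta>" .
    have "c * cos \<phi> + d * sin \<phi> - sin (\<sigma> * (\<phi> - \<psi>)) = x * cos (\<phi> - \<psi>) + (\<sigma> * (\<bar>y\<bar> - 1)) * sin (\<phi> - \<psi>)"
      by (auto simp: cd cos_diff sin_diff \<sigma>_def algebra_simps)
    also have "\<bar>\<dots>\<bar> \<le> \<bar>x\<bar> * 1 + \<bar>\<bar>y\<bar> - 1\<bar> * 1"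
      by (intro order_trans[OF abs_triangle_ineq] add_mono) (auto simp: abs_mult \<sigma>_def intro!: mult_left_le)
    also have "\<dots> \<le> 4 / 3 * \<delta> + 2 * \<delta>" unfolding mult_1_right by (rule add_mono[OF x y])
    also have "\<dots> \<le> 4 * \<delta>" using d0 by simp
    finally show "\<bar>c * cos \<phi> + d * sin \<phi> - sin (\<sigma> * (\<phi> - \<psi>))\<bar> \<le> 4 * \<delta>" .
  qed
  show ?thesis by (rule exI[of _ \<psi>], rule exI[of _ \<sigma>]) (use main in \<open>auto simp: \<sigma>_def\<close>)
qed

text \<open>If a node more than \<open>r + T\<close> steps away were selected, every true neighbor would have a strictly smaller estimated
distance and would be selected too; these are already \<open>2 r\<close> nodes. So all wrongly selected nodes lie in
the two strips of width \<open>T\<close> at the ends of the arc, and as many true neighbors are missed.\<close>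
lemma nearest_nodes_error:
  assumes p: "bij_betw p {..<n} {..<n}" and i: "i < n"
    and S: "nearest_nodes n (2 * r) \<theta> i S"
    and ad: "\<And>j. j < n \<Longrightarrow> \<bar>angle_dist (\<theta> i) (\<theta> j) - 2 * pi / n * ring_dist n (p i) (p j)\<bar> \<le> \<eta>"
    and T: "n * \<eta> / pi < real T + 1" "2 * (r + T) < n"
  defines "Nb \<equiv> {j. j < n \<and> ring_adj n r (p i) (p j)}"
  shows "card (sym_diff S Nb) \<le> 4 * T"
proof -
  have n: "0 < real n" using i by simp
  have cardN: "card {j. j < n \<and> ring_adj n r' (p i) (p j)} = 2 * r'" if "2 * r' < n" for r'
  proof -
    have "card {j. j < n \<and> ring_adj n r' (p i) (p j)} = card (p ` {j. j < n \<and> ring_adj n r' (p i) (p j)})"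
      by (rule card_image[symmetric], rule inj_on_subset[OF bij_betw_imp_inj_on[OF p]]) auto
    also have "\<dots> = card {y. y < n \<and> ring_adj n r' (p i) y}"
      using p unfolding bij_betw_def by (intro arg_cong[where f = card]) auto
    also have "\<dots> = 2 * r'" using p i that by (intro card_ring_adj) (auto simp: bij_betw_def)
    finally show ?thesis .
  qed
  define Nb' where "Nb' = {j. j < n \<and> ring_adj n (r + T) (p i) (p j)}"
  have fin: "finite Nb" "finite Nb'" "finite S"
    using S by (auto simp: Nb_def Nb'_def nearest_nodes_def intro: finite_subset[of _ "{..<n}"])
  have c: "card Nb = 2 * r" "card Nb' = 2 * (r + T)" using cardN T by (simp_all add: Nb_def Nb'_def)
  have cS: "card S = 2 * r" using S by (simp add: nearest_nodes_def)
  have sub: "Nb \<subseteq> Nb'" by (auto simp: Nb_def Nb'_def ring_adj_def)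
  have pij: "p i \<noteq> p j" if "j < n" "j \<noteq> i" for j
    using bij_betw_imp_inj_on[OF p] i that by (auto simp: inj_on_def)
  have "S \<subseteq> Nb'"
  proof
    fix j assume j: "j \<in> S"
    then have jn: "j < n" "j \<noteq> i" using S by (auto simp: nearest_nodes_def)
    show "j \<in> Nb'"
    proof (rule ccontr)
      assume "j \<notin> Nb'"
      then have "int (r + T) + 1 \<le> ring_dist n (p i) (p j)" using jn pij[OF jn] by (auto simp: Nb'_def ring_adj_def)
      then have far: "real r + real T + 1 \<le> real_of_int (ring_dist n (p i) (p j))" by linarith
      have "Nb \<subseteq> S"
      proof
        fix l assume l: "l \<in> Nb"
        then have ln: "l < n" "l \<noteq> i" and near: "real_of_int (ring_dist n (p i) (p l)) \<le> real r"
          by (auto simp: Nb_def ring_adj_def)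
        show "l \<in> S"
        proof (rule ccontr)
          assume "l \<notin> S"
          then have "angle_dist (\<theta> i) (\<theta> j) \<le> angle_dist (\<theta> i) (\<theta> l)"
            using S j ln by (auto simp: nearest_nodes_def)
          then have "2 * pi / n * ring_dist n (p i) (p j) - 2 * pi / n * ring_dist n (p i) (p l) \<le> 2 * \<eta>"
            using ad[OF jn(1)] ad[OF ln(1)] by linarith
          moreover have "2 * pi / n * (real T + 1) \<le> 2 * pi / n * (ring_dist n (p i) (p j) - ring_dist n (p i) (p l))"
            using far near by (intro mult_left_mono) auto
          ultimately have "2 * pi / n * (real T + 1) \<le> 2 * \<eta>" by (simp add: right_diff_distrib)
          then have "real T + 1 \<le> n * \<eta> / pi" using n by (simp add: field_simps)
          then show False using T by simp
        qed
      qed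
      then have "Nb = S" using card_subset_eq[of S Nb] fin c cS by simp
      then show False using j sub \<open>j \<notin> Nb'\<close> by blast
    qed
  qed
  then have "card (S - Nb) \<le> card (Nb' - Nb)" using fin by (intro card_mono) auto
  also have "\<dots> = 2 * T" using card_Diff_subset[OF fin(1) sub] c by simp
  finally have a: "card (S - Nb) \<le> 2 * T" .
  have "card (Nb - S) = card (S - Nb)"
    using card_Diff_subset_Int[of Nb S] card_Diff_subset_Int[of S Nb] fin c cS by (simp add: Int_commute)
  moreover have "card (sym_diff S Nb) \<le> card (S - Nb) + card (Nb - S)" by (rule card_Un_le)
  ultimately show ?thesis using a by simp
qed

section \<open>Concentration of the noise\<close>

lemma hoeffding_bernoulli:
  assumes A: "finite A" and pr: "\<And>e. e \<in> A \<Longrightarrow> 0 \<le> pr e \<and> pr e \<le> 1" and t: "0 \<le> t" and V: "(\<Sum>e\<in>A. (c e)\<^sup>2) \<le> V" "0 < V"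
  shows "measure_pmf.prob (Pi_pmf A False (\<lambda>e. bernoulli_pmf (pr e)))
     {E. t < \<bar>\<Sum>e\<in>A. c e * (of_bool (E e) - pr e)\<bar>} \<le> 2 * exp (- 2 * t\<^sup>2 / V)"
proof (cases "(\<Sum>e\<in>A. (c e)\<^sup>2) = 0")
  case True
  then have "c e = 0" if "e \<in> A" for e using that A by (simp add: sum_nonneg_eq_0_iff)
  then have "{E. t < \<bar>\<Sum>e\<in>A. c e * (of_bool (E e) - pr e)\<bar>} = {}" using t by (auto simp: not_less)
  then show ?thesis by simp
next
  case False
  then have pos: "0 < (\<Sum>e\<in>A. (c e)\<^sup>2)" using sum_nonneg[of A "\<lambda>e. (c e)\<^sup>2"] by simp
  define P where "P = Pi_pmf A False (\<lambda>e. bernoulli_pmf (pr e))"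
  define X where "X e E = c e * of_bool (E e)" for e :: 'a and E :: "'a \<Rightarrow> bool"
  have ex: "measure_pmf.expectation P (X e) = c e * pr e" if "e \<in> A" for e
  proof -
    have "measure_pmf.expectation P (X e) = measure_pmf.expectation (map_pmf (\<lambda>E. E e) P) (\<lambda>b. c e * of_bool b)"
      by (simp add: X_def[abs_def])
    also have "map_pmf (\<lambda>E. E e) P = bernoulli_pmf (pr e)" using A that by (simp add: P_def Pi_pmf_component)
    finally show ?thesis using pr[OF that] by simp
  qed
  interpret Hoeffding_ineq "measure_pmf P" A X "\<lambda>e. min 0 (c e)" "\<lambda>e. max 0 (c e)" "\<Sum>e\<in>A. measure_pmf.expectation P (X e)"
  proof unfold_locales
    show "prob_space.indep_vars (measure_pmf P) (\<lambda>_. borel) X A"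
      unfolding P_def X_def
      by (intro prob_space.indep_vars_compose2[OF _ indep_vars_Pi_pmf]) (auto simp: A measure_pmf.prob_space_axioms)
    show "AE x in measure_pmf P. X e x \<in> {min 0 (c e)..max 0 (c e)}" for e by (auto simp: X_def)
  qed (use A in simp_all)
  have d: "(\<Sum>e\<in>A. (max 0 (c e) - min 0 (c e))\<^sup>2) = (\<Sum>e\<in>A. (c e)\<^sup>2)"
    by (intro sum.cong refl) (auto simp: max_def min_def)
  have "measure_pmf.prob P {E. t < \<bar>\<Sum>e\<in>A. c e * (of_bool (E e) - pr e)\<bar>}
      \<le> measure_pmf.prob P {E \<in> space (measure_pmf P). t \<le> \<bar>(\<Sum>e\<in>A. X e E) - (\<Sum>e\<in>A. measure_pmf.expectation P (X e))\<bar>}"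
    by (intro measure_pmf.finite_measure_mono) (auto simp: X_def ex sum_subtractf right_diff_distrib)
  also have "\<dots> \<le> 2 * exp (- 2 * t\<^sup>2 / (\<Sum>e\<in>A. (max 0 (c e) - min 0 (c e))\<^sup>2))"
    by (rule Hoeffding_ineq_abs_ge) (use t pos d in auto)
  also have "\<dots> \<le> 2 * exp (- 2 * t\<^sup>2 / V)"
    unfolding d using V pos by (auto intro!: divide_left_mono mult_pos_pos)
  finally show ?thesis unfolding P_def .
qed

lemma prob_bind_le:
  assumes "\<And>x. measure_pmf.prob (g x) S \<le> c" "0 \<le> c"
  shows "measure_pmf.prob (bind_pmf p g) S \<le> c"
proof -
  have "emeasure (measure_pmf (bind_pmf p g)) S = (\<integral>\<^sup>+x. emeasure (g x) S \<partial>p)" by simp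
  also have "\<dots> \<le> (\<integral>\<^sup>+x. ennreal c \<partial>p)"
    using assms by (intro nn_integral_mono) (simp add: measure_pmf.emeasure_eq_measure ennreal_leI)
  also have "\<dots> = ennreal c" by simp
  finally show ?thesis using assms(2) by (simp add: measure_pmf.emeasure_eq_measure)
qed

text \<open>Conditioning on the coordinates outside \<open>B\<close>: a bound for every fixed value of them is a bound for the
whole product.\<close>
lemma prob_Pi_pmf_split_le:
  assumes A: "finite A" "B \<subseteq> A" and c: "0 \<le> c"
    and bd: "\<And>g. measure_pmf.prob (Pi_pmf B d p) {f. (\<lambda>x. if x \<in> B then f x else g x) \<in> S} \<le> c"
  shows "measure_pmf.prob (Pi_pmf A d p) S \<le> c"
proof -
  have fin: "finite B" using A finite_subset by blast
  have "Pi_pmf A d p = Pi_pmf (B \<union> (A - B)) d p" using A by (simp add: Un_absorb1)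
  also have "\<dots> = map_pmf (\<lambda>(f, g) x. if x \<in> B then f x else g x) (pair_pmf (Pi_pmf B d p) (Pi_pmf (A - B) d p))"
    using A fin by (intro Pi_pmf_union) auto
  also have "\<dots> = bind_pmf (Pi_pmf (A - B) d p) (\<lambda>g. map_pmf (\<lambda>f x. if x \<in> B then f x else g x) (Pi_pmf B d p))"
    unfolding pair_pmf_def by (subst bind_commute_pmf) (simp add: map_bind_pmf map_pmf_def bind_return_pmf bind_assoc_pmf)
  finally show ?thesis
    by (simp only:) (rule prob_bind_le, use bd c in \<open>auto simp: vimage_def\<close>)
qed

definition node_pairs :: "nat \<Rightarrow> (nat \<times> nat) set" where
  "node_pairs n = {(i, j). i < j \<and> j < n}"

abbreviation edge_law :: "nat \<Rightarrow> (nat \<times> nat \<Rightarrow> real) \<Rightarrow> (nat \<times> nat \<Rightarrow> bool) pmf" where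
  "edge_law n pr \<equiv> Pi_pmf (node_pairs n) False (\<lambda>e. bernoulli_pmf (pr e))"

text \<open>The centered adjacency matrix, as a function of the coin flips.\<close>
definition noise :: "(nat \<times> nat \<Rightarrow> real) \<Rightarrow> (nat \<times> nat \<Rightarrow> bool) \<Rightarrow> nat \<Rightarrow> nat \<Rightarrow> real" where
  "noise pr E a b = (if a < b then of_bool (E (a, b)) - pr (a, b)
     else if b < a then of_bool (E (b, a)) - pr (b, a) else 0)"

lemma finite_node_pairs: "finite (node_pairs n)"
  by (rule finite_subset[of _ "{..<n} \<times> {..<n}"]) (auto simp: node_pairs_def)

lemma noise_sym: "noise pr E a b = noise pr E b a"
  by (simp add: noise_def)

lemma noise_diag: "noise pr E a a = 0"
  by (simp add: noise_def)

lemma sum_square_node_pairs: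
  fixes g :: "nat \<Rightarrow> nat \<Rightarrow> real"
  shows "(\<Sum>a<n. \<Sum>b<n. g a b) = (\<Sum>a<n. g a a) + (\<Sum>(a, b)\<in>node_pairs n. g a b + g b a)"
proof -
  have split: "{..<n} \<times> {..<n} = (\<lambda>a. (a, a)) ` {..<n} \<union> (node_pairs n \<union> prod.swap ` node_pairs n)"
    by (force simp: node_pairs_def image_iff)
  have "(\<Sum>a<n. \<Sum>b<n. g a b) = sum (case_prod g) ({..<n} \<times> {..<n})" by (rule sum.cartesian_product)
  also have "\<dots> = sum (case_prod g) ((\<lambda>a. (a, a)) ` {..<n}) + sum (case_prod g) (node_pairs n \<union> prod.swap ` node_pairs n)"
    unfolding split by (rule sum.union_disjoint) (auto simp: finite_node_pairs, auto simp: node_pairs_def)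
  also have "sum (case_prod g) (node_pairs n \<union> prod.swap ` node_pairs n) = sum (case_prod g) (node_pairs n) + sum (case_prod g) (prod.swap ` node_pairs n)"
    by (rule sum.union_disjoint) (auto simp: finite_node_pairs, auto simp: node_pairs_def)
  also have "sum (case_prod g) ((\<lambda>a. (a, a)) ` {..<n}) = (\<Sum>a<n. g a a)"
    by (subst sum.reindex) (auto simp: inj_on_def)
  also have "sum (case_prod g) (prod.swap ` node_pairs n) = (\<Sum>(a, b)\<in>node_pairs n. g b a)"
    by (subst sum.reindex) (auto simp: inj_on_def intro!: sum.cong)
  finally show ?thesis by (simp add: sum.distrib case_prod_unfold)
qed

lemma quadratic_form_noise:
  "inn n x (mv n (noise pr E) x) = (\<Sum>e\<in>node_pairs n. (2 * x (fst e) * x (snd e)) * (of_bool (E e) - pr e))"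
proof -
  have "inn n x (mv n (noise pr E) x) = (\<Sum>a<n. \<Sum>b<n. x a * noise pr E a b * x b)"
    by (simp add: inn_def mv_def sum_distrib_left mult.assoc)
  also have "\<dots> = (\<Sum>e\<in>node_pairs n. (2 * x (fst e) * x (snd e)) * (of_bool (E e) - pr e))"
    unfolding sum_square_node_pairs noise_diag
    by (simp, intro sum.cong refl) (auto simp: node_pairs_def noise_def)
  finally show ?thesis .
qed

lemma quadratic_form_noise_tail:
  assumes pr: "\<And>e. e \<in> node_pairs n \<Longrightarrow> 0 \<le> pr e \<and> pr e \<le> 1" and x: "inn n x x \<le> R" "0 < R" and t: "0 \<le> t"
  shows "measure_pmf.prob (edge_law n pr)
    {E. t < \<bar>inn n x (mv n (noise pr E) x)\<bar>} \<le> 2 * exp (- (t / R)\<^sup>2)"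
proof -
  have "(\<Sum>a<n. \<Sum>b<n. (x a)\<^sup>2 * (x b)\<^sup>2) = inn n x x * inn n x x"
    by (simp add: inn_def sum_product power2_eq_square)
  also have "\<dots> \<le> R * R" using x by (intro mult_mono) (auto simp: inn_def sum_nonneg)
  finally have "(\<Sum>a<n. \<Sum>b<n. (x a)\<^sup>2 * (x b)\<^sup>2) \<le> R * R" .
  then have "(\<Sum>e\<in>node_pairs n. 2 * ((x (fst e))\<^sup>2 * (x (snd e))\<^sup>2)) \<le> R\<^sup>2"
  proof -
    assume *: "(\<Sum>a<n. \<Sum>b<n. (x a)\<^sup>2 * (x b)\<^sup>2) \<le> R * R"
    have "(\<Sum>(a, b)\<in>node_pairs n. (x a)\<^sup>2 * (x b)\<^sup>2 + (x b)\<^sup>2 * (x a)\<^sup>2) = (\<Sum>e\<in>node_pairs n. 2 * ((x (fst e))\<^sup>2 * (x (snd e))\<^sup>2))"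
      by (intro sum.cong refl) (auto simp: mult.commute)
    moreover have "0 \<le> (\<Sum>a<n. (x a)\<^sup>2 * (x a)\<^sup>2)" by (rule sum_nonneg) simp
    ultimately show ?thesis using *[unfolded sum_square_node_pairs] unfolding power2_eq_square[of R] by linarith
  qed
  then have "2 * (\<Sum>e\<in>node_pairs n. 2 * ((x (fst e))\<^sup>2 * (x (snd e))\<^sup>2)) \<le> 2 * R\<^sup>2" by simp
  then have V: "(\<Sum>e\<in>node_pairs n. (2 * x (fst e) * x (snd e))\<^sup>2) \<le> 2 * R\<^sup>2"
    by (simp add: power_mult_distrib sum_distrib_left mult.assoc)
  have "measure_pmf.prob (edge_law n pr)
    {E. t < \<bar>inn n x (mv n (noise pr E) x)\<bar>} \<le> 2 * exp (- 2 * t\<^sup>2 / (2 * R\<^sup>2))"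
    unfolding quadratic_form_noise by (rule hoeffding_bernoulli[OF finite_node_pairs pr t V]) (use x in auto)
  then show ?thesis by (simp add: power_divide)
qed

text \<open>A net of the unit sphere. With \<open>25 n\<close> bounding the sum of squares of the integer coordinates, the points
\<open>z / (4 sqrt n)\<close> have norm at most \<open>5 / 4\<close> and come within \<open>1 / 4\<close> of every unit vector. The box
\<open>\<bar>z a\<bar> \<le> 5 n\<close> follows from the bound on the squares and makes the set visibly finite.\<close>
definition grid :: "nat \<Rightarrow> (nat \<Rightarrow> int) set" where
  "grid n = {z \<in> PiE {..<n} (\<lambda>_. {- 5 * int n..5 * int n}). (\<Sum>a<n. (z a)\<^sup>2) \<le> 25 * int n}"

definition grid_point :: "nat \<Rightarrow> (nat \<Rightarrow> int) \<Rightarrow> nat \<Rightarrow> real" where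
  "grid_point n z a = real_of_int (z a) / (4 * sqrt n)"

lemma finite_grid: "finite (grid n)"
  unfolding grid_def by (rule finite_subset[OF Collect_restrict finite_PiE]) auto

lemma sum_half_powers_int: "(\<Sum>z\<in>{- int m..int m}. (1 / 2 :: real) ^ nat \<bar>z\<bar>) \<le> 3"
proof -
  have "(\<Sum>z\<in>{- int m..int m}. (1 / 2 :: real) ^ nat \<bar>z\<bar>) = 3 - 2 * (1 / 2) ^ m"
  proof (induction m)
    case (Suc m)
    have "{- int (Suc m)..int (Suc m)} = insert (- int (Suc m)) (insert (int (Suc m)) {- int m..int m})" by auto
    then show ?case using Suc by (simp add: nat_add_distrib)
  qed simp
  then show ?thesis by simp
qed

text \<open>An exponential count by a generating function: each grid point has \<open>\<Sum> \<bar>z a\<bar> \<le> 25 n\<close>, hence weight at least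
\<open>2 ^ (- 25 n)\<close> under \<open>\<Prod> 2 ^ (- \<bar>z a\<bar>)\<close>, whose total over the box is at most \<open>4 ^ n\<close>.\<close>
lemma card_grid: "real (card (grid n)) \<le> 2 ^ (27 * n)"
proof -
  have "real (card (grid n)) * (1 / 2) ^ (25 * n) = (\<Sum>z\<in>grid n. (1 / 2) ^ (25 * n))" by simp
  also have "\<dots> \<le> (\<Sum>z\<in>grid n. \<Prod>a<n. (1 / 2) ^ nat \<bar>z a\<bar>)"
  proof (rule sum_mono)
    fix z assume z: "z \<in> grid n"
    have "int (\<Sum>a<n. nat \<bar>z a\<bar>) \<le> (\<Sum>a<n. (z a)\<^sup>2)"
    proof -
      have "\<bar>y\<bar> \<le> y\<^sup>2" for y :: int
      proof (cases "y = 0")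
        case False
        then have "\<bar>y\<bar> * 1 \<le> \<bar>y\<bar> * \<bar>y\<bar>" by (intro mult_left_mono) auto
        then show ?thesis by (simp add: power2_eq_square)
      qed simp
      then show ?thesis by (simp add: sum_mono)
    qed
    also have "\<dots> \<le> int (25 * n)" using z by (simp add: grid_def)
    finally have "(\<Sum>a<n. nat \<bar>z a\<bar>) \<le> 25 * n" by linarith
    then have "(1 / 2 :: real) ^ (25 * n) \<le> (1 / 2) ^ (\<Sum>a<n. nat \<bar>z a\<bar>)" by (intro power_decreasing) auto
    then show "(1 / 2 :: real) ^ (25 * n) \<le> (\<Prod>a<n. (1 / 2) ^ nat \<bar>z a\<bar>)" by (simp add: power_sum)
  qed
  also have "\<dots> \<le> (\<Sum>z\<in>PiE {..<n} (\<lambda>_. {- 5 * int n..5 * int n}). \<Prod>a<n. (1 / 2) ^ nat \<bar>z a\<bar>)"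
  proof (rule sum_mono2)
    show "finite (PiE {..<n} (\<lambda>_. {- 5 * int n..5 * int n}))" by (rule finite_PiE) auto
    show "grid n \<subseteq> PiE {..<n} (\<lambda>_. {- 5 * int n..5 * int n})" unfolding grid_def by (rule Collect_restrict)
  qed (simp add: prod_nonneg)
  also have "\<dots> = (\<Prod>a<n. \<Sum>z\<in>{- 5 * int n..5 * int n}. (1 / 2 :: real) ^ nat \<bar>z\<bar>)"
    by (rule prod_sum_PiE[symmetric]) auto
  also have "\<dots> \<le> (\<Prod>a<n. 4)"
  proof (rule prod_mono)
    fix a assume "a \<in> {..<n}"
    have "(\<Sum>z\<in>{- 5 * int n..5 * int n}. (1 / 2 :: real) ^ nat \<bar>z\<bar>) \<le> 3"
      using sum_half_powers_int[of "5 * n"] by (simp only: of_nat_mult of_nat_numeral mult_minus_left)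
    moreover have "0 \<le> (\<Sum>z\<in>{- 5 * int n..5 * int n}. (1 / 2 :: real) ^ nat \<bar>z\<bar>)" by (rule sum_nonneg) simp
    ultimately show "0 \<le> (\<Sum>z\<in>{- 5 * int n..5 * int n}. (1 / 2 :: real) ^ nat \<bar>z\<bar>) \<and>
        (\<Sum>z\<in>{- 5 * int n..5 * int n}. (1 / 2 :: real) ^ nat \<bar>z\<bar>) \<le> 4" by linarith
  qed
  also have "\<dots> = 2 ^ (2 * n)" by (simp add: power_mult)
  finally have "real (card (grid n)) * (1 / 2) ^ (25 * n) * 2 ^ (25 * n) \<le> 2 ^ (2 * n) * 2 ^ (25 * n)"
    by (rule mult_right_mono) simp
  moreover have "(1 / 2 :: real) ^ (25 * n) * 2 ^ (25 * n) = 1" by (simp only: power_mult_distrib[symmetric]) simp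
  moreover have "(2 :: real) ^ (2 * n) * 2 ^ (25 * n) = 2 ^ (27 * n)" by (simp only: power_add[symmetric]) simp
  ultimately show ?thesis by (simp only: mult.assoc mult_1_right)
qed

lemma inn_grid_point: "0 < n \<Longrightarrow> inn n (grid_point n z) (grid_point n z) = real_of_int (\<Sum>a<n. (z a)\<^sup>2) / (16 * n)"
  by (simp add: inn_def grid_point_def sum_divide_distrib power2_eq_square)

lemma grid_approx:
  assumes x: "nrm n x = 1" and n: "0 < n"
  obtains z where "z \<in> grid n" "nrm n (\<lambda>a. x a - grid_point n z a) \<le> 1 / 4"
    "nrm n (grid_point n z) \<le> 5 / 4"
proof -
  define z where "z = restrict (\<lambda>a. \<lfloor>4 * sqrt n * x a\<rfloor>) {..<n}"
  have n0: "0 < sqrt n" using n by simp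
  have d: "nrm n (\<lambda>a. x a - grid_point n z a) \<le> 1 / 4"
  proof -
    have "nrm n (\<lambda>a. x a - grid_point n z a) \<le> nrm n (\<lambda>a. 1 / (4 * sqrt n))"
    proof (rule nrm_mono)
      fix a assume a: "a < n"
      have "x a - grid_point n z a = (4 * sqrt n * x a - of_int \<lfloor>4 * sqrt n * x a\<rfloor>) / (4 * sqrt n)"
        using a n by (simp add: grid_point_def z_def field_simps)
      moreover have "\<bar>4 * sqrt n * x a - of_int \<lfloor>4 * sqrt n * x a\<rfloor>\<bar> \<le> 1" by linarith
      ultimately show "\<bar>x a - grid_point n z a\<bar> \<le> \<bar>1 / (4 * sqrt n)\<bar>"
        using n0 by (simp add: abs_divide divide_right_mono)
    qed
    also have "\<dots> = 1 / 4" using n0 by (simp add: L2_set_constant)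
    finally show ?thesis .
  qed
  have y: "nrm n (grid_point n z) \<le> 5 / 4"
  proof -
    have "nrm n (grid_point n z) = nrm n (\<lambda>a. x a + - (x a - grid_point n z a))" by simp
    also have "\<dots> \<le> nrm n x + nrm n (\<lambda>a. - (x a - grid_point n z a))" by (rule L2_set_triangle_ineq)
    also have "nrm n (\<lambda>a. - (x a - grid_point n z a)) = nrm n (\<lambda>a. x a - grid_point n z a)"
      by (simp only: L2_set_def power2_minus)
    finally show ?thesis using d x by simp
  qed
  have "real_of_int (\<Sum>a<n. (z a)\<^sup>2) = 16 * n * (nrm n (grid_point n z))\<^sup>2"
    unfolding nrm_power2 inn_grid_point[OF n] using n by simp
  also have "\<dots> \<le> 16 * n * (5 / 4)\<^sup>2" using y by (intro mult_left_mono power_mono) auto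
  also have "\<dots> = real_of_int (25 * int n)" by (simp add: power2_eq_square)
  finally have s: "(\<Sum>a<n. (z a)\<^sup>2) \<le> 25 * int n" by linarith
  have "z a \<in> {- 5 * int n..5 * int n}" if a: "a < n" for a
  proof -
    have "(z a)\<^sup>2 \<le> (\<Sum>a<n. (z a)\<^sup>2)" using a by (intro member_le_sum) auto
    also have "\<dots> \<le> 25 * int n * int n" using s n by (simp add: order_trans[OF s])
    finally have "(z a)\<^sup>2 \<le> (5 * int n)\<^sup>2" by (simp add: power2_eq_square)
    then have "\<bar>z a\<bar> \<le> \<bar>5 * int n\<bar>" by (simp only: abs_le_square_iff)
    then show ?thesis by auto
  qed
  then have "z \<in> grid n" using s by (auto simp: grid_def z_def)
  then show ?thesis using d y that by blast
qed

lemma inn_mv_add_diff: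
  fixes x y :: "nat \<Rightarrow> real"
  assumes sym: "\<And>a b. a < n \<Longrightarrow> b < n \<Longrightarrow> W a b = W b a"
  shows "inn n (\<lambda>a. x a + y a) (mv n W (\<lambda>a. x a + y a)) - inn n (\<lambda>a. x a - y a) (mv n W (\<lambda>a. x a - y a)) = 4 * inn n x (mv n W y)"
    and "inn n (\<lambda>a. x a - y a) (mv n W (\<lambda>a. x a + y a)) = inn n x (mv n W x) - inn n y (mv n W y)"
proof -
  have p: "(\<lambda>a. x a + y a) = (\<lambda>a. 1 * x a + 1 * y a)" "(\<lambda>a. x a - y a) = (\<lambda>a. 1 * x a + (- 1) * y a)" by simp_all
  have s: "inn n y (mv n W x) = inn n x (mv n W y)" using inn_mv_sym[where n = n and W = W and x = y and y = x, OF sym] by (simp add: inn_commute)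
  show "inn n (\<lambda>a. x a + y a) (mv n W (\<lambda>a. x a + y a)) - inn n (\<lambda>a. x a - y a) (mv n W (\<lambda>a. x a - y a)) = 4 * inn n x (mv n W y)"
    unfolding p mv_lin inn_lin_left inn_lin_right s by simp
  show "inn n (\<lambda>a. x a - y a) (mv n W (\<lambda>a. x a + y a)) = inn n x (mv n W x) - inn n y (mv n W y)"
    unfolding p mv_lin inn_lin_left inn_lin_right s by simp
qed

lemma nrm_add_diff: "(nrm n (\<lambda>a. x a + y a))\<^sup>2 + (nrm n (\<lambda>a. x a - y a))\<^sup>2 = 2 * (nrm n x)\<^sup>2 + 2 * (nrm n y)\<^sup>2"
  unfolding nrm_power2 inn_def by (simp add: sum.distrib[symmetric] sum_distrib_left algebra_simps)

lemma nrm_normalize: "0 < nrm n w \<Longrightarrow> nrm n (\<lambda>a. 1 / nrm n w * w a + 0 * 0) = 1"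
  using L2_set_right_distrib[of "1 / nrm n w" w "{..<n}"] by simp

lemma opnorm_leI_unit:
  assumes N: "0 \<le> N" and b: "\<And>x y. nrm n x = 1 \<Longrightarrow> nrm n y = 1 \<Longrightarrow> \<bar>inn n x (mv n W y)\<bar> \<le> N"
  shows "opnorm_le n W N"
  unfolding opnorm_le_def
proof (intro conjI allI N)
  fix x y :: "nat \<Rightarrow> real"
  show "\<bar>inn n x (mv n W y)\<bar> \<le> N * nrm n x * nrm n y"
  proof (cases "nrm n x = 0 \<or> nrm n y = 0")
    case True
    then have "inn n x (mv n W y) = 0" by (auto simp: L2_set_eq_0_iff inn_def mv_def)
    then show ?thesis using N by simp
  next
    case False
    then have p: "0 < nrm n x" "0 < nrm n y" by (auto simp: less_le)
    define x' y' where "x' = (\<lambda>a. 1 / nrm n x * x a + 0 * 0)" and "y' = (\<lambda>a. 1 / nrm n y * y a + 0 * 0)"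
    have "\<bar>inn n x' (mv n W y')\<bar> \<le> N"
      unfolding x'_def y'_def by (intro b nrm_normalize p)
    moreover have "inn n x' (mv n W y') = inn n x (mv n W y) / (nrm n x * nrm n y)"
      unfolding x'_def y'_def mv_lin inn_lin_left inn_lin_right by (simp add: inn_def)
    ultimately show ?thesis using p by (simp add: abs_divide abs_mult field_simps)
  qed
qed

lemma opnorm_le_polarization:
  assumes sym: "\<And>a b. a < n \<Longrightarrow> b < n \<Longrightarrow> W a b = W b a" and N: "0 \<le> N"
    and q: "\<And>x. \<bar>inn n x (mv n W x)\<bar> \<le> N * (nrm n x)\<^sup>2"
  shows "opnorm_le n W N"
proof (rule opnorm_leI_unit[OF N])
  fix x y assume x: "nrm n x = 1" "nrm n y = 1"
  have "\<bar>4 * inn n x (mv n W y)\<bar> \<le> N * (nrm n (\<lambda>a. x a + y a))\<^sup>2 + N * (nrm n (\<lambda>a. x a - y a))\<^sup>2"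
    using q[of "\<lambda>a. x a + y a"] q[of "\<lambda>a. x a - y a"] inn_mv_add_diff(1)[where n = n and W = W and x = x and y = y, OF sym] by linarith
  also have "\<dots> = N * 4" unfolding distrib_left[symmetric] nrm_add_diff using x by simp
  finally show "\<bar>inn n x (mv n W y)\<bar> \<le> N" by simp
qed

text \<open>For a unit vector \<open>x\<close> with grid point \<open>y\<close>, the difference of the quadratic forms is the bilinear form at \<open>x - y\<close> and
\<open>x + y\<close>, at most \<open>1 / 4 * 9 / 4\<close> times the norm. This can be absorbed.\<close>
lemma opnorm_le_grid:
  assumes sym: "\<And>a b. a < n \<Longrightarrow> b < n \<Longrightarrow> W a b = W b a" and n: "0 < n" and t: "0 \<le> t"
    and q: "\<And>z. z \<in> grid n \<Longrightarrow> \<bar>inn n (grid_point n z) (mv n W (grid_point n z))\<bar> \<le> t"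
  shows "opnorm_le n W (16 / 7 * t)"
proof -
  define S where "S = (\<lambda>x. \<bar>inn n x (mv n W x)\<bar>) ` {x. nrm n x = 1}"
  define N where "N = Sup S"
  have abs1: "\<bar>x a\<bar> \<le> 1" if "nrm n x = 1" "a < n" for x a using abs_le_nrm[OF that(2), of x] that by simp
  have bdd: "bdd_above S"
  proof (rule bdd_aboveI[of _ "\<Sum>a<n. \<Sum>b<n. \<bar>W a b\<bar>"])
    fix s assume "s \<in> S"
    then obtain x where x: "nrm n x = 1" "s = \<bar>inn n x (mv n W x)\<bar>" by (auto simp: S_def)
    have "s \<le> (\<Sum>a<n. \<bar>x a * mv n W x a\<bar>)" unfolding x(2) inn_def by (rule sum_abs)
    also have "\<dots> \<le> (\<Sum>a<n. \<Sum>b<n. \<bar>W a b\<bar>)"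
    proof (rule sum_mono)
      fix a assume a: "a \<in> {..<n}"
      have "\<bar>x a * mv n W x a\<bar> \<le> 1 * \<bar>mv n W x a\<bar>" unfolding abs_mult using abs1[OF x(1)] a by (intro mult_right_mono) auto
      also have "\<dots> \<le> (\<Sum>b<n. \<bar>W a b * x b\<bar>)" unfolding mv_def by (simp add: sum_abs)
      also have "\<dots> \<le> (\<Sum>b<n. \<bar>W a b\<bar> * 1)"
        unfolding abs_mult using abs1[OF x(1)] by (intro sum_mono mult_left_mono) auto
      finally show "\<bar>x a * mv n W x a\<bar> \<le> (\<Sum>b<n. \<bar>W a b\<bar>)" by simp
    qed
    finally show "s \<le> (\<Sum>a<n. \<Sum>b<n. \<bar>W a b\<bar>)" .
  qed
  have ne: "S \<noteq> {}"
  proof -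
    have "nrm n (\<lambda>b. if b = 0 then 1 else 0) = 1"
      using n by (simp add: L2_set_def if_distrib[of "\<lambda>x. x\<^sup>2"] cong: if_cong)
    then show ?thesis by (auto simp: S_def)
  qed
  have upper: "\<bar>inn n x (mv n W x)\<bar> \<le> N" if "nrm n x = 1" for x
    unfolding N_def by (rule cSup_upper[OF _ bdd]) (use that in \<open>auto simp: S_def\<close>)
  have N0: "0 \<le> N"
  proof -
    obtain s where "s \<in> S" using ne by blast
    then have "0 \<le> s" "s \<le> N" using cSup_upper[OF _ bdd] by (auto simp: S_def N_def)
    then show ?thesis by linarith
  qed
  have op: "opnorm_le n W N"
  proof (rule opnorm_le_polarization[OF sym N0])
    fix x
    show "\<bar>inn n x (mv n W x)\<bar> \<le> N * (nrm n x)\<^sup>2"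
    proof (cases "nrm n x = 0")
      case True
      then have "inn n x (mv n W x) = 0" by (auto simp: L2_set_eq_0_iff inn_def)
      then show ?thesis using N0 by simp
    next
      case False
      then have p: "0 < nrm n x" by (auto simp: less_le)
      define x' where "x' = (\<lambda>a. 1 / nrm n x * x a + 0 * 0)"
      have "\<bar>inn n x' (mv n W x')\<bar> \<le> N" unfolding x'_def by (intro upper nrm_normalize p)
      moreover have "inn n x' (mv n W x') = inn n x (mv n W x) / (nrm n x)\<^sup>2"
        unfolding x'_def mv_lin inn_lin_left inn_lin_right by (simp add: inn_def power2_eq_square)
      ultimately show ?thesis using p by (simp add: abs_divide field_simps)
    qed
  qed
  have "Sup S \<le> t + 9 / 16 * N"
  proof (rule cSup_least[OF ne])
    fix s assume "s \<in> S"
    then obtain x where x: "nrm n x = 1" "s = \<bar>inn n x (mv n W x)\<bar>" by (auto simp: S_def)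
    obtain z where z: "z \<in> grid n" "nrm n (\<lambda>a. x a - grid_point n z a) \<le> 1 / 4" "nrm n (grid_point n z) \<le> 5 / 4"
      using grid_approx[OF x(1) n] .
    define y where "y = grid_point n z"
    have "nrm n (\<lambda>a. x a + y a) \<le> 9 / 4"
      using L2_set_triangle_ineq[of x y "{..<n}"] x z by (simp add: y_def)
    then have "N * nrm n (\<lambda>a. x a - y a) * nrm n (\<lambda>a. x a + y a) \<le> N * (1 / 4) * (9 / 4)"
      using z N0 by (intro mult_mono mult_left_mono) (auto simp: y_def)
    moreover have "\<bar>inn n (\<lambda>a. x a - y a) (mv n W (\<lambda>a. x a + y a))\<bar> \<le> N * nrm n (\<lambda>a. x a - y a) * nrm n (\<lambda>a. x a + y a)"
      using op unfolding opnorm_le_def by blast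
    ultimately have "\<bar>inn n (\<lambda>a. x a - y a) (mv n W (\<lambda>a. x a + y a))\<bar> \<le> 9 / 16 * N" by linarith
    then have "\<bar>inn n x (mv n W x) - inn n y (mv n W y)\<bar> \<le> 9 / 16 * N"
      using inn_mv_add_diff(2)[where n = n and W = W and x = x and y = y, OF sym] by simp
    then show "s \<le> t + 9 / 16 * N" using q[OF z(1)] unfolding x(2) y_def by linarith
  qed
  then have "N \<le> 16 / 7 * t" by (simp add: N_def)
  then show ?thesis using op t
    unfolding opnorm_le_def by (meson L2_set_nonneg mult_nonneg_nonneg mult_right_mono order_trans zero_le_divide_iff zero_le_numeral)
qed

text \<open>A union bound over the net. At \<open>t = 16 sqrt n\<close> Hoeffding's inequality gives \<open>2 exp (- 28 n)\<close>, which beats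
the \<open>2 ^ (27 n)\<close> grid points. The factor \<open>16 / 7\<close> of the net then gives \<open>16 * 16 / 7 < 37\<close>. A bound without
logarithms matters, since the norm enters the main error term.\<close>
lemma noise_opnorm_tail:
  assumes pr: "\<And>e. e \<in> node_pairs n \<Longrightarrow> 0 \<le> pr e \<and> pr e \<le> 1" and n: "0 < n"
  shows "measure_pmf.prob (edge_law n pr)
    {E. \<not> opnorm_le n (noise pr E) (37 * sqrt n)} \<le> 2 * exp (- real n)"
proof -
  define P where "P = edge_law n pr"
  define t where "t = 16 * sqrt n"
  define bad where "bad z = {E. t < \<bar>inn n (grid_point n z) (mv n (noise pr E) (grid_point n z))\<bar>}" for z
  have t0: "0 \<le> t" by (simp add: t_def)
  have "{E. \<not> opnorm_le n (noise pr E) (37 * sqrt n)} \<subseteq> (\<Union>z\<in>grid n. bad z)"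
  proof
    fix E assume "E \<in> {E. \<not> opnorm_le n (noise pr E) (37 * sqrt n)}"
    then have no: "\<not> opnorm_le n (noise pr E) (37 * sqrt n)" by simp
    show "E \<in> (\<Union>z\<in>grid n. bad z)"
    proof (rule ccontr)
      assume "E \<notin> (\<Union>z\<in>grid n. bad z)"
      then have "\<bar>inn n (grid_point n z) (mv n (noise pr E) (grid_point n z))\<bar> \<le> t" if "z \<in> grid n" for z
        using that by (auto simp: bad_def not_less)
      then have "opnorm_le n (noise pr E) (16 / 7 * t)"
        using t0 n by (intro opnorm_le_grid noise_sym) auto
      moreover have "16 / 7 * t \<le> 37 * sqrt n" by (simp add: t_def)
      ultimately have "opnorm_le n (noise pr E) (37 * sqrt n)"
        unfolding opnorm_le_def by (meson L2_set_nonneg mult_right_mono order_trans)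
      then show False using no by simp
    qed
  qed
  then have "measure_pmf.prob P {E. \<not> opnorm_le n (noise pr E) (37 * sqrt n)} \<le> measure_pmf.prob P (\<Union>z\<in>grid n. bad z)"
    by (intro measure_pmf.finite_measure_mono) auto
  also have "\<dots> \<le> (\<Sum>z\<in>grid n. measure_pmf.prob P (bad z))"
    by (rule measure_pmf.finite_measure_subadditive_finite) (auto simp: finite_grid)
  also have "\<dots> \<le> (\<Sum>z\<in>grid n. 2 * exp (- 28 * real n))"
  proof (rule sum_mono)
    fix z assume z: "z \<in> grid n"
    have "inn n (grid_point n z) (grid_point n z) = real_of_int (\<Sum>a<n. (z a)\<^sup>2) / (16 * n)"
      by (rule inn_grid_point[OF n])
    also have "\<dots> \<le> real_of_int (25 * int n) / (16 * n)"
    proof (rule divide_right_mono)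
      have "(\<Sum>a<n. (z a)\<^sup>2) \<le> 25 * int n" using z by (simp add: grid_def)
      then show "real_of_int (\<Sum>a<n. (z a)\<^sup>2) \<le> real_of_int (25 * int n)" by (simp only: of_int_le_iff)
    qed simp
    also have "\<dots> = 25 / 16" using n by simp
    finally have "measure_pmf.prob P (bad z) \<le> 2 * exp (- (t / (25 / 16))\<^sup>2)"
      unfolding P_def bad_def by (intro quadratic_form_noise_tail pr t0) auto
    also have "\<dots> \<le> 2 * exp (- 28 * real n)"
      by (simp add: t_def power_divide power_mult_distrib)
    finally show "measure_pmf.prob P (bad z) \<le> 2 * exp (- 28 * real n)" .
  qed
  also have "\<dots> = real (card (grid n)) * (2 * exp (- 28 * real n))" by simp
  also have "\<dots> \<le> 2 ^ (27 * n) * (2 * exp (- 28 * real n))" by (intro mult_right_mono card_grid) auto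
  also have "(2 :: real) ^ (27 * n) \<le> exp 1 ^ (27 * n)"
    using exp_ge_add_one_self[of "1 :: real"] by (intro power_mono) auto
  also have "exp 1 ^ (27 * n) = exp (27 * real n)" by (simp add: exp_of_nat_mult[symmetric])
  also have "exp (27 * real n) * (2 * exp (- 28 * real n)) = 2 * exp (- real n)"
    by (simp add: exp_add[symmetric] mult.left_commute[of _ 2])
  finally show ?thesis unfolding P_def by simp
qed

text \<open>Given the entries outside row \<open>i\<close>, the vector to which the row is applied is fixed, and the row is a
family of independent centered variables.\<close>
lemma walk_noise_tail:
  assumes pr: "\<And>e. e \<in> node_pairs n \<Longrightarrow> 0 \<le> pr e \<and> pr e \<le> 1" and i: "i < n" and L: "0 \<le> L"
  shows "measure_pmf.prob (edge_law n pr)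
    {E. L * nrm n ((mv n (minor i (noise pr E)) ^^ j) f) < \<bar>walk n (noise pr E) i j f\<bar>} \<le> 2 * exp (- 2 * L\<^sup>2)"
proof (rule prob_Pi_pmf_split_le[where B = "{e \<in> node_pairs n. fst e = i \<or> snd e = i}"])
  define B where "B = {e \<in> node_pairs n. fst e = i \<or> snd e = i}"
  define edge where "edge b = (if i < b then (i, b) else (b, i))" for b
  have edge: "bij_betw edge ({..<n} - {i}) B"
    unfolding bij_betw_def inj_on_def
    by (auto simp: edge_def B_def node_pairs_def i split: if_splits; force simp: image_iff split: if_splits)
  fix g :: "nat \<times> nat \<Rightarrow> bool"
  define join where "join f' = (\<lambda>x. if x \<in> B then f' x else g x)" for f'
  define v where "v = (mv n (minor i (noise pr g)) ^^ j) f"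
  have minor_eq: "minor i (noise pr (join f')) a b = minor i (noise pr g) a b" for f' a b
    by (auto simp: minor_def noise_def join_def B_def node_pairs_def)
  then have v: "(mv n (minor i (noise pr (join f'))) ^^ j) f = v" for f'
    unfolding v_def by (simp add: mv_def[abs_def] minor_eq)
  define c where "c e = v (if fst e = i then snd e else fst e)" for e
  have cb: "c (edge b) = v b" if "b \<noteq> i" for b using that by (auto simp: c_def edge_def)
  have row: "walk n (noise pr (join f')) i j f = (\<Sum>e\<in>B. c e * (of_bool (f' e) - pr e))" for f'
  proof -
    have "walk n (noise pr (join f')) i j f = (\<Sum>b<n. noise pr (join f') i b * v b)"
      unfolding walk_def v by (simp add: mv_def)
    also have "\<dots> = (\<Sum>b\<in>{..<n}-{i}. noise pr (join f') i b * v b)"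
      using i by (subst sum.remove[of _ i]) (auto simp: noise_diag)
    also have "\<dots> = (\<Sum>b\<in>{..<n}-{i}. c (edge b) * (of_bool (f' (edge b)) - pr (edge b)))"
    proof (intro sum.cong refl)
      fix b assume b: "b \<in> {..<n} - {i}"
      then have "edge b \<in> B" using edge by (auto simp: bij_betw_def)
      then have "noise pr (join f') i b = of_bool (f' (edge b)) - pr (edge b)"
        using b by (auto simp: noise_def edge_def join_def)
      then show "noise pr (join f') i b * v b = c (edge b) * (of_bool (f' (edge b)) - pr (edge b))" using cb b by simp
    qed
    also have "\<dots> = (\<Sum>e\<in>B. c e * (of_bool (f' e) - pr e))" by (rule sum.reindex_bij_betw[OF edge])
    finally show ?thesis .
  qed
  have fin: "finite B" unfolding B_def using finite_node_pairs by simp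
  have prB: "0 \<le> pr e \<and> pr e \<le> 1" if "e \<in> B" for e using pr that by (auto simp: B_def)
  have cV: "(\<Sum>e\<in>B. (c e)\<^sup>2) \<le> (nrm n v)\<^sup>2"
  proof -
    have "(\<Sum>e\<in>B. (c e)\<^sup>2) = (\<Sum>b\<in>{..<n}-{i}. (c (edge b))\<^sup>2)" by (rule sum.reindex_bij_betw[OF edge, symmetric])
    also have "\<dots> = (\<Sum>b\<in>{..<n}-{i}. (v b)\<^sup>2)" using cb by (intro sum.cong) auto
    also have "\<dots> \<le> (\<Sum>b<n. (v b)\<^sup>2)" by (intro sum_mono2) auto
    finally show ?thesis unfolding nrm_power2 inn_def by (simp add: power2_eq_square)
  qed
  have eq: "{f'. join f' \<in> {E. L * nrm n ((mv n (minor i (noise pr E)) ^^ j) f) < \<bar>walk n (noise pr E) i j f\<bar>}}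
      = {f'. L * nrm n v < \<bar>\<Sum>e\<in>B. c e * (of_bool (f' e) - pr e)\<bar>}"
    by (simp add: v row)
  have "measure_pmf.prob (Pi_pmf B False (\<lambda>e. bernoulli_pmf (pr e))) {f'. L * nrm n v < \<bar>\<Sum>e\<in>B. c e * (of_bool (f' e) - pr e)\<bar>} \<le> 2 * exp (- 2 * L\<^sup>2)"
  proof (cases "nrm n v = 0")
    case True
    then have "(\<Sum>e\<in>B. (c e)\<^sup>2) = 0" using cV sum_nonneg[of B "\<lambda>e. (c e)\<^sup>2"] by simp
    then have "c e = 0" if "e \<in> B" for e using fin that by (simp add: sum_nonneg_eq_0_iff)
    then have "{f'. L * nrm n v < \<bar>\<Sum>e\<in>B. c e * (of_bool (f' e) - pr e)\<bar>} = {}" using True by simp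
    then show ?thesis by simp
  next
    case False
    then have "0 < (nrm n v)\<^sup>2" by simp
    then have "measure_pmf.prob (Pi_pmf B False (\<lambda>e. bernoulli_pmf (pr e))) {f'. L * nrm n v < \<bar>\<Sum>e\<in>B. c e * (of_bool (f' e) - pr e)\<bar>} \<le> 2 * exp (- 2 * (L * nrm n v)\<^sup>2 / (nrm n v)\<^sup>2)"
      using L by (intro hoeffding_bernoulli fin prB cV) auto
    then show ?thesis using False by (simp add: power_mult_distrib)
  qed
  then show "measure_pmf.prob (Pi_pmf {e \<in> node_pairs n. fst e = i \<or> snd e = i} False (\<lambda>e. bernoulli_pmf (pr e)))
      {f'. (\<lambda>x. if x \<in> {e \<in> node_pairs n. fst e = i \<or> snd e = i} then f' x else g x) \<in>
         {E. L * nrm n ((mv n (minor i (noise pr E)) ^^ j) f) < \<bar>walk n (noise pr E) i j f\<bar>}} \<le> 2 * exp (- 2 * L\<^sup>2)"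
    unfolding B_def[symmetric] using eq by (simp add: join_def)
qed (use finite_node_pairs in auto)

section \<open>From the noise bounds to the neighborhoods\<close>

lemma spectral_basis_shift:
  assumes s: "spectral_basis n A u e"
  shows "spectral_basis n (\<lambda>a b. A a b + (if a = b then q else 0)) u (\<lambda>l. e l + q)"
proof -
  have "A a b + (if a = b then q else 0) = (\<Sum>l<n. u l a * (e l + q) * u l b)" if "a < n" "b < n" for a b
  proof -
    have "(\<Sum>l<n. u l a * (e l + q) * u l b) = (\<Sum>l<n. u l a * e l * u l b) + q * (\<Sum>l<n. u l a * u l b)"
      by (simp add: algebra_simps sum.distrib sum_distrib_left)
    then show ?thesis using s that by (simp add: spectral_basis_def)
  qed
  then show ?thesis using s by (auto simp: spectral_basis_def monotone_on_def)
qed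

context noisy_ring
begin

text \<open>
  The error of an entry relative to the main term, of size \<open>s r / sqrt n\<close>. The first summand is \<open>norm W\<close> divided
  by the gap, the second the row noise; \<open>q\<close> accounts for the diagonal shift.\<close>
definition entry_error :: "real \<Rightarrow> real" where
  "entry_error L = 45 * (N / (s * G)) + (56 * L + q) * sqrt n / (s * real r)"

text \<open>The second and third eigenvalue may differ, but in both coordinates the eigenvector times its eigenvalue
approximates its \<open>m = 1\<close> part with the same factor \<open>R\<close>. Divided by \<open>R\<close>, the planar points are therefore a
nearly orthonormal image of the points on the true circle.\<close>
lemma spectral_angle_near:
  assumes dec: "spectral_decomposition n A U eig"
    and A: "\<And>a b. a < n \<Longrightarrow> b < n \<Longrightarrow> A $$ (a, b) + (if a = b then q else 0) = M a b + W a b"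
    and L: "0 \<le> L"
    and walks: "\<And>a t j. a < n \<Longrightarrow> t \<in> modes \<Longrightarrow> j < n \<Longrightarrow> \<bar>walk n W a j (mode t)\<bar> \<le> L * nrm n ((mv n (minor a W) ^^ j) (mode t))"
    and small: "entry_error L \<le> 1 / 4"
  shows "\<exists>\<psi> \<sigma>. \<bar>\<sigma>\<bar> = 1 \<and>
    (\<forall>a<n. circ_dist (spectral_angle A U a - \<sigma> * (2 * pi * real (p a) / n - \<psi>)) \<le> 8 * entry_error L)"
proof -
  define u where "u = (\<lambda>l a. U $$ (a, l))"
  define e where "e l = eig l + q" for l
  have n2: "1 < n" "2 < n" using n_ge by auto
  have n0: "0 < real n" "0 < sqrt n" using real_r by auto
  have basis: "spectral_basis n (\<lambda>a b. A $$ (a, b) + (if a = b then q else 0)) u e"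
    using spectral_basis_shift[OF spectral_decomposition_basis[OF dec], of q] by (simp add: u_def e_def[abs_def])
  note near = eigenvalues_near[OF basis A] and pair = eigenpair_u[OF basis A]
  have near1: "\<bar>e 1 - s * mu n r 1\<bar> \<le> N" and near2: "\<bar>e 2 - s * mu n r 1\<bar> \<le> N"
    by (rule near; simp)+
  have pair1: "eigenpair (e 1) (u 1)" and pair2: "eigenpair (e 2) (u 2)"
    by (rule pair; use n2 in simp)+
  have inn: "inn n (u 1) (u 1) = 1" "inn n (u 2) (u 2) = 1" "inn n (u 1) (u 2) = 0"
    using basis n2 by (auto simp: spectral_basis_def)
  define k where "k = sqrt (2 / n)"
  have k2: "k * k = 2 / n" using n0 by (simp add: k_def)
  define \<epsilon> where "\<epsilon> = N / (s * G)"
  have sG: "0 < s * G" using s_pos G_pos by simp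
  have \<epsilon>: "0 \<le> \<epsilon>" "\<epsilon> \<le> 1" using N_nonneg N_le sG by (auto simp: \<epsilon>_def)
  define \<delta> where "\<delta> = (N / (4 * s * G))\<^sup>2"
  have \<delta>_eq: "\<delta> = \<epsilon> * \<epsilon> / 16" by (simp add: \<delta>_def \<epsilon>_def power2_eq_square)
  have "\<epsilon> * \<epsilon> \<le> \<epsilon>" using \<epsilon> by (simp add: mult_left_le)
  then have \<delta>: "4 * \<delta> \<le> \<epsilon>" "\<delta> \<le> 1 / 4" using \<epsilon> unfolding \<delta>_eq by linarith+
  have gram: "\<bar>inn n v w - ((k * coef True v) * (k * coef True w) + (k * coef False v) * (k * coef False w))\<bar> \<le> \<delta>"
    if "\<bar>l - s * mu n r 1\<bar> \<le> N" "eigenpair l v" "\<bar>l' - s * mu n r 1\<bar> \<le> N" "eigenpair l' w" for l v l' w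
  proof -
    have "(k * coef True v) * (k * coef True w) + (k * coef False v) * (k * coef False w)
      = (k * k) * (coef True v * coef True w + coef False v * coef False w)" by (simp add: algebra_simps)
    then show ?thesis unfolding k2 \<delta>_def using coef_gram[OF that] by simp
  qed
  obtain \<psi> \<sigma> where \<sigma>: "\<bar>\<sigma>\<bar> = 1"
    and rot: "\<And>\<phi>. \<bar>k * coef True (u 1) * cos \<phi> + k * coef False (u 1) * sin \<phi> - cos (\<sigma> * (\<phi> - \<psi>))\<bar> \<le> 4 * \<delta>"
      "\<And>\<phi>. \<bar>k * coef True (u 2) * cos \<phi> + k * coef False (u 2) * sin \<phi> - sin (\<sigma> * (\<phi> - \<psi>))\<bar> \<le> 4 * \<delta>"
  proof -
    have "\<bar>(k * coef True (u 1))\<^sup>2 + (k * coef False (u 1))\<^sup>2 - 1\<bar> \<le> \<delta>"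
      using gram[OF near1 pair1 near1 pair1] unfolding inn power2_eq_square by (subst abs_minus_commute)
    moreover have "\<bar>(k * coef True (u 2))\<^sup>2 + (k * coef False (u 2))\<^sup>2 - 1\<bar> \<le> \<delta>"
      using gram[OF near2 pair2 near2 pair2] unfolding inn power2_eq_square by (subst abs_minus_commute)
    moreover have "\<bar>(k * coef True (u 1)) * (k * coef True (u 2)) + (k * coef False (u 1)) * (k * coef False (u 2))\<bar> \<le> \<delta>"
      using gram[OF near1 pair1 near2 pair2] unfolding inn by (simp only: diff_0 abs_minus_cancel)
    ultimately show ?thesis using nearly_orthonormal_pair \<delta>(2) that by blast
  qed
  define R where "R = s * mu n r 1 * k"
  have R: "s * real r / sqrt n \<le> R" "0 < R"
  proof -
    have "1 / sqrt n \<le> k" using n0 by (simp add: k_def real_sqrt_divide divide_right_mono)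
    then have "(s * real r) * (1 / sqrt n) \<le> (s * mu n r 1) * k"
      using mu_1_bounds s_pos n0 real_r by (intro mult_mono) auto
    then show "s * real r / sqrt n \<le> R" by (simp add: R_def)
    moreover have "0 < s * real r / sqrt n" using s_pos real_r n0 by simp
    ultimately show "0 < R" by linarith
  qed
  define E where "E = 56 * L + 44 * (N * rho / sqrt n) + q"
  have E0: "0 \<le> E" using L N_nonneg rho_ge q_nonneg n0 by (simp add: E_def)
  have entry: "\<bar>eig l * u l a / R - (k * coef True (u l) * cos (2 * pi * real (p a) / n) + k * coef False (u l) * sin (2 * pi * real (p a) / n))\<bar> \<le> E / R"
    if nl: "\<bar>e l - s * mu n r 1\<bar> \<le> N" and pl: "eigenpair (e l) (u l)" and a: "a < n" for l a
  proof -
    have "\<bar>u l a\<bar> \<le> 1" using abs_le_nrm[OF a, of "u l"] pl by (simp add: eigenpair_def)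
    then have "\<bar>q * u l a\<bar> \<le> q" using q_nonneg by (simp add: abs_mult mult_left_le)
    moreover have "\<bar>e l * u l a - main (u l) a\<bar> \<le> 56 * L + 44 * (N * rho / sqrt n)"
      by (rule entry_approx[OF nl pl a L walks[OF a]])
    ultimately have "\<bar>eig l * u l a - main (u l) a\<bar> \<le> E"
      unfolding E_def e_def distrib_right by linarith
    then have "\<bar>eig l * u l a - main (u l) a\<bar> / R \<le> E / R" using R by (intro divide_right_mono) auto
    moreover have "main (u l) a = R * (k * coef True (u l) * cos (2 * pi * real (p a) / n) + k * coef False (u l) * sin (2 * pi * real (p a) / n))"
    proof -
      have "R * (k * coef True (u l) * c + k * coef False (u l) * d) = (s * mu n r 1) * (k * k) * (coef True (u l) * c + coef False (u l) * d)" for c d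
        by (simp add: R_def algebra_simps)
      then show ?thesis unfolding k2 by (simp add: main_def mode_def harmonic_def)
    qed
    ultimately show ?thesis using R by (simp add: diff_divide_distrib[symmetric] abs_divide divide_simps mult.commute)
  qed
  have total: "4 * \<delta> + E / R \<le> entry_error L"
  proof -
    have "E / R \<le> E / (s * real r / sqrt n)"
      using R E0 s_pos real_r n0 by (intro divide_left_mono mult_pos_pos divide_pos_pos) auto
    also have "\<dots> = (56 * L + q) * sqrt n / (s * real r) + 44 * (N * rho / (s * real r))"
      using n0 s_pos real_r by (simp add: E_def field_simps)
    also have "N * rho / (s * real r) = \<epsilon>"
      using rho_ge s_pos G_pos unfolding \<epsilon>_def G_rho[symmetric] by simp
    finally show ?thesis using \<delta> unfolding entry_error_def \<epsilon>_def[symmetric] by linarith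
  qed
  have "circ_dist (spectral_angle A U a - \<sigma> * (2 * pi * real (p a) / n - \<psi>)) \<le> 8 * entry_error L" if a: "a < n" for a
    unfolding spectral_angle_eq[OF dec n2(2) a]
  proof (rule Arg_near[OF R(2) _ _ small])
    show "\<bar>eig 1 * U $$ (a, 1) / R - cos (\<sigma> * (2 * pi * real (p a) / n - \<psi>))\<bar> \<le> entry_error L"
      using entry[OF near1 pair1 a] rot(1)[of "2 * pi * real (p a) / n"] total unfolding u_def by linarith
    show "\<bar>eig 2 * U $$ (a, 2) / R - sin (\<sigma> * (2 * pi * real (p a) / n - \<psi>))\<bar> \<le> entry_error L"
      using entry[OF near2 pair2 a] rot(2)[of "2 * pi * real (p a) / n"] total unfolding u_def by linarith
  qed
  then show ?thesis using \<sigma> by blast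
qed

lemma neighborhood_recovery:
  assumes ord: "spectral_ordering n (2 * r) A Nhat"
    and A: "\<And>a b. a < n \<Longrightarrow> b < n \<Longrightarrow> A $$ (a, b) + (if a = b then q else 0) = M a b + W a b"
    and L: "0 \<le> L"
    and walks: "\<And>a t j. a < n \<Longrightarrow> t \<in> modes \<Longrightarrow> j < n \<Longrightarrow> \<bar>walk n W a j (mode t)\<bar> \<le> L * nrm n ((mv n (minor a W) ^^ j) (mode t))"
    and small: "8 * entry_error L * n \<le> real r" and i: "i < n"
  shows "real (card (sym_diff (Nhat i) {j. j < n \<and> ring_adj n r (p i) (p j)})) \<le> 32 * entry_error L * n"
proof -
  define e where "e = entry_error L"
  have e0: "0 \<le> e"
    using N_nonneg s_pos G_pos L q_nonneg unfolding e_def entry_error_def by simp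
  have "8 * e * n \<le> real n / 16" using small real_r unfolding e_def by linarith
  then have "8 * e \<le> 1 / 16" using real_r by (simp add: field_simps)
  then have e4: "e \<le> 1 / 4" by linarith
  obtain U eig where dec: "spectral_decomposition n A U eig"
    and nn: "nearest_nodes n (2 * r) (spectral_angle A U) i (Nhat i)"
    using ord i unfolding spectral_ordering_def by blast
  define \<theta> where "\<theta> = spectral_angle A U"
  obtain \<psi> \<sigma> where \<sigma>: "\<bar>\<sigma>\<bar> = 1" and near: "\<And>a. a < n \<Longrightarrow> circ_dist (\<theta> a - \<sigma> * (2 * pi * real (p a) / n - \<psi>)) \<le> 8 * e"
  proof -
    have "\<exists>\<psi> \<sigma>. \<bar>\<sigma>\<bar> = 1 \<and> (\<forall>a<n. circ_dist (\<theta> a - \<sigma> * (2 * pi * real (p a) / n - \<psi>)) \<le> 8 * e)"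
      unfolding \<theta>_def e_def by (rule spectral_angle_near[OF dec A L walks]) (use e4 in \<open>auto simp: e_def\<close>)
    then show ?thesis using that by blast
  qed
  have dist: "\<bar>angle_dist (\<theta> i) (\<theta> j) - 2 * pi / n * ring_dist n (p i) (p j)\<bar> \<le> 16 * e" if j: "j < n" for j
  proof -
    define f where "f a = \<sigma> * (2 * pi * real (p a) / n - \<psi>)" for a
    have ad: "angle_dist (\<theta> i) (\<theta> j) = circ_dist (\<theta> i - \<theta> j)"
      unfolding \<theta>_def spectral_angle_def by (intro angle_dist_circ_dist mpi_less_Arg Arg_le_pi)
    have "circ_dist (f i - f j) = circ_dist (2 * pi * real (p i) / n - 2 * pi * real (p j) / n)"
    proof -
      consider "\<sigma> = 1" | "\<sigma> = - 1" using \<sigma> by linarith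
      then show ?thesis
      proof cases
        case 2
        then have "f i - f j = - (2 * pi * real (p i) / n - 2 * pi * real (p j) / n)" by (simp add: f_def)
        then show ?thesis by (simp only: circ_dist_minus)
      qed (simp add: f_def)
    qed
    then have fd: "circ_dist (f i - f j) = 2 * pi / n * ring_dist n (p i) (p j)"
      using ring_dist_circ_dist[OF p_less[OF i] p_less[OF j]] by simp
    have c: "circ_dist (\<theta> i - f i) \<le> 8 * e" "circ_dist (\<theta> j - f j) \<le> 8 * e"
      "circ_dist (f i - \<theta> i) \<le> 8 * e" "circ_dist (f j - \<theta> j) \<le> 8 * e"
      using near[OF i] near[OF j] circ_dist_minus[of "\<theta> i - f i"] circ_dist_minus[of "\<theta> j - f j"] by (auto simp: f_def)
    have "circ_dist (\<theta> i - \<theta> j) \<le> circ_dist (f i - f j) + 16 * e"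
      using circ_dist_triangle[of "\<theta> i - f i" "(f i - f j) + (f j - \<theta> j)"] circ_dist_triangle[of "f i - f j" "f j - \<theta> j"] c by simp
    moreover have "circ_dist (f i - f j) \<le> circ_dist (\<theta> i - \<theta> j) + 16 * e"
      using circ_dist_triangle[of "f i - \<theta> i" "(\<theta> i - \<theta> j) + (\<theta> j - f j)"] circ_dist_triangle[of "\<theta> i - \<theta> j" "\<theta> j - f j"] c by simp
    ultimately show ?thesis unfolding ad fd by linarith
  qed
  \<comment> \<open>An error of \<open>16 e\<close> in the angular distance can exchange nodes that are \<open>32 e\<close> apart, that is \<open>16 e n / \<pi>\<close> steps.\<close>
  define T where "T = nat \<lfloor>n * (16 * e) / pi\<rfloor>"
  have T0: "0 \<le> n * (16 * e) / pi" using e0 by simp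
  have T: "n * (16 * e) / pi < real T + 1" "real T \<le> n * (16 * e) / pi" using T0 unfolding T_def by linarith+
  have "n * (16 * e) / pi \<le> n * (16 * e) / 2" using e0 pi_ge_two by (intro divide_left_mono) auto
  then have T8: "real T \<le> 8 * e * n" using T by simp
  then have "T \<le> r" using small unfolding e_def by linarith
  then have "2 * (r + T) \<le> 4 * r" by simp
  also have "\<dots> < 16 * r" using r_pos by simp
  also have "\<dots> \<le> n" by (rule r_le)
  finally have "2 * (r + T) < n" .
  then have "card (sym_diff (Nhat i) {j. j < n \<and> ring_adj n r (p i) (p j)}) \<le> 4 * T"
    using nn T dist unfolding \<theta>_def by (intro nearest_nodes_error[OF p i]) auto
  then have "real (card (sym_diff (Nhat i) {j. j < n \<and> ring_adj n r (p i) (p j)})) \<le> 4 * real T" by linarith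
  then show ?thesis using T8 unfolding e_def by linarith
qed

end

lemma cross_prob_bounds:
  fixes n r :: nat and \<beta> :: real
  assumes "0 < r" "16 * r \<le> n" "0 \<le> \<beta>" "\<beta> \<le> 1"
  shows "0 \<le> \<beta> * (real (2 * r) / (real n - 1))" "\<beta> * (real (2 * r) / (real n - 1)) \<le> 1 / 2"
proof -
  have n: "16 \<le> real n" "16 * real r \<le> real n" using assms(1,2) by auto
  then have "real (2 * r) / (real n - 1) \<le> 1 / 2" by (simp add: field_simps)
  then have "\<beta> * (real (2 * r) / (real n - 1)) \<le> 1 * (1 / 2)" using assms n by (intro mult_mono) auto
  then show "\<beta> * (real (2 * r) / (real n - 1)) \<le> 1 / 2" by simp
  show "0 \<le> \<beta> * (real (2 * r) / (real n - 1))"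
    using assms n by (intro mult_nonneg_nonneg divide_nonneg_nonneg) auto
qed

lemma edge_prob_eq:
  fixes r :: nat and \<beta> :: real
  assumes \<pi>: "\<pi> permutes {..<n}" and ij: "i < n" "j < n" "i \<noteq> j"
  defines "q \<equiv> \<beta> * (real (2 * r) / (real n - 1))"
  shows "edge_prob n (2 * r) \<beta> \<pi> i j = (1 - \<beta>) * (1 - q) * of_bool (ring_adj n r (inv \<pi> i) (inv \<pi> j)) + q"
proof -
  have lt: "inv \<pi> i < n" "inv \<pi> j < n"
    using permutes_in_image[OF permutes_inv[OF \<pi>]] ij by auto
  have "permuted_lattice n (2 * r) \<pi> $$ (i, j) = 1 \<longleftrightarrow> ring_adj n r (inv \<pi> i) (inv \<pi> j)"
  proof -
    have "real_of_int (ring_dist n (inv \<pi> i) (inv \<pi> j)) \<le> real r \<longleftrightarrow> ring_dist n (inv \<pi> i) (inv \<pi> j) \<le> int r" by linarith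
    then show ?thesis unfolding permuted_lattice_index[OF \<pi> ij(1,2)] using lt
      by (simp add: ring_lattice_def ring_adj_def)
  qed
  then have "edge_prob n (2 * r) \<beta> \<pi> i j = (if ring_adj n r (inv \<pi> i) (inv \<pi> j) then 1 - \<beta> * (1 - q) else q)"
    unfolding edge_prob_def q_def by (simp only:)
  then show ?thesis by (simp add: algebra_simps)
qed

lemma nbhd_eq:
  assumes \<pi>: "\<pi> permutes {..<n}" and i: "i < n"
  shows "nbhd n (2 * r) \<pi> i = {j. j < n \<and> ring_adj n r (inv \<pi> i) (inv \<pi> j)}"
proof -
  have inj: "inv \<pi> i = inv \<pi> j \<longleftrightarrow> i = j" for j
    using permutes_inj[OF permutes_inv[OF \<pi>]] by (auto simp: inj_def)
  have "real_of_int x \<le> real r \<longleftrightarrow> x \<le> int r" for x by linarith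
  then show ?thesis by (auto simp: nbhd_def ring_adj_def inj)
qed

abbreviation recovered :: "nat \<Rightarrow> nat \<Rightarrow> (nat \<Rightarrow> nat) \<Rightarrow> real \<Rightarrow> real mat set" where
  "recovered n k \<pi> \<epsilon> \<equiv> {A. \<forall>Nhat. spectral_ordering n k A Nhat \<longrightarrow> max_nbhd_error n k \<pi> Nhat \<le> \<epsilon>}"

text \<open>There are \<open>2 n\<^sup>3\<close> walk events (node, mode, length below \<open>n\<close>). With \<open>L = 2 sqrt (ln n)\<close> each fails with
probability at most \<open>2 / n\<^sup>8\<close>, which leaves \<open>4 / n\<^sup>5\<close>.\<close>
lemma recovery_probability:
  fixes n r :: nat and \<beta> q s e :: real
  assumes \<pi>: "\<pi> permutes {..<n}" and r: "0 < r" "16 * r \<le> n" and \<beta>: "0 \<le> \<beta>" "\<beta> < 1"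
  defines "q \<equiv> \<beta> * (real (2 * r) / (real n - 1))"
  defines "s \<equiv> (1 - \<beta>) * (1 - q)"
  defines "e \<equiv> 45 * (37 * sqrt n / (s * (real r ^ 3 / (real n)\<^sup>2))) + (56 * (2 * sqrt (ln n)) + q) * sqrt n / (s * real r)"
  assumes small: "8 * e * n \<le> real r"
  shows "1 - (2 * exp (- real n) + 4 / real n ^ 5) \<le> measure_pmf.prob (WS n (2 * r) \<beta> \<pi>) (recovered n (2 * r) \<pi> (16 * (e * n / real r)))"
    (is "_ \<le> measure_pmf.prob _ ?good")
proof -
  define L where "L = 2 * sqrt (ln n)"
  define pr where "pr e = edge_prob n (2 * r) \<beta> \<pi> (fst e) (snd e)" for e
  define P where "P = edge_law n pr"
  define mat where "mat E = Matrix.mat n n (\<lambda>(i, j). if i < j \<and> E (i, j) \<or> j < i \<and> E (j, i) then 1 else 0 :: real)" for E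
  define p where "p = inv \<pi>"
  have n: "16 \<le> n" "0 < n" using r by auto
  have rn: "0 < real r" "16 * real r \<le> real n" "16 \<le> real n" using r n by auto
  have q: "0 \<le> q" "q \<le> 1 / 2" unfolding q_def by (rule cross_prob_bounds[OF r \<beta>(1) less_imp_le[OF \<beta>(2)]])+
  have s: "0 < s" "s \<le> 1 - q"
    using \<beta> q by (auto simp: s_def intro: mult_left_le_one_le)
  have WS: "WS n (2 * r) \<beta> \<pi> = map_pmf mat P"
    unfolding WS_def P_def mat_def pr_def node_pairs_def by (simp add: case_prod_unfold)
  have L: "0 \<le> L" using n by (simp add: L_def)
  have p: "bij_betw p {..<n} {..<n}" unfolding p_def by (rule permutes_imp_bij[OF permutes_inv[OF \<pi>]])
  have pr: "pr (i, j) = s * of_bool (ring_adj n r (p i) (p j)) + q" if "i < n" "j < n" "i \<noteq> j" for i j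
    using edge_prob_eq[OF \<pi> that, of r \<beta>] by (simp add: pr_def q_def s_def p_def)
  have pr01: "0 \<le> pr e \<and> pr e \<le> 1" if "e \<in> node_pairs n" for e
    using that pr[of "fst e" "snd e"] s q by (auto simp: node_pairs_def of_bool_def)
  define N where "N = 37 * sqrt n"
  define G where "G = real r ^ 3 / (real n)\<^sup>2"
  have G: "0 < G" using rn by (simp add: G_def)
  have N_small: "N \<le> s * G"
  proof -
    have "0 \<le> (56 * L + q) * sqrt n / (s * real r)" using L q s rn by simp
    then have "45 * (N / (s * G)) \<le> e" by (simp add: e_def N_def G_def L_def)
    then have "8 * (45 * (N / (s * G))) * n \<le> real n" 
      using small rn mult_right_mono[of "45 * (N / (s * G))" e "8 * real n"] by simp
    then have "(360 * (N / (s * G))) * real n \<le> 1 * real n" by simp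
    then have "360 * (N / (s * G)) \<le> 1" by (rule mult_right_le_imp_le) (use rn in simp)
    then have "N / (s * G) \<le> 1" by linarith
    then show ?thesis using s G by simp
  qed
  define badop where "badop = {E. \<not> opnorm_le n (noise pr E) N}"
  define badwalk where "badwalk x = {E. L * nrm n ((mv n (minor (fst x) (noise pr E)) ^^ snd (snd x)) (\<lambda>a. harmonic n (fst (snd x)) (p a)))
      < \<bar>walk n (noise pr E) (fst x) (snd (snd x)) (\<lambda>a. harmonic n (fst (snd x)) (p a))\<bar>}" for x
  define X where "X = {..<n} \<times> (({..<n} \<times> (UNIV :: bool set)) \<times> {..<n})"
  have sub: "- (badop \<union> (\<Union>x\<in>X. badwalk x)) \<subseteq> mat -` ?good"
  proof
    fix E assume E: "E \<in> - (badop \<union> (\<Union>x\<in>X. badwalk x))"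
    define W where "W = noise pr E"
    interpret noisy_ring n r p s q W N
    proof
      show "opnorm_le n W N" using E by (simp add: badop_def W_def)
      show "N \<le> s * (real r ^ 3 / (real n)\<^sup>2)" using N_small by (simp add: G_def)
    qed (use p r s q in \<open>simp_all add: W_def noise_diag noise_sym[of pr E]\<close>)
    have A: "mat E $$ (a, b) + (if a = b then q else 0) = M a b + W a b" if ab: "a < n" "b < n" for a b
    proof (cases a b rule: linorder_cases)
      case less
      then show ?thesis using ab pr[of a b] by (simp add: mat_def M_def W_def noise_def of_bool_def)
    next
      case equal
      then show ?thesis using ab by (simp add: mat_def M_def W_def noise_diag ring_adj_def)
    next
      case greater
      then show ?thesis using ab pr[of b a] by (simp add: mat_def M_def W_def noise_def ring_adj_commute[of n r "p a"] of_bool_def)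
    qed
    have walks: "\<bar>walk n W a j (mode t)\<bar> \<le> L * nrm n ((mv n (minor a W) ^^ j) (mode t))"
      if "a < n" "t \<in> modes" "j < n" for a t j
    proof -
      have "(a, t, j) \<in> X" using that by (auto simp: X_def modes_def)
      then have "E \<notin> badwalk (a, t, j)" using E by blast
      then show ?thesis by (simp add: badwalk_def not_less W_def mode_def[abs_def])
    qed
    have err: "entry_error L = e"
      unfolding entry_error_def noisy_ring.G_def[OF noisy_ring_axioms] unfolding e_def N_def L_def ..
    have "max_nbhd_error n (2 * r) \<pi> Nhat \<le> 16 * (e * n / real r)" if ord: "spectral_ordering n (2 * r) (mat E) Nhat" for Nhat
    proof -
      have "real (card (sym_diff (Nhat i) (nbhd n (2 * r) \<pi> i))) / real (card (nbhd n (2 * r) \<pi> i)) \<le> 16 * (e * n / real r)" if i: "i < n" for i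
      proof -
        have c: "card (nbhd n (2 * r) \<pi> i) = 2 * r"
        proof -
          have "card (p ` nbhd n (2 * r) \<pi> i) = card (nbhd n (2 * r) \<pi> i)"
            by (rule card_image, rule inj_on_subset[OF bij_betw_imp_inj_on[OF p]]) (auto simp: nbhd_def)
          moreover have "p ` nbhd n (2 * r) \<pi> i = {y. y < n \<and> ring_adj n r (p i) y}"
            unfolding nbhd_eq[OF \<pi> i] p_def[symmetric] using p unfolding bij_betw_def by auto
          moreover have "card {y. y < n \<and> ring_adj n r (p i) y} = 2 * r"
            using r by (intro card_ring_adj p_less i) auto
          ultimately show ?thesis by simp
        qed
        have "real (card (sym_diff (Nhat i) (nbhd n (2 * r) \<pi> i))) \<le> 32 * e * n"
          using neighborhood_recovery[OF ord A L walks _ i] small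
          unfolding nbhd_eq[OF \<pi> i] p_def[symmetric] err by simp
        then have "real (card (sym_diff (Nhat i) (nbhd n (2 * r) \<pi> i))) / (2 * real r) \<le> 32 * e * n / (2 * real r)"
          using rn by (intro divide_right_mono) auto
        then show ?thesis unfolding c by simp
      qed
      then show ?thesis unfolding max_nbhd_error_def using n by (subst Max_le_iff) (auto simp: lessThan_empty_iff)
    qed
    then show "E \<in> mat -` ?good" by simp
  qed
  have bad: "measure_pmf.prob P (badop \<union> (\<Union>x\<in>X. badwalk x)) \<le> 2 * exp (- real n) + 4 / real n ^ 5"
  proof -
    have "measure_pmf.prob P badop \<le> 2 * exp (- real n)"
      unfolding P_def badop_def N_def by (rule noise_opnorm_tail[OF pr01 n(2)])
    moreover have "measure_pmf.prob P (\<Union>x\<in>X. badwalk x) \<le> 4 / real n ^ 5"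
    proof -
      have finX: "finite X" by (simp add: X_def)
      have expL: "exp (- 2 * L\<^sup>2) = 1 / real n ^ 8"
      proof -
        have "L\<^sup>2 = 4 * ln n" using n by (simp add: L_def power_mult_distrib)
        then have "exp (- 2 * L\<^sup>2) = exp (- (8 * ln n))" by simp
        also have "\<dots> = 1 / exp (ln n) ^ 8" by (simp add: exp_minus exp_of_nat_mult[of 8, simplified] inverse_eq_divide)
        finally show ?thesis using n by simp
      qed
      have "measure_pmf.prob P (\<Union>x\<in>X. badwalk x) \<le> (\<Sum>x\<in>X. measure_pmf.prob P (badwalk x))"
        by (rule measure_pmf.finite_measure_subadditive_finite) (auto simp: finX)
      also have "\<dots> \<le> (\<Sum>x\<in>X. 2 * exp (- 2 * L\<^sup>2))"
        unfolding P_def badwalk_def by (intro sum_mono walk_noise_tail pr01 L) (auto simp: X_def)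
      also have "\<dots> = 2 * real n ^ 3 * (2 / real n ^ 8)"
        unfolding expL by (simp add: X_def card_cartesian_product power3_eq_cube)
      also have "\<dots> = 4 / real n ^ 5" using n by (simp add: field_simps flip: power_add)
      finally show ?thesis .
    qed
    ultimately show ?thesis
      by (intro order_trans[OF measure_Un_le]) auto
  qed
  have "1 - measure_pmf.prob P (badop \<union> (\<Union>x\<in>X. badwalk x)) = measure_pmf.prob P (- (badop \<union> (\<Union>x\<in>X. badwalk x)))"
    using measure_pmf.prob_compl[of "badop \<union> (\<Union>x\<in>X. badwalk x)" P] by (simp add: Compl_eq_Diff_UNIV)
  also have "\<dots> \<le> measure_pmf.prob P (mat -` ?good)" by (intro measure_pmf.finite_measure_mono sub) auto
  also have "\<dots> = measure_pmf.prob (WS n (2 * r) \<beta> \<pi>) ?good" unfolding WS by simp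
  finally show ?thesis using bad by linarith
qed

section \<open>Asymptotics\<close>

text \<open>The quotient that the hypothesis on \<open>1 - \<beta>\<close> sends to \<open>0\<close>.\<close>
definition signal_ratio :: "nat \<Rightarrow> nat \<Rightarrow> real \<Rightarrow> real" where
  "signal_ratio n k \<beta> = (real n powr 3.5 / real k ^ 4) / (1 - \<beta>)"

text \<open>A bound for the relative error of an entry in units of \<open>r / n\<close>. Both parts of \<open>entry_error\<close> are multiples of
\<open>signal_ratio\<close>; the row noise carries the extra factor \<open>(k / n)\<^sup>2\<close>, which defeats its logarithm when \<open>k\<close> is
at most a power of \<open>n\<close> with exponent below \<open>1\<close>.\<close>
definition error_rate :: "nat \<Rightarrow> nat \<Rightarrow> real \<Rightarrow> real" where
  "error_rate n k \<beta> = signal_ratio n k \<beta> * (53280 + 8 * (112 * sqrt (ln n) + 1) * (real k / real n)\<^sup>2)"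

lemma entry_error_le_rate:
  fixes n r :: nat and \<beta> q s :: real
  assumes r: "0 < r" "16 * r \<le> n" and \<beta>: "\<beta> < 1" and q: "0 \<le> q" "q \<le> 1 / 2" and s: "s = (1 - \<beta>) * (1 - q)"
  shows "(45 * (37 * sqrt n / (s * (real r ^ 3 / (real n)\<^sup>2))) + (56 * (2 * sqrt (ln n)) + q) * sqrt n / (s * real r)) * n / real r
    \<le> error_rate n (2 * r) \<beta>"
proof -
  have rn: "0 < real r" "0 < real n" using r by auto
  define y where "y = signal_ratio n (2 * r) \<beta>"
  have pw: "real n powr (7 / 2) = real n ^ 3 * sqrt n"
  proof -
    have "real n powr (7 / 2) = real n powr (3 + 1 / 2)" by simp
    also have "\<dots> = real n powr 3 * real n powr (1 / 2)" by (rule powr_add)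
    finally show ?thesis using rn by (simp add: powr_half_sqrt)
  qed
  have y: "y = real n ^ 3 * sqrt n / ((1 - \<beta>) * (16 * real r ^ 4))"
    by (simp add: y_def signal_ratio_def pw power_mult_distrib mult.commute)
  have y0: "0 \<le> y" unfolding y using \<beta> rn by simp
  have s2: "(1 - \<beta>) / 2 \<le> s"
    using mult_left_mono[of "1 / 2" "1 - q" "1 - \<beta>"] q \<beta> unfolding s by simp
  have b2: "0 < (1 - \<beta>) / 2" using \<beta> by simp
  have sp: "0 < s" "0 < (1 - \<beta>) / 2" by (rule less_le_trans[OF b2 s2], rule b2)
  have inv: "1 / s \<le> 1 / ((1 - \<beta>) / 2)" using s2 sp by (intro divide_left_mono mult_pos_pos) auto
  have a: "37 * sqrt n / (s * (real r ^ 3 / (real n)\<^sup>2)) * n / real r \<le> 1184 * y"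
  proof -
    have "37 * sqrt n / (s * (real r ^ 3 / (real n)\<^sup>2)) * n / real r = (1 / s) * (37 * real n ^ 3 * sqrt n / real r ^ 4)"
      using rn sp by (simp add: field_simps power2_eq_square power3_eq_cube power4_eq_xxxx)
    also have "\<dots> \<le> (1 / ((1 - \<beta>) / 2)) * (37 * real n ^ 3 * sqrt n / real r ^ 4)"
      by (intro mult_right_mono inv) auto
    also have "\<dots> = 1184 * y" unfolding y using rn \<beta> by (simp add: field_simps)
    finally show ?thesis .
  qed
  have lnn: "0 \<le> sqrt (ln n)" using rn r by simp
  have b: "(56 * (2 * sqrt (ln n)) + q) * sqrt n / (s * real r) * n / real r \<le> (112 * sqrt (ln n) + 1) * (8 * (real (2 * r) / real n)\<^sup>2 * y)"
  proof -
    have "(56 * (2 * sqrt (ln n)) + q) * sqrt n / (s * real r) * n / real r = (112 * sqrt (ln n) + q) * ((1 / s) * (sqrt n * n / (real r)\<^sup>2))"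
      using rn sp by (simp add: field_simps power2_eq_square)
    also have "\<dots> \<le> (112 * sqrt (ln n) + 1) * ((1 / ((1 - \<beta>) / 2)) * (sqrt n * n / (real r)\<^sup>2))"
      using q lnn sp by (intro mult_mono inv) auto
    also have "(1 / ((1 - \<beta>) / 2)) * (sqrt n * n / (real r)\<^sup>2) = 8 * (real (2 * r) / real n)\<^sup>2 * y"
      unfolding y using rn \<beta> by (simp add: field_simps power2_eq_square power3_eq_cube power4_eq_xxxx)
    finally show ?thesis .
  qed
  have "(45 * (37 * sqrt n / (s * (real r ^ 3 / (real n)\<^sup>2))) + (56 * (2 * sqrt (ln n)) + q) * sqrt n / (s * real r)) * n / real r
    = 45 * (37 * sqrt n / (s * (real r ^ 3 / (real n)\<^sup>2)) * n / real r) + (56 * (2 * sqrt (ln n)) + q) * sqrt n / (s * real r) * n / real r"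
    by (simp add: add_divide_distrib distrib_right)
  also have "\<dots> \<le> 45 * (1184 * y) + (112 * sqrt (ln n) + 1) * (8 * (real (2 * r) / real n)\<^sup>2 * y)"
    by (intro add_mono mult_left_mono a b) auto
  also have "\<dots> = error_rate n (2 * r) \<beta>"
    unfolding error_rate_def y_def[symmetric] by (simp add: algebra_simps)
  finally show ?thesis .
qed

lemma recovery_probability_rate:
  assumes \<pi>: "\<pi> permutes {..<n}" and k: "even k" "0 < k" "8 * k \<le> n" and \<beta>: "0 \<le> \<beta>" "\<beta> < 1"
    and small: "error_rate n k \<beta> \<le> 1 / 8"
  shows "1 - (2 * exp (- real n) + 4 / real n ^ 5) \<le> measure_pmf.prob (WS n k \<beta> \<pi>) (recovered n k \<pi> (16 * error_rate n k \<beta>))"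
proof -
  obtain r where kr: "k = 2 * r" using k(1) by (rule evenE)
  have r: "0 < r" "16 * r \<le> n" using k kr by auto
  have rn: "0 < real r" "16 * real r \<le> real n" using r by auto
  define q where "q = \<beta> * (real (2 * r) / (real n - 1))"
  define s where "s = (1 - \<beta>) * (1 - q)"
  define e where "e = 45 * (37 * sqrt n / (s * (real r ^ 3 / (real n)\<^sup>2))) + (56 * (2 * sqrt (ln n)) + q) * sqrt n / (s * real r)"
  have q: "0 \<le> q" "q \<le> 1 / 2" unfolding q_def by (rule cross_prob_bounds[OF r \<beta>(1) less_imp_le[OF \<beta>(2)]])+
  have rate: "e * n / real r \<le> error_rate n k \<beta>"
    unfolding e_def kr by (rule entry_error_le_rate[OF r \<beta>(2) q s_def])
  then have "e * n / real r \<le> 1 / 8" using small by linarith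
  then have "8 * e * n \<le> real r" using rn by (simp add: field_simps)
  then have "1 - (2 * exp (- real n) + 4 / real n ^ 5) \<le> measure_pmf.prob (WS n k \<beta> \<pi>) (recovered n k \<pi> (16 * (e * n / real r)))"
    using recovery_probability[OF \<pi> r \<beta>] unfolding e_def s_def q_def kr by blast
  also have "\<dots> \<le> measure_pmf.prob (WS n k \<beta> \<pi>) (recovered n k \<pi> (16 * error_rate n k \<beta>))"
    using rate by (intro measure_pmf.finite_measure_mono) (auto intro: order_trans)
  finally show ?thesis .
qed

theorem lemma4:
  fixes k :: "nat \<Rightarrow> nat" and \<beta> :: "nat \<Rightarrow> real" and \<pi> :: "nat \<Rightarrow> nat \<Rightarrow> nat"
  assumes "\<And>n. even (k n)"
    and "\<And>n. 0 \<le> \<beta> n \<and> \<beta> n \<le> 1"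
    and "\<And>n. \<pi> n permutes {..<n}"
    and "limsup (\<lambda>n. ereal (ln (real (k n)) / ln (real n))) < 1"
    and "liminf (\<lambda>n. ereal (ln (real (k n)) / ln (real n))) > ereal (7 / 8)"
    and "(\<lambda>n. 1 - \<beta> n) \<succ> (\<lambda>n. real n powr 3.5 / real (k n) ^ 4)"
  shows "\<exists>\<epsilon> :: nat \<Rightarrow> real. \<epsilon> \<longlonglongrightarrow> 0 \<and>
    (\<lambda>n. measure_pmf.prob (WS n (k n) (\<beta> n) (\<pi> n))
       {A. \<forall>Nhat. spectral_ordering n (k n) A Nhat \<longrightarrow>
              max_nbhd_error n (k n) (\<pi> n) Nhat \<le> \<epsilon> n}) \<longlonglongrightarrow> 1"
proof -
  have k_pos: "eventually (\<lambda>n. 0 < k n) sequentially"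
  proof -
    have "eventually (\<lambda>n. ereal (7 / 8) < ereal (ln (real (k n)) / ln (real n))) sequentially"
      by (rule less_LiminfD[OF assms(5)])
    then show ?thesis
    proof eventually_elim
      case (elim n)
      then show "0 < k n" by (cases "k n = 0") auto
    qed
  qed
  obtain c where c: "limsup (\<lambda>n. ereal (ln (real (k n)) / ln (real n))) < ereal c" "c < 1"
    using ereal_dense2[OF assms(4)] by (auto simp: one_ereal_def)
  have k_le: "eventually (\<lambda>n. real (k n) / real n \<le> real n powr (c - 1)) sequentially"
    using Limsup_lessD[OF c(1)] k_pos eventually_gt_at_top[of 1]
  proof eventually_elim
    case (elim n)
    then have "ln (real (k n)) < c * ln (real n)" by (simp add: divide_less_eq)
    then have "exp (ln (real (k n))) < exp (c * ln (real n))" by simp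
    then have "real (k n) < real n powr c" using elim by (simp add: powr_def)
    also have "\<dots> = real n powr (c - 1) * real n" using elim by (simp add: powr_diff)
    finally show ?case using elim by (simp add: divide_le_eq)
  qed
  have "((\<lambda>n. real n powr (c - 1)) \<longlongrightarrow> 0) sequentially" using c(2) by real_asymp
  then have "eventually (\<lambda>n. real n powr (c - 1) < 1 / 8) sequentially"
    by (rule order_tendstoD) simp
  then have k8: "eventually (\<lambda>n. 8 * k n \<le> n) sequentially"
    using k_le eventually_gt_at_top[of 0]
  proof eventually_elim
    case (elim n)
    then have "real (k n) / real n \<le> 1 / 8" by linarith
    then have "real (8 * k n) \<le> real n" using elim by (simp add: field_simps)
    then show ?case by (simp only: of_nat_le_iff)
  qed
  define y where "y n = signal_ratio n (k n) (\<beta> n)" for n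
  have ls: "limsup (\<lambda>n. ereal (real n powr 3.5 / real (k n) ^ 4) / ereal (1 - \<beta> n)) = 0"
    using assms(6) by (simp add: asymp_dominates_def)
  have y_less: "eventually (\<lambda>n. \<beta> n < 1 \<and> 0 \<le> y n \<and> y n < \<delta>) sequentially" if "0 < \<delta>" for \<delta>
  proof -
    have "limsup (\<lambda>n. ereal (real n powr 3.5 / real (k n) ^ 4) / ereal (1 - \<beta> n)) < ereal \<delta>"
      unfolding ls using that by simp
    from Limsup_lessD[OF this] k_pos eventually_gt_at_top[of 0]
    show ?thesis
    proof eventually_elim
      case (elim n)
      have num: "0 < real n powr 3.5 / real (k n) ^ 4" using elim by simp
      \<comment> \<open>For \<open>\<beta> n = 1\<close> the quotient in the extended reals is infinite.\<close>
      have b1: "\<beta> n \<noteq> 1"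
      proof
        assume "\<beta> n = 1"
        moreover have "0 < ereal (real n powr 3.5 / real (k n) ^ 4)" using num by simp
        ultimately show False using elim by (simp split: if_splits)
      qed
      then have b: "\<beta> n < 1" using assms(2)[of n] by simp
      then show ?case using elim(1) num by (simp add: y_def signal_ratio_def)
    qed
  qed
  have \<beta>_less: "eventually (\<lambda>n. \<beta> n < 1) sequentially"
    using y_less[of 1] by (auto elim: eventually_mono)
  have y0: "y \<longlonglongrightarrow> 0"
  proof (rule LIMSEQ_I)
    fix \<delta> :: real assume "0 < \<delta>"
    then have "eventually (\<lambda>n. norm (y n - 0) < \<delta>) sequentially"
      using y_less[of \<delta>] by (auto elim: eventually_mono)
    then show "\<exists>no. \<forall>n\<ge>no. norm (y n - 0) < \<delta>" by (simp add: eventually_sequentially)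
  qed
  define g where "g n = 8 * (112 * sqrt (ln n) + 1) * (real (k n) / real n)\<^sup>2" for n :: nat
  have "g \<longlonglongrightarrow> 0"
  proof (rule real_tendsto_sandwich)
    show "eventually (\<lambda>n. 0 \<le> g n) sequentially"
      using eventually_gt_at_top[of 0] by eventually_elim (simp add: g_def)
    show "eventually (\<lambda>n. g n \<le> 8 * (112 * sqrt (ln n) + 1) * (real n powr (c - 1))\<^sup>2) sequentially"
      using k_le eventually_gt_at_top[of 0]
      by eventually_elim (auto simp: g_def intro!: mult_left_mono power_mono)
    show "(\<lambda>n. 8 * (112 * sqrt (ln n) + 1) * (real n powr (c - 1))\<^sup>2) \<longlonglongrightarrow> 0"
      using c(2) by real_asymp
  qed auto
  then have "(\<lambda>n. y n * (53280 + g n)) \<longlonglongrightarrow> 0 * (53280 + 0)"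
    by (intro tendsto_intros y0)
  then have rate0: "(\<lambda>n. error_rate n (k n) (\<beta> n)) \<longlonglongrightarrow> 0"
    by (simp add: error_rate_def y_def g_def)
  then have "eventually (\<lambda>n. error_rate n (k n) (\<beta> n) < 1 / 8) sequentially"
    by (rule order_tendstoD) simp
  then have lower: "eventually (\<lambda>n. 1 - (2 * exp (- real n) + 4 / real n ^ 5) \<le> measure_pmf.prob (WS n (k n) (\<beta> n) (\<pi> n))
       (recovered n (k n) (\<pi> n) (16 * error_rate n (k n) (\<beta> n)))) sequentially"
    using k_pos k8 \<beta>_less
    by eventually_elim (rule recovery_probability_rate, use assms in auto)
  have "(\<lambda>n. measure_pmf.prob (WS n (k n) (\<beta> n) (\<pi> n))
       (recovered n (k n) (\<pi> n) (16 * error_rate n (k n) (\<beta> n)))) \<longlonglongrightarrow> 1"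
  proof (rule real_tendsto_sandwich[OF lower])
    show "(\<lambda>n. 1 - (2 * exp (- real n) + 4 / real n ^ 5)) \<longlonglongrightarrow> 1" by real_asymp
  qed auto
  moreover have "(\<lambda>n. 16 * error_rate n (k n) (\<beta> n)) \<longlonglongrightarrow> 0"
    using tendsto_mult_left[OF rate0, of 16] by simp
  ultimately show ?thesis by (intro exI[of _ "\<lambda>n. 16 * error_rate n (k n) (\<beta> n)"] conjI)
qed

end
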